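(* Let $\mathfrak{A}=\{\mathfrak{A}_k\}_k$ be a holomorphy type and $E$ a complex Banach space with separable dual such that the finite type polynomials are dense in $\mathfrak{A}_k(E)$ for every $k$. If $T:\mathcal{H}_{b\mathfrak{A}}(E)\to\mathcal{H}_{b\mathfrak{A}}(E)$ is a non-trivial convolution operator, then $T$ is strongly mixing in the gaussian sense.
   Context: All Banach spaces are complex. For a Banach space $E$, $\mathcal{P}(^kE)$ is the Banach space of continuous $k$-homogeneous polynomials $P:E\to\mathbb{C}$ with norm $\sup_{\|z\|=1}|P(z)|$ (and $\mathcal{P}(^0E)=\mathbb{C}$); $\overset{\vee}{P}$ is the symmetric $k$-linear form associated to $P$. The finite type polynomials of degree $k$ are the elements of the linear span of $\{\gamma(\cdot)^k:\gamma\in E'\}$, where $E'$ is the dual of $E$. $\mathcal{H}(E)$ is the space of holomorphic functions $E\to\mathbb{C}$; for $f\in\mathcal{H}(E)$, $\frac{d^kf(0)}{k!}$ is the $k$-homogeneous polynomial that is the $k$-th term of the Taylor series of $f$ at $0$. For $P\in\mathcal{P}(^kE)$, $a\in E$, $0\le j\le k$, let $P_{a^j}\in\mathcal{P}(^{k-j}E)$ be $P_{a^j}(x)=\overset{\vee}{P}(a,\dots,a,x,\dots,x)$ with $a$ repeated $j$ times and $x$ repeated $k-j$ times. A Banach ideal of scalar-valued continuous $k$-homogeneous polynomials ($k\ge 0$) is a pair $(\mathfrak{A}_k,\|\cdot\|_{\mathfrak{A}_k})$ such that: (i) for every Banach space $E$, $\mathfrak{A}_k(E)=\mathfrak{A}_k\cap\mathcal{P}(^kE)$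 is a linear subspace of $\mathcal{P}(^kE)$ and $\|\cdot\|_{\mathfrak{A}_k(E)}$ is a norm making it a Banach space; (ii) if $R:E_1\to E$ is bounded and linear and $P\in\mathfrak{A}_k(E)$ then $P\circ R\in\mathfrak{A}_k(E_1)$ and $\|P\circ R\|_{\mathfrak{A}_k(E_1)}\le\|P\|_{\mathfrak{A}_k(E)}\|R\|^k$; (iii) $z\mapsto z^k$ belongs to $\mathfrak{A}_k(\mathbb{C})$ and has norm $1$. A holomorphy type is a sequence $\mathfrak{A}=\{\mathfrak{A}_k\}_{k=0}^\infty$, where each $\mathfrak{A}_k$ is a Banach ideal of $k$-homogeneous polynomials, for which there exist constants $c$ and $C_{k,l}$ with $C_{k,l}\le c^k$ for all $0\le l\le k$ such that for every Banach space $E$, $P\in\mathfrak{A}_k(E)$ and $a\in E$: $P_{a^l}\in\mathfrak{A}_{k-l}(E)$ and $\|P_{a^l}\|_{\mathfrak{A}_{k-l}(E)}\le C_{k,l}\|P\|_{\mathfrak{A}_k(E)}\|a\|^l$. $\mathcal{H}_{b\mathfrak{A}}(E)$ is the set of $f\in\mathcal{H}(E)$ such that $d^kf(0)\in\mathfrak{A}_k(E)$ for every $k$ and $\lim_{k\to\infty}\left\|\frac{d^kf(0)}{k!}\right\|_{\mathfrak{A}_k}^{1/k}=0$; it is a Fréchet space with the seminorms $p_s(f)=\sum_{k=0}^\infty s^k\left\|\frac{d^kf(0)}{k!}\right\|_{\mathfrak{A}_k}$, $s>0$. For $x\in E$, $\tau_x f=f(x+\cdot)$ is the translation operator, which is a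 continuous linear operator on $\mathcal{H}_{b\mathfrak{A}}(E)$. A convolution operator is a continuous linear operator $T$ on $\mathcal{H}_{b\mathfrak{A}}(E)$ with $T\circ\tau_x=\tau_x\circ T$ for every $x\in E$. It is trivial if it is a scalar multiple of the identity. A Borel probability measure on a topological vector space $X$ is gaussian if it is the distribution of an almost surely convergent random series $\sum_{n=0}^\infty g_nx_n$, where $(x_n)\subset X$ and $(g_n)$ is a sequence of independent standard complex gaussian variables. A continuous linear operator $T$ on $X$ is strongly mixing in the gaussian sense if there exists a gaussian $T$-invariant probability measure $\mu$ on $X$ with full support (i.e. strictly positive on non-empty open sets) such that $\lim_{n\to\infty}\mu(A\cap T^{-n}(B))=\mu(A)\mu(B)$ for all measurable $A,B\subset X$. *)

theory Defs
  imports "HOL-Analysis.Analysis" "HOL-Probability.Probability"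
begin

section \<open>Complex Banach spaces\<close>

text \<open>
  A Banach ideal of polynomials and a holomorphy type speak about \<^emph>\<open>all\<close> Banach spaces, so Banach
  spaces are values rather than types: a record consists of a carrier set inside a type \<open>'u\<close>
  together with its own vector space operations and norm. The type \<open>'u\<close> is arbitrary and plays the
  role of the universe; "every Banach space" means every Banach space whose carrier is a subset
  of \<open>'u\<close>.

  Functions on the space that are themselves elements of a function space are set to zero outside
  the carrier, so that equality of functions is equality on the carrier.
\<close>

record 'u cnormed =
  vcarrier :: "'u set"
  vzero :: 'u
  vadd :: "'u \<Rightarrow> 'u \<Rightarrow> 'u"
  vscale :: "complex \<Rightarrow> 'u \<Rightarrow> 'u"
  vnorm :: "'u \<Rightarrow> real"

definition vminus :: "'u cnormed \<Rightarrow> 'u \<Rightarrow> 'u \<Rightarrow> 'u" where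
  "vminus E x y = vadd E x (vscale E (-1) y)"

definition vdist :: "'u cnormed \<Rightarrow> 'u \<Rightarrow> 'u \<Rightarrow> real" where
  "vdist E x y = (if x \<in> vcarrier E \<and> y \<in> vcarrier E then vnorm E (vminus E x y) else 0)"

definition norm_topology :: "'u cnormed \<Rightarrow> 'u topology" where
  "norm_topology E = Metric_space.mtopology (vcarrier E) (vdist E)"

locale complex_normed_space =
  fixes E :: "'u cnormed"
  assumes zero_closed: "vzero E \<in> vcarrier E"
    and add_closed: "\<And>x y. \<lbrakk>x \<in> vcarrier E; y \<in> vcarrier E\<rbrakk> \<Longrightarrow> vadd E x y \<in> vcarrier E"
    and scale_closed: "\<And>a x. x \<in> vcarrier E \<Longrightarrow> vscale E a x \<in> vcarrier E"
    and add_assoc: "\<And>x y z. \<lbrakk>x \<in> vcarrier E; y \<in> vcarrier E; z \<in> vcarrier E\<rbrakk> \<Longrightarrow>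
          vadd E (vadd E x y) z = vadd E x (vadd E y z)"
    and add_commute: "\<And>x y. \<lbrakk>x \<in> vcarrier E; y \<in> vcarrier E\<rbrakk> \<Longrightarrow> vadd E x y = vadd E y x"
    and add_zero: "\<And>x. x \<in> vcarrier E \<Longrightarrow> vadd E x (vzero E) = x"
    and add_neg: "\<And>x. x \<in> vcarrier E \<Longrightarrow> vadd E x (vscale E (-1) x) = vzero E"
    and scale_add: "\<And>a x y. \<lbrakk>x \<in> vcarrier E; y \<in> vcarrier E\<rbrakk> \<Longrightarrow>
          vscale E a (vadd E x y) = vadd E (vscale E a x) (vscale E a y)"
    and add_scale: "\<And>a b x. x \<in> vcarrier E \<Longrightarrow>
          vscale E (a + b) x = vadd E (vscale E a x) (vscale E b x)"
    and scale_scale: "\<And>a b x. x \<in> vcarrier E \<Longrightarrow> vscale E a (vscale E b x) = vscale E (a * b) x"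
    and scale_one: "\<And>x. x \<in> vcarrier E \<Longrightarrow> vscale E 1 x = x"
    and norm_nonneg: "\<And>x. x \<in> vcarrier E \<Longrightarrow> 0 \<le> vnorm E x"
    and norm_eq_zero: "\<And>x. x \<in> vcarrier E \<Longrightarrow> vnorm E x = 0 \<longleftrightarrow> x = vzero E"
    and norm_scale: "\<And>a x. x \<in> vcarrier E \<Longrightarrow> vnorm E (vscale E a x) = cmod a * vnorm E x"
    and norm_triangle: "\<And>x y. \<lbrakk>x \<in> vcarrier E; y \<in> vcarrier E\<rbrakk> \<Longrightarrow>
          vnorm E (vadd E x y) \<le> vnorm E x + vnorm E y"
begin

lemma minus_closed: "x \<in> vcarrier E \<Longrightarrow> y \<in> vcarrier E \<Longrightarrow> vminus E x y \<in> vcarrier E"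
  by (simp add: vminus_def add_closed scale_closed)

lemma minus_telescope:
  assumes "x \<in> vcarrier E" "y \<in> vcarrier E" "z \<in> vcarrier E"
  shows "vadd E (vminus E x y) (vminus E y z) = vminus E x z"
proof -
  have "vadd E (vminus E x y) (vminus E y z)
      = vadd E x (vadd E (vscale E (-1) y) (vadd E y (vscale E (-1) z)))"
    unfolding vminus_def by (intro add_assoc) (use assms in \<open>auto intro: add_closed scale_closed\<close>)
  also have "vadd E (vscale E (-1) y) (vadd E y (vscale E (-1) z))
      = vadd E (vadd E (vscale E (-1) y) y) (vscale E (-1) z)"
    using assms by (intro add_assoc [symmetric]) (auto intro: scale_closed)
  also have "vadd E (vscale E (-1) y) y = vzero E"
    using assms by (metis add_commute add_neg scale_closed)
  also have "vadd E (vzero E) (vscale E (-1) z) = vscale E (-1) z"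
    using assms by (metis add_commute add_zero scale_closed zero_closed)
  finally show ?thesis by (simp add: vminus_def)
qed

lemma minus_swap:
  assumes "x \<in> vcarrier E" "y \<in> vcarrier E"
  shows "vminus E y x = vscale E (-1) (vminus E x y)"
  using assms by (simp add: vminus_def scale_add scale_closed scale_scale scale_one add_commute)

sublocale Metric_space "vcarrier E" "vdist E"
proof
  fix x y
  show "0 \<le> vdist E x y"
    by (simp add: vdist_def norm_nonneg minus_closed)
  show "vdist E x y = vdist E y x"
    by (auto simp: vdist_def minus_swap [of x y] norm_scale minus_closed)
next
  fix x y assume xy: "x \<in> vcarrier E" "y \<in> vcarrier E"
  have "x = y" if "vminus E x y = vzero E"
  proof -
    have "vadd E (vminus E x y) y = x"
      using xy by (metis add_assoc add_commute add_neg add_zero scale_closed vminus_def)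
    moreover have "vadd E (vzero E) y = y"
      using xy by (metis add_commute add_zero zero_closed)
    ultimately show ?thesis using that by simp
  qed
  moreover have "vminus E x y = vzero E" if "x = y"
    using that xy by (simp add: vminus_def add_neg)
  ultimately show "(vdist E x y = 0) = (x = y)"
    using xy by (auto simp: vdist_def norm_eq_zero minus_closed)
next
  fix x y z assume "x \<in> vcarrier E" "y \<in> vcarrier E" "z \<in> vcarrier E"
  then show "vdist E x z \<le> vdist E x y + vdist E y z"
    using norm_triangle [of "vminus E x y" "vminus E y z"]
    by (simp add: vdist_def minus_telescope minus_closed)
qed

end

locale complex_banach = complex_normed_space +
  assumes complete: mcomplete

definition complex_space :: "complex cnormed" where
  "complex_space = \<lparr>vcarrier = UNIV, vzero = 0, vadd = (+), vscale = (*), vnorm = cmod\<rparr>"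

definition function_space :: "('a \<Rightarrow> complex) set \<Rightarrow> (('a \<Rightarrow> complex) \<Rightarrow> real) \<Rightarrow> ('a \<Rightarrow> complex) cnormed"
  where "function_space F n =
    \<lparr>vcarrier = F, vzero = (\<lambda>x. 0), vadd = (\<lambda>f g x. f x + g x), vscale = (\<lambda>c f x. c * f x), vnorm = n\<rparr>"

definition bounded_linear_map :: "'a cnormed \<Rightarrow> 'b cnormed \<Rightarrow> ('a \<Rightarrow> 'b) \<Rightarrow> bool" where
  "bounded_linear_map E F R \<longleftrightarrow>
     (\<forall>x\<in>vcarrier E. R x \<in> vcarrier F) \<and>
     (\<forall>x\<in>vcarrier E. \<forall>y\<in>vcarrier E. R (vadd E x y) = vadd F (R x) (R y)) \<and>
     (\<forall>a. \<forall>x\<in>vcarrier E. R (vscale E a x) = vscale F a (R x)) \<and>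
     (\<exists>K. \<forall>x\<in>vcarrier E. vnorm F (R x) \<le> K * vnorm E x)"

text \<open>As for \<^const>\<open>onorm\<close>, the quotient is \<open>0\<close> at the zero vector.\<close>

definition op_norm :: "'a cnormed \<Rightarrow> 'b cnormed \<Rightarrow> ('a \<Rightarrow> 'b) \<Rightarrow> real" where
  "op_norm E F R = (SUP x\<in>vcarrier E. vnorm F (R x) / vnorm E x)"

definition zero_off :: "'u cnormed \<Rightarrow> ('u \<Rightarrow> complex) \<Rightarrow> 'u \<Rightarrow> complex" where
  "zero_off E f x = (if x \<in> vcarrier E then f x else 0)"

definition dual_space :: "'u cnormed \<Rightarrow> ('u \<Rightarrow> complex) cnormed" where
  "dual_space E = function_space
     {\<gamma>. bounded_linear_map E complex_space \<gamma> \<and> (\<forall>x. x \<notin> vcarrier E \<longrightarrow> \<gamma> x = 0)}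
     (op_norm E complex_space)"


section \<open>Homogeneous polynomials\<close>

text \<open>A \<open>k\<close>-linear form takes its arguments as a list of length \<open>k\<close>.\<close>

definition multilinear_form :: "'u cnormed \<Rightarrow> nat \<Rightarrow> ('u list \<Rightarrow> complex) \<Rightarrow> bool" where
  "multilinear_form E k L \<longleftrightarrow>
     (\<forall>xs i x y a b. set xs \<subseteq> vcarrier E \<and> length xs = k \<and> i < k \<and> x \<in> vcarrier E \<and> y \<in> vcarrier E \<longrightarrow>
        L (xs[i := vadd E (vscale E a x) (vscale E b y)]) = a * L (xs[i := x]) + b * L (xs[i := y]))"

definition symmetric_form :: "'u cnormed \<Rightarrow> nat \<Rightarrow> ('u list \<Rightarrow> complex) \<Rightarrow> bool" where
  "symmetric_form E k L \<longleftrightarrow>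
     (\<forall>xs ys. set xs \<subseteq> vcarrier E \<and> length xs = k \<and> mset xs = mset ys \<longrightarrow> L xs = L ys)"

definition hpoly :: "'u cnormed \<Rightarrow> nat \<Rightarrow> ('u \<Rightarrow> complex) set" where
  "hpoly E k = {P. (\<exists>L. multilinear_form E k L \<and> (\<forall>x\<in>vcarrier E. P x = L (replicate k x))) \<and>
     continuous_map (norm_topology E) euclidean P \<and> (\<forall>x. x \<notin> vcarrier E \<longrightarrow> P x = 0)}"

text \<open>The symmetric \<open>k\<close>-linear form of a polynomial; the last conjunct only normalises junk
  arguments, so that the form is unique (polarisation).\<close>

definition assoc_form :: "'u cnormed \<Rightarrow> nat \<Rightarrow> ('u \<Rightarrow> complex) \<Rightarrow> 'u list \<Rightarrow> complex" where
  "assoc_form E k P = (THE L. multilinear_form E k L \<and> symmetric_form E k L \<and>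
     (\<forall>x\<in>vcarrier E. L (replicate k x) = P x) \<and>
     (\<forall>xs. \<not> (set xs \<subseteq> vcarrier E \<and> length xs = k) \<longrightarrow> L xs = 0))"

text \<open>\<open>hpoly_at E k P a j\<close> is \<open>P\<^bsub>a^j\<^esub>\<close>.\<close>

definition hpoly_at :: "'u cnormed \<Rightarrow> nat \<Rightarrow> ('u \<Rightarrow> complex) \<Rightarrow> 'u \<Rightarrow> nat \<Rightarrow> 'u \<Rightarrow> complex" where
  "hpoly_at E k P a j = zero_off E (\<lambda>x. assoc_form E k P (replicate j a @ replicate (k - j) x))"

definition finite_type :: "'u cnormed \<Rightarrow> nat \<Rightarrow> ('u \<Rightarrow> complex) set" where
  "finite_type E k =
     {zero_off E (\<lambda>x. \<Sum>i<m. c i * (\<gamma> i x) ^ k) | (m :: nat) c \<gamma>. \<forall>i<m. \<gamma> i \<in> vcarrier (dual_space E)}"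


section \<open>Banach ideals of polynomials and holomorphy types\<close>

text \<open>
  An ideal of \<open>k\<close>-homogeneous polynomials assigns to each Banach space \<open>E\<close> a set \<open>A E\<close> of
  polynomials and a norm \<open>n E\<close>. The last clause is the normalisation for \<open>z \<mapsto> z^k\<close> on \<open>\<complex>\<close>: the
  space \<open>\<complex>\<close> enters through its isometric copies \<open>C\<close> inside the universe \<open>'u\<close> (all copies are
  equivalent by the composition clause, and any nonzero Banach space in \<open>'u\<close> contains one).
\<close>

definition banach_ideal ::
  "nat \<Rightarrow> ('u cnormed \<Rightarrow> ('u \<Rightarrow> complex) set) \<Rightarrow> ('u cnormed \<Rightarrow> ('u \<Rightarrow> complex) \<Rightarrow> real) \<Rightarrow> bool" where
  "banach_ideal k A n \<longleftrightarrow>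
     (\<forall>E. complex_banach E \<longrightarrow>
        A E \<subseteq> hpoly E k \<and> complex_banach (function_space (A E) (n E))) \<and>
     (\<forall>E\<^sub>1 E R P. complex_banach E\<^sub>1 \<and> complex_banach E \<and> bounded_linear_map E\<^sub>1 E R \<and> P \<in> A E \<longrightarrow>
        zero_off E\<^sub>1 (P \<circ> R) \<in> A E\<^sub>1 \<and> n E\<^sub>1 (zero_off E\<^sub>1 (P \<circ> R)) \<le> n E P * op_norm E\<^sub>1 E R ^ k) \<and>
     (\<forall>C \<phi>. complex_banach C \<and> bounded_linear_map C complex_space \<phi> \<and>
        bij_betw \<phi> (vcarrier C) UNIV \<and> (\<forall>z\<in>vcarrier C. cmod (\<phi> z) = vnorm C z) \<longrightarrow>
        zero_off C (\<lambda>z. \<phi> z ^ k) \<in> A C \<and> n C (zero_off C (\<lambda>z. \<phi> z ^ k)) = 1)"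

definition holomorphy_type ::
  "(nat \<Rightarrow> 'u cnormed \<Rightarrow> ('u \<Rightarrow> complex) set) \<Rightarrow>
   (nat \<Rightarrow> 'u cnormed \<Rightarrow> ('u \<Rightarrow> complex) \<Rightarrow> real) \<Rightarrow> bool" where
  "holomorphy_type A n \<longleftrightarrow>
     (\<forall>k. banach_ideal k (A k) (n k)) \<and>
     (\<exists>(c :: real) (C :: nat \<Rightarrow> nat \<Rightarrow> real).
        (\<forall>k l. l \<le> k \<longrightarrow> C k l \<le> c ^ k) \<and>
        (\<forall>E k l P a. complex_banach E \<and> l \<le> k \<and> P \<in> A k E \<and> a \<in> vcarrier E \<longrightarrow>
           hpoly_at E k P a l \<in> A (k - l) E \<and>
           n (k - l) E (hpoly_at E k P a l) \<le> C k l * n k E P * vnorm E a ^ l))"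


section \<open>Holomorphic functions\<close>

definition taylor_series_at :: "'u cnormed \<Rightarrow> ('u \<Rightarrow> complex) \<Rightarrow> 'u \<Rightarrow> (nat \<Rightarrow> 'u \<Rightarrow> complex) \<Rightarrow> bool" where
  "taylor_series_at E f a P \<longleftrightarrow>
     (\<forall>k. P k \<in> hpoly E k) \<and>
     (\<exists>r>0. uniform_limit {x \<in> vcarrier E. vnorm E (vminus E x a) < r}
        (\<lambda>N x. \<Sum>k<N. P k (vminus E x a)) f sequentially)"

definition holomorphic_functions :: "'u cnormed \<Rightarrow> ('u \<Rightarrow> complex) set" where
  "holomorphic_functions E =
     {f. (\<forall>a\<in>vcarrier E. \<exists>P. taylor_series_at E f a P) \<and> (\<forall>x. x \<notin> vcarrier E \<longrightarrow> f x = 0)}"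

text \<open>\<open>taylor_term E f k\<close> is \<open>d^kf(0)/k!\<close>.\<close>

definition taylor_term :: "'u cnormed \<Rightarrow> ('u \<Rightarrow> complex) \<Rightarrow> nat \<Rightarrow> 'u \<Rightarrow> complex" where
  "taylor_term E f = (THE P. taylor_series_at E f (vzero E) P)"

definition HbA ::
  "(nat \<Rightarrow> 'u cnormed \<Rightarrow> ('u \<Rightarrow> complex) set) \<Rightarrow>
   (nat \<Rightarrow> 'u cnormed \<Rightarrow> ('u \<Rightarrow> complex) \<Rightarrow> real) \<Rightarrow> 'u cnormed \<Rightarrow> ('u \<Rightarrow> complex) set" where
  "HbA A n E = {f \<in> holomorphic_functions E.
     (\<forall>k. (\<lambda>x. fact k * taylor_term E f k x) \<in> A k E) \<and>
     (\<lambda>k. root k (n k E (taylor_term E f k))) \<longlonglongrightarrow> 0}"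

definition HbA_seminorm ::
  "(nat \<Rightarrow> 'u cnormed \<Rightarrow> ('u \<Rightarrow> complex) \<Rightarrow> real) \<Rightarrow> 'u cnormed \<Rightarrow> real \<Rightarrow> ('u \<Rightarrow> complex) \<Rightarrow> real" where
  "HbA_seminorm n E s f = (\<Sum>k. s ^ k * n k E (taylor_term E f k))"

definition HbA_topology ::
  "(nat \<Rightarrow> 'u cnormed \<Rightarrow> ('u \<Rightarrow> complex) set) \<Rightarrow>
   (nat \<Rightarrow> 'u cnormed \<Rightarrow> ('u \<Rightarrow> complex) \<Rightarrow> real) \<Rightarrow> 'u cnormed \<Rightarrow> ('u \<Rightarrow> complex) topology" where
  "HbA_topology A n E = topology_generated_by
     {{g \<in> HbA A n E. HbA_seminorm n E s (\<lambda>x. g x - f x) < \<epsilon>} | f s \<epsilon>. f \<in> HbA A n E \<and> s > 0 \<and> \<epsilon> > 0}"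


section \<open>Operators and gaussian measures on topological vector spaces of functions\<close>

text \<open>Here a topological vector space is a set of functions with pointwise operations, given by
  a topology whose underlying set is \<open>topspace X\<close>.\<close>

definition continuous_linear_operator ::
  "('a \<Rightarrow> complex) topology \<Rightarrow> (('a \<Rightarrow> complex) \<Rightarrow> ('a \<Rightarrow> complex)) \<Rightarrow> bool" where
  "continuous_linear_operator X T \<longleftrightarrow> continuous_map X X T \<and>
     (\<forall>f\<in>topspace X. \<forall>g\<in>topspace X. \<forall>a b.
        T (\<lambda>x. a * f x + b * g x) = (\<lambda>x. a * T f x + b * T g x))"

definition trivial_operator ::
  "('a \<Rightarrow> complex) topology \<Rightarrow> (('a \<Rightarrow> complex) \<Rightarrow> ('a \<Rightarrow> complex)) \<Rightarrow> bool" where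
  "trivial_operator X T \<longleftrightarrow> (\<exists>c. \<forall>f\<in>topspace X. T f = (\<lambda>x. c * f x))"

definition translation :: "'u cnormed \<Rightarrow> 'u \<Rightarrow> ('u \<Rightarrow> complex) \<Rightarrow> 'u \<Rightarrow> complex" where
  "translation E x f = zero_off E (\<lambda>y. f (vadd E x y))"

definition convolution_operator ::
  "(nat \<Rightarrow> 'u cnormed \<Rightarrow> ('u \<Rightarrow> complex) set) \<Rightarrow>
   (nat \<Rightarrow> 'u cnormed \<Rightarrow> ('u \<Rightarrow> complex) \<Rightarrow> real) \<Rightarrow> 'u cnormed \<Rightarrow>
   (('u \<Rightarrow> complex) \<Rightarrow> ('u \<Rightarrow> complex)) \<Rightarrow> bool" where
  "convolution_operator A n E T \<longleftrightarrow>
     continuous_linear_operator (HbA_topology A n E) T \<and>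
     (\<forall>x\<in>vcarrier E. \<forall>f\<in>HbA A n E. T (translation E x f) = translation E x (T f))"

definition borel_measure_space :: "'a topology \<Rightarrow> 'a measure" where
  "borel_measure_space X = sigma (topspace X) {U. openin X U}"

definition standard_complex_gaussian :: "'w measure \<Rightarrow> ('w \<Rightarrow> complex) \<Rightarrow> bool" where
  "standard_complex_gaussian M g \<longleftrightarrow> distributed M lborel g (\<lambda>z. ennreal (exp (- (cmod z)\<^sup>2) / pi))"

text \<open>The probability space carrying the gaussian sequence lives on \<open>nat \<Rightarrow> complex\<close>; this is no
  restriction, since the distribution of the series depends only on the joint law of the
  sequence.\<close>

definition gaussian_measure :: "('a \<Rightarrow> complex) topology \<Rightarrow> ('a \<Rightarrow> complex) measure \<Rightarrow> bool" where
  "gaussian_measure X \<mu> \<longleftrightarrow>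
     (\<exists>(M :: (nat \<Rightarrow> complex) measure) (g :: nat \<Rightarrow> (nat \<Rightarrow> complex) \<Rightarrow> complex) x S.
        prob_space M \<and>
        prob_space.indep_vars M (\<lambda>_. borel) g UNIV \<and>
        (\<forall>n. standard_complex_gaussian M (g n)) \<and>
        (\<forall>n. x n \<in> topspace X) \<and>
        S \<in> measurable M (borel_measure_space X) \<and>
        (AE \<omega> in M. limitin X (\<lambda>N y. \<Sum>n<N. g n \<omega> * x n y) (S \<omega>) sequentially) \<and>
        \<mu> = distr M (borel_measure_space X) S)"

definition strongly_mixing_gaussian ::
  "('a \<Rightarrow> complex) topology \<Rightarrow> (('a \<Rightarrow> complex) \<Rightarrow> ('a \<Rightarrow> complex)) \<Rightarrow> bool" where
  "strongly_mixing_gaussian X T \<longleftrightarrow>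
     continuous_linear_operator X T \<and>
     (\<exists>\<mu>. gaussian_measure X \<mu> \<and>
        (\<forall>B\<in>sets \<mu>. emeasure \<mu> (T -` B \<inter> space \<mu>) = emeasure \<mu> B) \<and>
        (\<forall>U. openin X U \<and> U \<noteq> {} \<longrightarrow> emeasure \<mu> U > 0) \<and>
        (\<forall>B\<in>sets \<mu>. \<forall>D\<in>sets \<mu>.
           (\<lambda>n. measure \<mu> (B \<inter> ((T ^^ n) -` D \<inter> space \<mu>))) \<longlonglongrightarrow> measure \<mu> B * measure \<mu> D))"

end

theory Submission
  imports Defs "HOL-Complex_Analysis.Complex_Analysis"
begin

text \<open>
  The exponential \<open>exp \<circ> \<gamma>\<close> of a functional \<open>\<gamma>\<close> is an eigenvector of \<open>T\<close>, with an eigenvalue that is an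
  entire function along complex lines. If it were constant, \<open>T\<close> would be trivial by density of the
  exponentials; otherwise Picard's theorem yields a unimodular eigenvalue that is a regular value
  along a line, and hence also along lines in a dense set of directions. On each of these lines the
  eigenvalue runs through an arc of the unit circle. Averaging the eigenvectors on the arc
  against smooth bumps gives vectors that lie on two-sided orbits of \<open>T\<close> with summable seminorms, and
  difference quotients show that their closed span contains a dense set of exponentials. Enumerate
  countably many such orbits, suitably scaled, as \<open>(x\<^sub>k)\<close>. The law \<open>\<mu>\<close> of
  \<open>\<Sum>\<^sub>k g\<^sub>k x\<^sub>k\<close> is gaussian, and \<open>T\<close> acts on the series by permuting the coordinates
  of the gaussian sequence along infinite cycles. So \<open>\<mu>\<close> is invariant and mixing as a factor of a
  Bernoulli shift, and it has full support since the span of the \<open>x\<^sub>k\<close> is dense.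
\<close>

section \<open>The Bernoulli shift on a sequence of independent complex gaussians\<close>

text \<open>Let E(t) be the eigenvector on the arc with eigenvalue exp(i(theta + t)). The orbit
  vectors are Fourier coefficients of this field: x_m is the integral of exp(i m (theta + t)) phi(t)
  E(t) dt. Applying T multiplies the integrand by the eigenvalue, so T x_m = x_(m+1), and two-sided
  summability is the decay of Fourier coefficients of a smooth function. A regular value is wanted
  because it makes the position u(t) on the complex line a holomorphic function of the angle t. The
  integral is never taken in the function space. E(t) = exp(gamma + u(t) delta) expands in powers of
  u(t); integrating these scalars leaves exp(gamma) times an entire function of delta, for which
  explicit bounds in the ideal norms are at hand (\<open>expfun\<close>, \<open>tame\<close>). One
  regular direction only reaches exponentials on a single line through gamma, so a dense set of
  directions is taken. It has to be countable because a single gaussian series carries all orbits;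
  this is where the separable dual enters.\<close>

definition cgauss :: "complex measure" where
  "cgauss = density lborel (\<lambda>z. ennreal (exp (- (cmod z)\<^sup>2) / pi))"

lemma sets_cgauss [measurable_cong, simp]: "sets cgauss = sets borel"
  by (simp add: cgauss_def)

lemma space_cgauss [simp]: "space cgauss = UNIV"
  by (simp add: cgauss_def)

lemma nn_integral_normal_density_complex:
  assumes "0 < \<sigma>"
  shows "(\<integral>\<^sup>+z. ennreal (normal_density 0 \<sigma> (Re z) * normal_density 0 \<sigma> (Im z)) \<partial>lborel) = 1"
proof -
  have one: "(\<integral>\<^sup>+x. ennreal (normal_density 0 \<sigma> x) \<partial>lborel) = 1"
    using assms by (subst nn_integral_eq_integral) auto
  have "(\<integral>\<^sup>+z. (\<Prod>b\<in>Basis. ennreal (normal_density 0 \<sigma> (z \<bullet> b))) \<partial>(lborel :: complex measure))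
      = (\<Prod>b\<in>(Basis :: complex set). \<integral>\<^sup>+x. ennreal (normal_density 0 \<sigma> x) \<partial>lborel)"
    by (rule nn_integral_lborel_prod) auto
  then show ?thesis
    by (simp add: one Basis_complex_def inner_complex_def ennreal_mult)
qed

lemma normal_density_complex:
  assumes "0 < \<sigma>"
  shows "normal_density 0 \<sigma> (Re z) * normal_density 0 \<sigma> (Im z)
       = exp (- (cmod z)\<^sup>2 / (2 * \<sigma>\<^sup>2)) / (2 * pi * \<sigma>\<^sup>2)"
proof -
  have "sqrt (2 * pi * \<sigma>\<^sup>2) * sqrt (2 * pi * \<sigma>\<^sup>2) = 2 * pi * \<sigma>\<^sup>2" by simp
  then show ?thesis
    unfolding normal_density_def
    by (simp add: exp_add [symmetric] cmod_power2 add_divide_distrib diff_divide_distrib)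
qed

lemma prob_space_cgauss: "prob_space cgauss"
proof
  have "emeasure cgauss (space cgauss) = (\<integral>\<^sup>+z. ennreal (exp (- (cmod z)\<^sup>2) / pi) \<partial>lborel)"
    by (simp add: cgauss_def emeasure_density)
  \<comment> \<open>The standard deviation 1 / sqrt 2 is that of the real and imaginary parts of a
    complex gaussian with density exp(-|z|^2) / pi.\<close>
  also have "\<dots> = (\<integral>\<^sup>+z. ennreal (normal_density 0 (1 / sqrt 2) (Re z)
                                  * normal_density 0 (1 / sqrt 2) (Im z)) \<partial>lborel)"
    by (subst normal_density_complex) (auto simp: power_divide)
  also have "\<dots> = 1" by (rule nn_integral_normal_density_complex) simp
  finally show "emeasure cgauss (space cgauss) = 1" .
qed

text \<open>Since |z| \<le> exp(|z|^2 / 2), the integrand is at most twice the density of a complex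
  gaussian whose parts have variance 1. This moment is what makes random series with summable
  majorants converge almost surely.\<close>

lemma cgauss_first_moment: "(\<integral>\<^sup>+z. ennreal (cmod z) \<partial>cgauss) < \<infinity>"
proof -
  have le: "ennreal (exp (- (cmod z)\<^sup>2) / pi) * ennreal (cmod z)
      \<le> 2 * ennreal (normal_density 0 1 (Re z) * normal_density 0 1 (Im z))" for z
  proof -
    have "cmod z \<le> 1 + (cmod z)\<^sup>2 / 2"
      using zero_le_power2 [of "cmod z - 1"] by (simp add: power2_diff field_simps)
    also have "\<dots> \<le> exp ((cmod z)\<^sup>2 / 2)" by (rule exp_ge_add_one_self)
    finally have "exp (- (cmod z)\<^sup>2) * cmod z \<le> exp (- (cmod z)\<^sup>2) * exp ((cmod z)\<^sup>2 / 2)"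
      by (simp add: mult_left_mono)
    also have "\<dots> = exp (- (cmod z)\<^sup>2 / 2)" by (simp add: exp_add [symmetric])
    finally have "exp (- (cmod z)\<^sup>2) / pi * cmod z
        \<le> 2 * (exp (- (cmod z)\<^sup>2 / 2) / (2 * pi))"
      by (simp add: divide_right_mono)
    also have "\<dots> = 2 * (normal_density 0 1 (Re z) * normal_density 0 1 (Im z))"
      by (subst normal_density_complex) simp_all
    finally show ?thesis
      by (simp add: ennreal_mult [symmetric] numeral_mult_ennreal)
  qed
  have "(\<integral>\<^sup>+z. ennreal (cmod z) \<partial>cgauss)
      = (\<integral>\<^sup>+z. ennreal (exp (- (cmod z)\<^sup>2) / pi) * ennreal (cmod z) \<partial>lborel)"
    unfolding cgauss_def by (rule nn_integral_density) auto
  also have "\<dots> \<le> (\<integral>\<^sup>+z. 2 * ennreal (normal_density 0 1 (Re z) * normal_density 0 1 (Im z)) \<partial>lborel)"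
    by (intro nn_integral_mono le)
  also have "\<dots> = 2 * 1"
    by (subst nn_integral_cmult) (auto simp: nn_integral_normal_density_complex)
  finally show ?thesis by (rule le_less_trans) simp
qed

text \<open>The density vanishes nowhere, so a ball of measure zero would be Lebesgue null. The full
  support of the final measure rests on this.\<close>

lemma cgauss_ball_pos:
  assumes "0 < r"
  shows "0 < emeasure cgauss (ball a r)"
proof (rule ccontr)
  assume "\<not> ?thesis"
  then have "(\<integral>\<^sup>+z. ennreal (exp (- (cmod z)\<^sup>2) / pi) * indicator (ball a r) z \<partial>lborel) = 0"
    by (simp add: cgauss_def emeasure_density)
  then have "AE z in lborel. ennreal (exp (- (cmod z)\<^sup>2) / pi) * indicator (ball a r) z = 0"
    by (subst (asm) nn_integral_0_iff_AE) (auto intro!: borel_measurable_times_ennreal borel_measurable_indicator)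
  then have "AE z in lborel. z \<notin> ball a r"
    by eventually_elim (auto simp: indicator_def split: if_splits)
  then have "emeasure lborel (ball a r) = 0"
    by (subst (asm) AE_iff_measurable [of "ball a r"]) auto
  then show False
    using content_ball_pos [OF assms, of a] emeasure_lborel_ball_finite [of a r]
    by (simp add: measure_def)
qed

definition gauss_seq :: "(nat \<Rightarrow> complex) measure" where
  "gauss_seq = PiM UNIV (\<lambda>_. cgauss)"

lemma space_gauss_seq [simp]: "space gauss_seq = UNIV"
  by (simp add: gauss_seq_def space_PiM)

lemma sets_gauss_seq [measurable_cong]: "sets gauss_seq = sets (PiM UNIV (\<lambda>_. borel))"
  unfolding gauss_seq_def by (rule sets_PiM_cong) auto

lemma sets_gauss_seq_borel: "sets gauss_seq = sets borel"
  by (simp add: sets_gauss_seq sets_PiM_equal_borel)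

interpretation gauss_seq: prob_space gauss_seq
  unfolding gauss_seq_def by (intro prob_space_PiM prob_space_cgauss)

lemma measurable_gauss_seq_component [measurable]: "(\<lambda>\<omega>. \<omega> k) \<in> measurable gauss_seq borel"
  by measurable

lemma distr_gauss_seq_component: "distr gauss_seq borel (\<lambda>\<omega>. \<omega> k) = cgauss"
proof -
  have "distr gauss_seq borel (\<lambda>\<omega>. \<omega> k) = distr gauss_seq cgauss (\<lambda>\<omega>. \<omega> k)"
    by (rule distr_cong) auto
  then show ?thesis
    using distr_PiM_component [of UNIV "\<lambda>_. cgauss" k] prob_space_cgauss by (simp add: gauss_seq_def)
qed

lemma gauss_seq_indep: "gauss_seq.indep_vars (\<lambda>_. borel) (\<lambda>k \<omega>. \<omega> k) UNIV"
proof (subst gauss_seq.indep_vars_iff_distr_eq_PiM')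
  show "distr gauss_seq (\<Pi>\<^sub>M i\<in>UNIV. borel) (\<lambda>x. \<lambda>i\<in>UNIV. x i)
      = (\<Pi>\<^sub>M i\<in>UNIV. distr gauss_seq borel (\<lambda>\<omega>. \<omega> i))"
    using distr_id2 [OF sets_gauss_seq [symmetric]]
    by (simp only: distr_gauss_seq_component restrict_UNIV gauss_seq_def [symmetric])
qed auto

lemma gauss_seq_standard: "standard_complex_gaussian gauss_seq (\<lambda>\<omega>. \<omega> k)"
  unfolding standard_complex_gaussian_def distributed_def
  using distr_gauss_seq_component [of k] distr_cong [OF refl sets_lborel refl, of gauss_seq "\<lambda>\<omega>. \<omega> k"]
  by (simp add: cgauss_def measurable_lborel1)

lemma nn_integral_gauss_seq_component:
  "(\<integral>\<^sup>+\<omega>. ennreal (cmod (\<omega> k)) \<partial>gauss_seq) = (\<integral>\<^sup>+z. ennreal (cmod z) \<partial>cgauss)"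
  unfolding distr_gauss_seq_component [of k, symmetric] by (subst nn_integral_distr) auto

definition cylinder :: "nat set \<Rightarrow> (nat \<Rightarrow> complex set) \<Rightarrow> (nat \<Rightarrow> complex) set" where
  "cylinder J D = {\<omega>. \<forall>j\<in>J. \<omega> j \<in> D j}"

lemma cylinder_eq_emb: "cylinder J D = prod_emb UNIV (\<lambda>_. cgauss) J (Pi\<^sub>E J D)"
  by (auto simp: cylinder_def prod_emb_def PiE_iff)

lemma emeasure_cylinder:
  assumes "finite J" "\<And>j. j \<in> J \<Longrightarrow> D j \<in> sets borel"
  shows "emeasure gauss_seq (cylinder J D) = (\<Prod>j\<in>J. emeasure cgauss (D j))"
  unfolding cylinder_eq_emb gauss_seq_def
  by (rule emeasure_PiM_emb) (use assms in \<open>auto simp: prob_space_cgauss\<close>)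

lemma measure_cylinder:
  assumes "finite J" "\<And>j. j \<in> J \<Longrightarrow> D j \<in> sets borel"
  shows "measure gauss_seq (cylinder J D) = (\<Prod>j\<in>J. measure cgauss (D j))"
proof -
  interpret prob_space cgauss by (rule prob_space_cgauss)
  have "ennreal (measure gauss_seq (cylinder J D)) = ennreal (\<Prod>j\<in>J. measure cgauss (D j))"
    using emeasure_cylinder [OF assms]
    by (simp add: emeasure_eq_measure gauss_seq.emeasure_eq_measure prod_ennreal)
  then show ?thesis
    by (subst (asm) ennreal_inj) (auto intro: prod_nonneg)
qed

lemma sets_cylinder:
  assumes "finite J" "\<And>j. j \<in> J \<Longrightarrow> D j \<in> sets borel"
  shows "cylinder J D \<in> sets gauss_seq"
  unfolding cylinder_eq_emb gauss_seq_def by (rule sets_PiM_I) (use assms in auto)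

definition cylinders :: "(nat \<Rightarrow> complex) set set" where
  "cylinders = {cylinder J D | J D. finite J \<and> (\<forall>j\<in>J. D j \<in> sets borel)}"

lemma sets_gauss_seq_cylinders: "sets gauss_seq = sigma_sets UNIV cylinders"
proof
  show "sigma_sets UNIV cylinders \<subseteq> sets gauss_seq"
    using sets.sigma_sets_subset [of cylinders gauss_seq] sets_cylinder
    by (auto simp: cylinders_def)
  have "{{f \<in> \<Pi>\<^sub>E i\<in>UNIV. space cgauss. f i \<in> A} | i A. i \<in> UNIV \<and> A \<in> sets cgauss} \<subseteq> cylinders"
  proof clarify
    fix i :: nat and D :: "complex set" assume "D \<in> sets cgauss"
    moreover have "{f \<in> \<Pi>\<^sub>E i\<in>UNIV. space cgauss. f i \<in> D} = cylinder {i} (\<lambda>_. D)"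
      by (simp add: cylinder_def)
    ultimately show "{f \<in> \<Pi>\<^sub>E i\<in>UNIV. space cgauss. f i \<in> D} \<in> cylinders"
      unfolding cylinders_def by (simp only:) (auto intro!: exI [of _ "{i}"])
  qed
  then show "sets gauss_seq \<subseteq> sigma_sets UNIV cylinders"
    unfolding gauss_seq_def sets_PiM_single by (simp add: sigma_sets_mono')
qed

lemma Int_stable_cylinders: "Int_stable cylinders"
proof (rule Int_stableI)
  fix a b assume "a \<in> cylinders" "b \<in> cylinders"
  then obtain J D K F where *: "a = cylinder J D" "finite J" "\<And>j. j \<in> J \<Longrightarrow> D j \<in> sets borel"
      "b = cylinder K F" "finite K" "\<And>j. j \<in> K \<Longrightarrow> F j \<in> sets borel"
    by (auto simp: cylinders_def)
  define G where "G j = (if j \<in> J then D j else UNIV) \<inter> (if j \<in> K then F j else UNIV)" for j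
  have "a \<inter> b = cylinder (J \<union> K) G"
    by (auto simp: * cylinder_def G_def split: if_splits)
  moreover have "\<forall>j\<in>J \<union> K. G j \<in> sets borel"
    using * by (auto simp: G_def)
  ultimately show "a \<inter> b \<in> cylinders"
    using * unfolding cylinders_def by blast
qed

text \<open>Coordinates are indexed by naturals although the orbits are two-sided: a permutation of
  the indices with only infinite cycles takes the place of translation on the integers.\<close>

definition coord_shift :: "(nat \<Rightarrow> nat) \<Rightarrow> (nat \<Rightarrow> complex) \<Rightarrow> nat \<Rightarrow> complex" where
  "coord_shift \<pi> \<omega> = (\<lambda>k. \<omega> (\<pi> k))"

lemma measurable_shift [measurable]: "coord_shift \<pi> \<in> measurable gauss_seq gauss_seq"
  unfolding gauss_seq_def coord_shift_def by (rule measurable_PiM_single') (auto simp: space_PiM)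

lemma distr_shift:
  assumes "inj \<pi>"
  shows "distr gauss_seq gauss_seq (coord_shift \<pi>) = gauss_seq"
  using distr_PiM_reindex [of UNIV "\<lambda>_. cgauss" \<pi> UNIV] assms prob_space_cgauss
  by (simp add: gauss_seq_def coord_shift_def [abs_def] restrict_UNIV)

lemma measure_shift_vimage:
  assumes "inj \<pi>" "C \<in> sets gauss_seq"
  shows "measure gauss_seq (coord_shift \<pi> -` C) = measure gauss_seq C"
  using measure_distr [OF measurable_shift assms(2), of \<pi>] distr_shift [OF assms(1)] by simp

lemma sets_shift_vimage:
  "C \<in> sets gauss_seq \<Longrightarrow> coord_shift \<pi> -` C \<in> sets gauss_seq"
  using measurable_sets [OF measurable_shift] by simp

text \<open>Once the moved index set has left \<open>J\<close>, the two events constrain disjoint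
  sets of independent coordinates, so the product formula holds exactly and the sequence is
  eventually constant.\<close>

lemma mixing_cylinder:
  assumes \<pi>: "inj \<pi>" and wander: "\<And>j k. eventually (\<lambda>n. (\<pi> ^^ n) j \<noteq> k) sequentially"
    and "B \<in> cylinders" "C \<in> cylinders"
  shows "(\<lambda>n. measure gauss_seq (B \<inter> coord_shift (\<pi> ^^ n) -` C))
           \<longlonglongrightarrow> measure gauss_seq B * measure gauss_seq C"
proof -
  obtain J D K F where B: "B = cylinder J D" "finite J" "\<And>j. j \<in> J \<Longrightarrow> D j \<in> sets borel"
    and C: "C = cylinder K F" "finite K" "\<And>j. j \<in> K \<Longrightarrow> F j \<in> sets borel"
    using assms by (auto simp: cylinders_def)
  have "eventually (\<lambda>n. \<forall>k\<in>K. \<forall>j\<in>J. (\<pi> ^^ n) k \<noteq> j) sequentially"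
    using B(2) C(2) wander by (simp add: eventually_ball_finite_distrib)
  then have "eventually (\<lambda>n. measure gauss_seq (B \<inter> coord_shift (\<pi> ^^ n) -` C)
      = measure gauss_seq B * measure gauss_seq C) sequentially"
  proof eventually_elim
    case (elim n)
    define p where "p = \<pi> ^^ n"
    have p: "inj p" unfolding p_def using \<pi> by (rule inj_fn)
    have disj: "J \<inter> p ` K = {}" using elim by (auto simp: p_def)
    \<comment> \<open>On disjoint index sets both families of constraints fit into one, so the
      intersection is again a cylinder.\<close>
    define G where "G j = (if j \<in> J then D j else F (the_inv p j))" for j
    have G: "p k \<notin> J" "G (p k) = F k" if "k \<in> K" for k
      using that disj by (auto simp: G_def the_inv_f_f [OF p])
    have GJ: "G j = D j" if "j \<in> J" for j
      using that by (simp add: G_def)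
    have "B \<inter> coord_shift p -` C = cylinder (J \<union> p ` K) G"
      using G GJ by (auto simp: B C cylinder_def coord_shift_def ball_Un)
    then have "measure gauss_seq (B \<inter> coord_shift p -` C) = (\<Prod>j\<in>J \<union> p ` K. measure cgauss (G j))"
      using B C G by (simp only:) (rule measure_cylinder, auto simp: GJ)
    also have "\<dots> = (\<Prod>j\<in>J. measure cgauss (G j)) * (\<Prod>j\<in>p ` K. measure cgauss (G j))"
      using B C disj by (intro prod.union_disjoint) auto
    also have "(\<Prod>j\<in>p ` K. measure cgauss (G j)) = (\<Prod>k\<in>K. measure cgauss (F k))"
      using G by (subst prod.reindex) (auto intro: inj_on_subset [OF p] prod.cong)
    also have "(\<Prod>j\<in>J. measure cgauss (G j)) = (\<Prod>j\<in>J. measure cgauss (D j))"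
      by (rule prod.cong) (auto simp: GJ)
    finally show ?case
      by (simp add: B C measure_cylinder p_def)
  qed
  then show ?thesis by (rule tendsto_eventually)
qed

lemma mixing_suminf:
  fixes a :: "nat \<Rightarrow> nat \<Rightarrow> real"
  assumes "\<And>i. (\<lambda>n. a i n) \<longlonglongrightarrow> b i" "\<And>i n. norm (a i n) \<le> M i" "summable M"
  shows "(\<lambda>n. \<Sum>i. a i n) \<longlonglongrightarrow> (\<Sum>i. b i)"
proof -
  have "eventually (\<lambda>(k, n). norm (a k n) \<le> M k) (at_top \<times>\<^sub>F sequentially)"
    using assms(2) by (simp add: always_eventually)
  then show ?thesis
    using tannerys_theorem [of a b sequentially M] assms by simp
qed

text \<open>Two applications of Dynkin's lemma extend mixing from cylinders to all measurable sets;
  countable disjoint unions are handled by Tannery's theorem.\<close>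

theorem mixing_shift:
  assumes \<pi>: "inj \<pi>" and wander: "\<And>j k. eventually (\<lambda>n. (\<pi> ^^ n) j \<noteq> k) sequentially"
    and B: "B \<in> sets gauss_seq" and C: "C \<in> sets gauss_seq"
  shows "(\<lambda>n. measure gauss_seq (B \<inter> coord_shift (\<pi> ^^ n) -` C))
           \<longlonglongrightarrow> measure gauss_seq B * measure gauss_seq C"
proof -
  note [simp] = sets_shift_vimage
  have inj: "inj (\<pi> ^^ n)" for n using \<pi> by (rule inj_fn)
  have shift_eq: "measure gauss_seq (coord_shift (\<pi> ^^ n) -` C) = measure gauss_seq C"
    if "C \<in> sets gauss_seq" for n C
    using measure_shift_vimage [OF inj that] .
  have cyl: "cylinders \<subseteq> Pow UNIV" by simp
  have cyl_sets: "B \<in> sets gauss_seq" if "B \<in> cylinders" for B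
    using that by (auto simp: cylinders_def sets_cylinder)
  \<comment> \<open>Here \<open>B\<close> is a cylinder and \<open>C\<close> varies; the outer
    induction then fixes \<open>C\<close> and lets \<open>B\<close> vary.\<close>
  have 1: "(\<lambda>n. measure gauss_seq (B \<inter> coord_shift (\<pi> ^^ n) -` C))
           \<longlonglongrightarrow> measure gauss_seq B * measure gauss_seq C"
    if Bc: "B \<in> cylinders" and "C \<in> sigma_sets UNIV cylinders" for B C
    using Int_stable_cylinders cyl that(2)
  proof (induction rule: sigma_sets_induct_disjoint)
    case (basic C)
    show ?case by (rule mixing_cylinder [OF \<pi> wander Bc basic])
  next
    case empty
    show ?case by simp
  next
    case (compl C)
    then have Cs: "C \<in> sets gauss_seq" by (simp add: sets_gauss_seq_cylinders)
    have "measure gauss_seq (B \<inter> coord_shift (\<pi> ^^ n) -` (UNIV - C))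
        = measure gauss_seq B - measure gauss_seq (B \<inter> coord_shift (\<pi> ^^ n) -` C)" for n
    proof -
      have "B \<inter> coord_shift (\<pi> ^^ n) -` (UNIV - C) = B - (B \<inter> coord_shift (\<pi> ^^ n) -` C)" by auto
      then show ?thesis
        using Cs cyl_sets [OF Bc] by (simp add: gauss_seq.finite_measure_Diff)
    qed
    moreover have "measure gauss_seq (UNIV - C) = 1 - measure gauss_seq C"
      using gauss_seq.prob_compl [OF Cs] by simp
    ultimately show ?case
      using tendsto_diff [OF tendsto_const compl.IH, of "measure gauss_seq B"]
      by (simp only: right_diff_distrib mult_1_right)
  next
    case (union C)
    have Cs: "C i \<in> sets gauss_seq" for i
      using union by (auto simp: sets_gauss_seq_cylinders)
    have sums: "(\<lambda>i. measure gauss_seq (B \<inter> coord_shift (\<pi> ^^ n) -` C i))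
        sums measure gauss_seq (B \<inter> coord_shift (\<pi> ^^ n) -` (\<Union>i. C i))" for n
    proof -
      have "(\<lambda>i. measure gauss_seq (B \<inter> coord_shift (\<pi> ^^ n) -` C i))
        sums measure gauss_seq (\<Union>i. B \<inter> coord_shift (\<pi> ^^ n) -` C i)"
        using Cs cyl_sets [OF Bc] union(1)
        by (intro gauss_seq.finite_measure_UNION) (auto simp: disjoint_family_on_def)
      moreover have "(\<Union>i. B \<inter> coord_shift (\<pi> ^^ n) -` C i) = B \<inter> coord_shift (\<pi> ^^ n) -` (\<Union>i. C i)" by auto
      ultimately show ?thesis by simp
    qed
    have sC: "(\<lambda>i. measure gauss_seq (C i)) sums measure gauss_seq (\<Union>i. C i)"
      using Cs union(1) by (intro gauss_seq.finite_measure_UNION) auto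
    have "(\<lambda>n. \<Sum>i. measure gauss_seq (B \<inter> coord_shift (\<pi> ^^ n) -` C i))
        \<longlonglongrightarrow> (\<Sum>i. measure gauss_seq B * measure gauss_seq (C i))"
    proof (rule mixing_suminf)
      \<comment> \<open>Invariance of the measure under the shift makes this bound independent of
        \<open>n\<close>.\<close>
      show "norm (measure gauss_seq (B \<inter> coord_shift (\<pi> ^^ n) -` C i)) \<le> measure gauss_seq (C i)" for i n
        using gauss_seq.finite_measure_mono [of "B \<inter> coord_shift (\<pi> ^^ n) -` C i" "coord_shift (\<pi> ^^ n) -` C i"]
          Cs shift_eq by simp
    qed (use union sums_summable [OF sC] in auto)
    then show ?case
      using sums_unique [OF sums] sums_unique [OF sums_mult [OF sC]] by simp
  qed
  have "B \<in> sigma_sets UNIV cylinders" using B by (simp add: sets_gauss_seq_cylinders)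
  with Int_stable_cylinders cyl show ?thesis
  proof (induction rule: sigma_sets_induct_disjoint)
    case (basic B)
    show ?case by (rule 1) (use basic C in \<open>auto simp: sets_gauss_seq_cylinders\<close>)
  next
    case empty
    show ?case by simp
  next
    case (compl B)
    then have Bs: "B \<in> sets gauss_seq" by (simp add: sets_gauss_seq_cylinders)
    have "measure gauss_seq ((UNIV - B) \<inter> coord_shift (\<pi> ^^ n) -` C)
        = measure gauss_seq C - measure gauss_seq (B \<inter> coord_shift (\<pi> ^^ n) -` C)" for n
    proof -
      have "(UNIV - B) \<inter> coord_shift (\<pi> ^^ n) -` C = coord_shift (\<pi> ^^ n) -` C - (B \<inter> coord_shift (\<pi> ^^ n) -` C)" by auto
      then show ?thesis
        using Bs C shift_eq by (simp add: gauss_seq.finite_measure_Diff)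
    qed
    moreover have "measure gauss_seq (UNIV - B) = 1 - measure gauss_seq B"
      using gauss_seq.prob_compl [OF Bs] by simp
    ultimately show ?case
      using tendsto_diff [OF tendsto_const compl.IH, of "measure gauss_seq C"]
      by (simp only: left_diff_distrib mult_1_left)
  next
    case (union B)
    have Bs: "B i \<in> sets gauss_seq" for i
      using union by (auto simp: sets_gauss_seq_cylinders)
    have sums: "(\<lambda>i. measure gauss_seq (B i \<inter> coord_shift (\<pi> ^^ n) -` C))
        sums measure gauss_seq ((\<Union>i. B i) \<inter> coord_shift (\<pi> ^^ n) -` C)" for n
    proof -
      have "(\<lambda>i. measure gauss_seq (B i \<inter> coord_shift (\<pi> ^^ n) -` C))
        sums measure gauss_seq (\<Union>i. B i \<inter> coord_shift (\<pi> ^^ n) -` C)"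
        using Bs C union(1)
        by (intro gauss_seq.finite_measure_UNION) (auto simp: disjoint_family_on_def)
      then show ?thesis by simp
    qed
    have sB: "(\<lambda>i. measure gauss_seq (B i)) sums measure gauss_seq (\<Union>i. B i)"
      using Bs union(1) by (intro gauss_seq.finite_measure_UNION) auto
    have "(\<lambda>n. \<Sum>i. measure gauss_seq (B i \<inter> coord_shift (\<pi> ^^ n) -` C))
        \<longlonglongrightarrow> (\<Sum>i. measure gauss_seq (B i) * measure gauss_seq C)"
    proof (rule mixing_suminf)
      show "norm (measure gauss_seq (B i \<inter> coord_shift (\<pi> ^^ n) -` C)) \<le> measure gauss_seq (B i)" for i n
        using gauss_seq.finite_measure_mono [of "B i \<inter> coord_shift (\<pi> ^^ n) -` C" "B i"] Bs by simp
    qed (use union sums_summable [OF sB] in auto)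
    then show ?case
      using sums_unique [OF sums] sums_unique [OF sums_mult2 [OF sB]] by simp
  qed
qed

section \<open>Function spaces topologised by a monotone family of seminorms\<close>

text \<open>Generated by the same sets as \<open>HbA_topology\<close>, so that the two agree by
  unfolding.\<close>

definition seminorm_topology ::
  "('a \<Rightarrow> complex) set \<Rightarrow> (real \<Rightarrow> ('a \<Rightarrow> complex) \<Rightarrow> real) \<Rightarrow> ('a \<Rightarrow> complex) topology" where
  "seminorm_topology X p = topology_generated_by
     {{g \<in> X. p s (\<lambda>x. g x - f x) < \<epsilon>} | f s \<epsilon>. f \<in> X \<and> s > 0 \<and> \<epsilon> > 0}"

text \<open>The properties of the function space on which the measure theory relies. Bounded
  evaluations let limits in the topology be identified pointwise; monotonicity in \<open>s\<close>
  makes single balls a neighbourhood base.\<close>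

locale seminormed_functions =
  fixes X :: "('a \<Rightarrow> complex) set" and p :: "real \<Rightarrow> ('a \<Rightarrow> complex) \<Rightarrow> real"
  assumes lin_closed: "f \<in> X \<Longrightarrow> g \<in> X \<Longrightarrow> (\<lambda>x. a * f x + b * g x) \<in> X"
    and nonempty: "X \<noteq> {}"
    and p_nonneg: "0 < s \<Longrightarrow> f \<in> X \<Longrightarrow> 0 \<le> p s f"
    and p_lin: "0 < s \<Longrightarrow> f \<in> X \<Longrightarrow> g \<in> X \<Longrightarrow>
          p s (\<lambda>x. a * f x + b * g x) \<le> cmod a * p s f + cmod b * p s g"
    and p_mono: "0 < s \<Longrightarrow> s \<le> t \<Longrightarrow> f \<in> X \<Longrightarrow> p s f \<le> p t f"
    and evaluation_bounded: "\<exists>s>0. \<forall>f\<in>X. cmod (f y) \<le> p s f"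
begin

abbreviation "\<T> \<equiv> seminorm_topology X p"

lemma zero_closed: "(\<lambda>x. 0) \<in> X"
proof -
  obtain f where "f \<in> X" using nonempty by blast
  then show ?thesis using lin_closed [of f f 0 0] by simp
qed

lemma diff_closed: "f \<in> X \<Longrightarrow> g \<in> X \<Longrightarrow> (\<lambda>x. f x - g x) \<in> X"
  using lin_closed [of f g 1 "-1"] by simp

lemma sum_closed: "(\<And>i. i \<in> I \<Longrightarrow> f i \<in> X) \<Longrightarrow> (\<lambda>x. \<Sum>i\<in>I. c i * f i x) \<in> X"
proof (induction I rule: infinite_finite_induct)
  case (insert i I)
  then show ?case
    using lin_closed [of "f i" "\<lambda>x. \<Sum>i\<in>I. c i * f i x" "c i" 1] by simp
qed (auto simp: zero_closed)

lemma p_scale: "0 < s \<Longrightarrow> f \<in> X \<Longrightarrow> p s (\<lambda>x. a * f x) \<le> cmod a * p s f"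
  using p_lin [of s f f a 0] by simp

lemma p_zero: "0 < s \<Longrightarrow> p s (\<lambda>x. 0) = 0"
  using p_scale [of s "\<lambda>x. 0" 0] zero_closed p_nonneg [of s "\<lambda>x. 0"] by simp

lemma p_sum:
  assumes "0 < s" "\<And>i. i \<in> I \<Longrightarrow> f i \<in> X"
  shows "p s (\<lambda>x. \<Sum>i\<in>I. c i * f i x) \<le> (\<Sum>i\<in>I. cmod (c i) * p s (f i))"
  using assms(2)
proof (induction I rule: infinite_finite_induct)
  case (insert i I)
  have "p s (\<lambda>x. c i * f i x + 1 * (\<Sum>i\<in>I. c i * f i x))
      \<le> cmod (c i) * p s (f i) + cmod 1 * p s (\<lambda>x. \<Sum>i\<in>I. c i * f i x)"
    by (rule p_lin) (use insert assms(1) in \<open>auto intro: sum_closed\<close>)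
  then show ?case using insert by simp
qed (use assms in \<open>auto simp: p_zero\<close>)

lemma p_triangle:
  assumes "0 < s" "f \<in> X" "g \<in> X" "h \<in> X"
  shows "p s (\<lambda>x. f x - h x) \<le> p s (\<lambda>x. f x - g x) + p s (\<lambda>x. g x - h x)"
  using p_lin [OF assms(1) diff_closed diff_closed, of f g g h 1 1] assms by simp

lemma p_swap:
  assumes "0 < s" "f \<in> X" "g \<in> X"
  shows "p s (\<lambda>x. f x - g x) = p s (\<lambda>x. g x - f x)"
proof -
  have "p s (\<lambda>x. f x - g x) \<le> p s (\<lambda>x. g x - f x)" if "f \<in> X" "g \<in> X" for f g
    using p_scale [OF assms(1) diff_closed [of g f], of "-1"] that by simp
  then show ?thesis using assms by (simp add: order_antisym)
qed

lemma topspace_seminorm [simp]: "topspace \<T> = X"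
proof -
  have "f \<in> \<Union>{{g \<in> X. p s (\<lambda>x. g x - f x) < \<epsilon>} | f s \<epsilon>. f \<in> X \<and> s > 0 \<and> \<epsilon> > 0}"
    if "f \<in> X" for f
  proof (rule UnionI)
    show "{g \<in> X. p 1 (\<lambda>x. g x - f x) < 1} \<in>
        {{g \<in> X. p s (\<lambda>x. g x - f x) < \<epsilon>} | f s \<epsilon>. f \<in> X \<and> s > 0 \<and> \<epsilon> > 0}"
      using that zero_less_one by blast
    show "f \<in> {g \<in> X. p 1 (\<lambda>x. g x - f x) < 1}"
      using that p_zero [of 1] by simp
  qed
  moreover have "\<Union>{{g \<in> X. p s (\<lambda>x. g x - f x) < \<epsilon>} | f s \<epsilon>. f \<in> X \<and> s > 0 \<and> \<epsilon> > 0} \<subseteq> X"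
    by (rule Union_least) clarsimp
  ultimately show ?thesis
    unfolding seminorm_topology_def topology_generated_by_topspace by blast
qed

lemma openin_ball:
  assumes "f \<in> X" "0 < s" "0 < \<epsilon>"
  shows "openin \<T> {g \<in> X. p s (\<lambda>x. g x - f x) < \<epsilon>}"
  unfolding seminorm_topology_def
  by (rule topology_generated_by_Basis) (use assms in blast)

definition nbhd :: "('a \<Rightarrow> complex) \<Rightarrow> ('a \<Rightarrow> complex) set \<Rightarrow> bool" where
  "nbhd f U \<longleftrightarrow> (\<exists>s>0. \<exists>\<epsilon>>0. {g \<in> X. p s (\<lambda>x. g x - f x) < \<epsilon>} \<subseteq> U)"

lemma nbhd_mono: "nbhd f U \<Longrightarrow> U \<subseteq> V \<Longrightarrow> nbhd f V"
  unfolding nbhd_def by (meson subset_trans)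

lemma nbhd_Int:
  assumes "f \<in> X" "nbhd f U" "nbhd f V"
  shows "nbhd f (U \<inter> V)"
proof -
  obtain s \<epsilon> where 1: "s > 0" "\<epsilon> > 0" "{g \<in> X. p s (\<lambda>x. g x - f x) < \<epsilon>} \<subseteq> U"
    using assms(2) unfolding nbhd_def by blast
  obtain t \<delta> where 2: "t > 0" "\<delta> > 0" "{g \<in> X. p t (\<lambda>x. g x - f x) < \<delta>} \<subseteq> V"
    using assms(3) unfolding nbhd_def by blast
  have "p s (\<lambda>x. g x - f x) \<le> p (max s t) (\<lambda>x. g x - f x)"
       "p t (\<lambda>x. g x - f x) \<le> p (max s t) (\<lambda>x. g x - f x)" if "g \<in> X" for g
    using p_mono [OF 1(1) _ diff_closed [OF that assms(1)]]
      p_mono [OF 2(1) _ diff_closed [OF that assms(1)]] by simp_all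
  then have "{g \<in> X. p (max s t) (\<lambda>x. g x - f x) < min \<epsilon> \<delta>} \<subseteq> U \<inter> V"
    using 1(3) 2(3) by fastforce
  moreover have "max s t > 0" "min \<epsilon> \<delta> > 0" using 1 2 by auto
  ultimately show ?thesis unfolding nbhd_def by blast
qed

lemma nbhd_ball:
  assumes "f \<in> X" "0 < s" "0 < \<epsilon>" "h \<in> X" "p s (\<lambda>x. h x - f x) < \<epsilon>"
  shows "nbhd h {g \<in> X. p s (\<lambda>x. g x - f x) < \<epsilon>}"
proof -
  have "p s (\<lambda>x. g x - f x) < \<epsilon>"
    if "g \<in> X" "p s (\<lambda>x. g x - h x) < \<epsilon> - p s (\<lambda>x. h x - f x)" for g
    using p_triangle [OF assms(2) that(1) assms(4) assms(1)] that(2) by linarith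
  then have "{g \<in> X. p s (\<lambda>x. g x - h x) < \<epsilon> - p s (\<lambda>x. h x - f x)}
      \<subseteq> {g \<in> X. p s (\<lambda>x. g x - f x) < \<epsilon>}"
    by blast
  moreover have "\<epsilon> - p s (\<lambda>x. h x - f x) > 0" using assms by simp
  ultimately show ?thesis unfolding nbhd_def using assms(2) by blast
qed

text \<open>The generating balls form a priori only a subbase. Monotonicity puts a ball into the
  intersection of two concentric ones, so the sets that are neighbourhoods of all their points form
  a topology; it contains the generators, and the generated topology is the coarsest such.\<close>

lemma openin_seminorm_iff: "openin \<T> U \<longleftrightarrow> U \<subseteq> X \<and> (\<forall>f\<in>U. nbhd f U)"
proof
  assume U: "openin \<T> U"
  let ?Q = "\<lambda>U. U \<subseteq> X \<and> (\<forall>f\<in>U. nbhd f U)"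
  have "istopology ?Q"
    unfolding istopology_def
  proof (intro conjI allI impI)
    fix S T assume "?Q S" "?Q T"
    then show "S \<inter> T \<subseteq> X" "\<forall>f\<in>S \<inter> T. nbhd f (S \<inter> T)"
      using nbhd_Int by (blast, blast)
  next
    fix K assume K: "\<forall>S\<in>K. ?Q S"
    then show "\<Union>K \<subseteq> X" by blast
    show "\<forall>f\<in>\<Union>K. nbhd f (\<Union>K)"
    proof
      fix f assume "f \<in> \<Union>K"
      then obtain S where "S \<in> K" "nbhd f S" using K by blast
      then show "nbhd f (\<Union>K)" by (auto intro: nbhd_mono)
    qed
  qed
  moreover have "?Q S" if "S \<in> {{g \<in> X. p s (\<lambda>x. g x - f x) < \<epsilon>} | f s \<epsilon>. f \<in> X \<and> s > 0 \<and> \<epsilon> > 0}" for S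
    using that nbhd_ball by blast
  moreover have "generate_topology_on {{g \<in> X. p s (\<lambda>x. g x - f x) < \<epsilon>} | f s \<epsilon>. f \<in> X \<and> s > 0 \<and> \<epsilon> > 0} U"
    using U by (simp add: seminorm_topology_def openin_topology_generated_by_iff)
  ultimately show "?Q U"
    by (rule generate_topology_on_coarsest)
next
  assume R: "U \<subseteq> X \<and> (\<forall>f\<in>U. nbhd f U)"
  define W where "W = {V. openin \<T> V \<and> V \<subseteq> U}"
  have "f \<in> \<Union>W" if f: "f \<in> U" for f
  proof -
    obtain s \<epsilon> where s: "s > 0" "\<epsilon> > 0" "{g \<in> X. p s (\<lambda>x. g x - f x) < \<epsilon>} \<subseteq> U"
      using R f unfolding nbhd_def by blast
    have "f \<in> X" using R f by blast
    then have "f \<in> {g \<in> X. p s (\<lambda>x. g x - f x) < \<epsilon>}"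
      using s p_zero by simp
    moreover have "{g \<in> X. p s (\<lambda>x. g x - f x) < \<epsilon>} \<in> W"
      using openin_ball [OF \<open>f \<in> X\<close> s(1,2)] s(3) by (simp add: W_def)
    ultimately show ?thesis by blast
  qed
  then have "U = \<Union>W" unfolding W_def by blast
  moreover have "openin \<T> (\<Union>W)"
    by (rule openin_Union) (simp add: W_def)
  ultimately show "openin \<T> U" by simp
qed

lemma limitin_seminorm:
  assumes f: "f \<in> X" and F: "\<And>N. F N \<in> X"
  shows "limitin \<T> F f sequentially \<longleftrightarrow> (\<forall>s>0. (\<lambda>N. p s (\<lambda>x. F N x - f x)) \<longlonglongrightarrow> 0)"
proof
  assume lim: "limitin \<T> F f sequentially"
  show "\<forall>s>0. (\<lambda>N. p s (\<lambda>x. F N x - f x)) \<longlonglongrightarrow> 0"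
  proof (intro allI impI LIMSEQ_I)
    fix s r :: real assume "0 < s" "0 < r"
    have "openin \<T> {g \<in> X. p s (\<lambda>x. g x - f x) < r}"
      by (rule openin_ball) fact+
    moreover have "f \<in> {g \<in> X. p s (\<lambda>x. g x - f x) < r}"
      using \<open>0 < s\<close> \<open>0 < r\<close> f p_zero by simp
    ultimately have "eventually (\<lambda>N. F N \<in> {g \<in> X. p s (\<lambda>x. g x - f x) < r}) sequentially"
      using lim by (auto simp: limitin_def)
    then show "\<exists>no. \<forall>n\<ge>no. norm (p s (\<lambda>x. F n x - f x) - 0) < r"
      using p_nonneg [OF \<open>0 < s\<close> diff_closed [OF F f]] by (auto simp: eventually_sequentially)
  qed
next
  assume R: "\<forall>s>0. (\<lambda>N. p s (\<lambda>x. F N x - f x)) \<longlonglongrightarrow> 0"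
  show "limitin \<T> F f sequentially"
    unfolding limitin_def
  proof (intro conjI allI impI)
    fix U assume U: "openin \<T> U \<and> f \<in> U"
    then have "nbhd f U" by (simp add: openin_seminorm_iff)
    then obtain s \<epsilon> where s: "s > 0" "\<epsilon> > 0" "{g \<in> X. p s (\<lambda>x. g x - f x) < \<epsilon>} \<subseteq> U"
      unfolding nbhd_def by blast
    have "eventually (\<lambda>N. p s (\<lambda>x. F N x - f x) < \<epsilon>) sequentially"
      using R s by (auto intro: order_tendstoD)
    then show "eventually (\<lambda>N. F N \<in> U) sequentially"
      by eventually_elim (use s F in auto)
  qed (use f in simp)
qed

lemma limitin_pointwise:
  assumes "f \<in> X" "\<And>N. F N \<in> X" "limitin \<T> F f sequentially"
  shows "(\<lambda>N. F N y) \<longlonglongrightarrow> f y"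
proof -
  obtain s where s: "s > 0" "\<And>f. f \<in> X \<Longrightarrow> cmod (f y) \<le> p s f"
    using evaluation_bounded by blast
  have "(\<lambda>N. p s (\<lambda>x. F N x - f x)) \<longlonglongrightarrow> 0"
    using assms limitin_seminorm s by auto
  then have "(\<lambda>N. F N y - f y) \<longlonglongrightarrow> 0"
    by (rule Lim_null_comparison [rotated]) (use s assms diff_closed in \<open>auto intro!: always_eventually\<close>)
  then show ?thesis by (simp add: LIM_zero_iff)
qed

lemma operator_lin:
  assumes "continuous_linear_operator \<T> T" "f \<in> X" "g \<in> X"
  shows "T (\<lambda>x. a * f x + b * g x) = (\<lambda>x. a * T f x + b * T g x)"
  using assms unfolding continuous_linear_operator_def topspace_seminorm by blast

lemma operator_zero:
  assumes "continuous_linear_operator \<T> T"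
  shows "T (\<lambda>x. 0) = (\<lambda>x. 0)"
  using operator_lin [OF assms zero_closed zero_closed, of 0 0] by simp

lemma operator_closed:
  assumes "continuous_linear_operator \<T> T" "f \<in> X"
  shows "T f \<in> X"
  using assms continuous_map_image_subset_topspace [of \<T> \<T> T]
  by (auto simp: continuous_linear_operator_def)

lemma operator_sum:
  assumes T: "continuous_linear_operator \<T> T" and f: "\<And>i. i \<in> I \<Longrightarrow> f i \<in> X"
  shows "T (\<lambda>x. \<Sum>i\<in>I. c i * f i x) = (\<lambda>x. \<Sum>i\<in>I. c i * T (f i) x)"
  using f
proof (induction I rule: infinite_finite_induct)
  case (insert i I)
  then show ?case
    using operator_lin [OF T _ sum_closed [of I f c], of "f i" "c i" 1] by simp
qed (auto simp: operator_zero [OF T])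

lemma operator_limit:
  assumes "continuous_linear_operator \<T> T" "limitin \<T> F f sequentially"
  shows "limitin \<T> (\<lambda>N. T (F N)) (T f) sequentially"
  using continuous_map_limit [of \<T> \<T> T F f] assms
  by (simp add: continuous_linear_operator_def comp_def)

end

section \<open>Gaussian series along the orbits of an operator\<close>

text \<open>\<open>T_x\<close> is oriented so that applying \<open>T\<close> to the series with
  coefficients \<open>\<omega>\<close> gives the series with coefficients
  \<open>coord_shift \<pi> \<omega>\<close>. The numbers \<open>b s k\<close> dominate the seminorms
  of the vectors. \<open>series_closed\<close> and \<open>series_limit\<close> replace completeness
  of the space: they speak only of series in these vectors.\<close>

locale orbit_series = seminormed_functions X p
  for X :: "('a \<Rightarrow> complex) set" and p :: "real \<Rightarrow> ('a \<Rightarrow> complex) \<Rightarrow> real" +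
  fixes T :: "('a \<Rightarrow> complex) \<Rightarrow> ('a \<Rightarrow> complex)"
    and x :: "nat \<Rightarrow> 'a \<Rightarrow> complex" and b :: "real \<Rightarrow> nat \<Rightarrow> real" and \<pi> :: "nat \<Rightarrow> nat"
  assumes T: "continuous_linear_operator \<T> T"
    and x_closed: "x k \<in> X"
    and T_x: "T (x (\<pi> k)) = x k"
    and bij_\<pi>: "bij \<pi>"
    and wandering: "eventually (\<lambda>n. (\<pi> ^^ n) j \<noteq> k) sequentially"
    and p_x_le: "0 < s \<Longrightarrow> p s (x k) \<le> b s k"
    and b_mono: "0 < s \<Longrightarrow> s \<le> t \<Longrightarrow> b s k \<le> b t k"
    and summable_b: "0 < s \<Longrightarrow> summable (b s)"
    and series_closed: "(\<And>s. 0 < s \<Longrightarrow> summable (\<lambda>k. cmod (z k) * b s k)) \<Longrightarrow>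
          (\<lambda>y. \<Sum>k. z k * x k y) \<in> X"
    and series_limit: "(\<And>s. 0 < s \<Longrightarrow> summable (\<lambda>k. cmod (z k) * b s k)) \<Longrightarrow> 0 < s \<Longrightarrow>
          (\<lambda>N. p s (\<lambda>y. (\<Sum>k<N. z k * x k y) - (\<Sum>k. z k * x k y))) \<longlonglongrightarrow> 0"
    and span_dense: "f \<in> X \<Longrightarrow> 0 < s \<Longrightarrow> 0 < \<epsilon> \<Longrightarrow>
          \<exists>N a. p s (\<lambda>y. f y - (\<Sum>k<N. a k * x k y)) < \<epsilon>"
begin

lemma b_nonneg: "0 < s \<Longrightarrow> 0 \<le> b s k"
  using p_nonneg [OF _ x_closed] p_x_le order_trans by blast

definition part :: "nat \<Rightarrow> (nat \<Rightarrow> complex) \<Rightarrow> 'a \<Rightarrow> complex" where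
  "part N \<omega> = (\<lambda>y. \<Sum>k<N. \<omega> k * x k y)"

lemma part_closed: "part N \<omega> \<in> X"
  unfolding part_def by (rule sum_closed) (rule x_closed)

text \<open>Extended nonnegative sums at integer scales make this a measurable set cut out by
  countably many conditions; \<open>b_mono\<close> recovers the remaining scales.\<close>

definition good :: "(nat \<Rightarrow> complex) set" where
  "good = {\<omega>. \<forall>m::nat. (\<Sum>k. ennreal (cmod (\<omega> k) * b (Suc m) k)) \<noteq> \<infinity>}"

text \<open>The value 0 off the set \<open>good\<close>, whose complement is null, makes the map
  total with values in \<open>X\<close>.\<close>

definition S :: "(nat \<Rightarrow> complex) \<Rightarrow> 'a \<Rightarrow> complex" where
  "S \<omega> = (if \<omega> \<in> good then (\<lambda>y. \<Sum>k. \<omega> k * x k y) else (\<lambda>y. 0))"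

lemma good_summable:
  assumes "\<omega> \<in> good" "0 < s"
  shows "summable (\<lambda>k. cmod (\<omega> k) * b s k)"
proof -
  obtain m :: nat where m: "s \<le> m" using real_arch_simple by blast
  have "summable (\<lambda>k. cmod (\<omega> k) * b (Suc m) k)"
    by (rule summable_suminf_not_top) (use assms b_nonneg in \<open>auto simp: good_def\<close>)
  then show ?thesis
    by (rule summable_comparison_test_ev [rotated])
      (use m assms b_nonneg b_mono [of s "Suc m"] in \<open>auto intro!: always_eventually mult_left_mono\<close>)
qed

lemma S_closed: "S \<omega> \<in> X"
  using series_closed good_summable zero_closed by (simp add: S_def)

lemma part_tendsto:
  assumes "\<omega> \<in> good"
  shows "0 < s \<Longrightarrow> (\<lambda>N. p s (\<lambda>y. part N \<omega> y - S \<omega> y)) \<longlonglongrightarrow> 0"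
  using series_limit [of \<omega> s] good_summable assms by (simp add: S_def part_def)

lemma part_limitin: "\<omega> \<in> good \<Longrightarrow> limitin \<T> (\<lambda>N. part N \<omega>) (S \<omega>) sequentially"
  by (subst limitin_seminorm [OF S_closed]) (auto intro: part_closed part_tendsto)

lemma part_diff_le:
  assumes "0 < s"
  shows "p s (\<lambda>y. part N \<omega> y - part N a y) \<le> (\<Sum>k<N. cmod (\<omega> k - a k) * b s k)"
proof -
  have "p s (\<lambda>y. \<Sum>k<N. (\<omega> k - a k) * x k y) \<le> (\<Sum>k<N. cmod (\<omega> k - a k) * p s (x k))"
    by (rule p_sum) (use assms x_closed in auto)
  also have "\<dots> \<le> (\<Sum>k<N. cmod (\<omega> k - a k) * b s k)"
    using assms p_x_le by (intro sum_mono mult_left_mono) auto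
  finally show ?thesis
    by (simp add: part_def sum_subtractf left_diff_distrib)
qed

text \<open>A partial sum depends on finitely many coordinates only, hence continuously on the
  sequence in the product topology, whose Borel sets are the measurable sets of
  \<open>gauss_seq\<close>.\<close>

lemma part_continuous:
  assumes U: "openin \<T> U"
  shows "open {\<omega>. part N \<omega> \<in> U}"
proof (subst open_subopen, rule ballI)
  fix a assume a: "a \<in> {\<omega>. part N \<omega> \<in> U}"
  then have "nbhd (part N a) U" using U by (simp add: openin_seminorm_iff)
  then obtain s \<epsilon> where s: "s > 0" "\<epsilon> > 0" "{g \<in> X. p s (\<lambda>y. g y - part N a y) < \<epsilon>} \<subseteq> U"
    unfolding nbhd_def by blast
  define W where "W = {\<omega> :: nat \<Rightarrow> complex. (\<Sum>k<N. cmod (\<omega> k - a k) * b s k) < \<epsilon>}"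
  have "open W"
    unfolding W_def by (intro open_Collect_less continuous_intros continuous_on_product_coordinates)
  moreover have "a \<in> W" using s by (simp add: W_def)
  moreover have "W \<subseteq> {\<omega>. part N \<omega> \<in> U}"
  proof
    fix \<omega> assume "\<omega> \<in> W"
    then have "p s (\<lambda>y. part N \<omega> y - part N a y) < \<epsilon>"
      using part_diff_le [OF s(1), of N \<omega> a] by (simp add: W_def)
    then show "\<omega> \<in> {\<omega>. part N \<omega> \<in> U}" using s part_closed by blast
  qed
  ultimately show "\<exists>W. open W \<and> a \<in> W \<and> W \<subseteq> {\<omega>. part N \<omega> \<in> U}" by blast
qed

lemma sets_good [measurable]: "good \<in> sets gauss_seq"
proof -
  have "{\<omega> \<in> space gauss_seq. \<forall>m::nat. (\<Sum>k. ennreal (cmod (\<omega> k) * b (Suc m) k)) \<noteq> \<infinity>} \<in> sets gauss_seq"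
    by measurable
  then show ?thesis by (simp add: good_def)
qed

text \<open>By monotone convergence the mean of the majorant series is the first moment of a
  gaussian times the convergent sum of the bounds. A function with finite integral is finite almost
  everywhere, and there are countably many scales.\<close>

lemma AE_good: "AE \<omega> in gauss_seq. \<omega> \<in> good"
proof -
  have "AE \<omega> in gauss_seq. (\<Sum>k. ennreal (cmod (\<omega> k) * b (Suc m) k)) \<noteq> \<infinity>" for m :: nat
  proof (rule nn_integral_PInf_AE)
    show "(\<lambda>\<omega>. \<Sum>k. ennreal (cmod (\<omega> k) * b (Suc m) k)) \<in> borel_measurable gauss_seq"
      by measurable
    let ?m1 = "\<integral>\<^sup>+z. ennreal (cmod z) \<partial>cgauss"
    have b: "0 \<le> b (Suc m) k" for k by (rule b_nonneg) simp
    have "(\<integral>\<^sup>+\<omega>. (\<Sum>k. ennreal (cmod (\<omega> k) * b (Suc m) k)) \<partial>gauss_seq)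
        = (\<Sum>k. \<integral>\<^sup>+\<omega>. ennreal (cmod (\<omega> k)) * ennreal (b (Suc m) k) \<partial>gauss_seq)"
      by (subst nn_integral_suminf) (auto simp: ennreal_mult b simp del: of_nat_Suc)
    also have "\<dots> = (\<Sum>k. ?m1 * ennreal (b (Suc m) k))"
      by (subst nn_integral_multc) (auto simp: nn_integral_gauss_seq_component simp del: of_nat_Suc)
    also have "\<dots> = ?m1 * ennreal (\<Sum>k. b (Suc m) k)"
      using b summable_b [of "Suc m"]
      by (simp add: suminf_ennreal2 [symmetric] del: of_nat_Suc)
    also have "\<dots> < \<infinity>"
      using cgauss_first_moment by (simp add: ennreal_mult_less_top)
    finally show "(\<integral>\<^sup>+\<omega>. (\<Sum>k. ennreal (cmod (\<omega> k) * b (Suc m) k)) \<partial>gauss_seq) \<noteq> \<infinity>" by simp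
  qed
  then show ?thesis by (simp add: good_def AE_all_countable del: of_nat_Suc)
qed

text \<open>The set of points whose neighbourhood of scale \<open>1 / (m + 1)\<close> stays in \<open>U\<close> up to some slack; the
  slack makes it open. As \<open>S\<close> is a pointwise limit of the partial sums, the preimage of \<open>U\<close> under
  \<open>S\<close> is described by the preimages of these sets under the partial sums, and no separability of
  the space has to be known in advance.\<close>

definition core :: "nat \<Rightarrow> ('a \<Rightarrow> complex) set \<Rightarrow> ('a \<Rightarrow> complex) set" where
  "core m U = {f \<in> X. \<exists>t > 1 / Suc m. {g \<in> X. p (Suc m) (\<lambda>y. g y - f y) < t} \<subseteq> U}"

lemma openin_core: "openin \<T> (core m U)"
  unfolding openin_seminorm_iff
proof (intro conjI ballI)
  show "core m U \<subseteq> X" by (auto simp: core_def)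
  fix f assume "f \<in> core m U"
  then obtain t where t: "f \<in> X" "t > 1 / Suc m" "{g \<in> X. p (Suc m) (\<lambda>y. g y - f y) < t} \<subseteq> U"
    by (auto simp: core_def)
  \<comment> \<open>Half of the slack of \<open>f\<close> is spent on moving to \<open>h\<close>;
    the other half remains as the slack of \<open>h\<close>.\<close>
  define r where "r = (t - 1 / Suc m) / 2"
  have r: "r > 0" using t(2) by (simp only: r_def half_gt_zero_iff diff_gt_0_iff_gt)
  have "t - r = r + 1 / Suc m" unfolding r_def by (simp only: field_sum_of_halves diff_eq_eq) argo
  then have r': "t - r > 1 / Suc m" using r by (simp only: less_add_same_cancel2)
  have "{g \<in> X. p (Suc m) (\<lambda>y. g y - f y) < r} \<subseteq> core m U"
  proof
    fix h assume h: "h \<in> {g \<in> X. p (Suc m) (\<lambda>y. g y - f y) < r}"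
    have "{g \<in> X. p (Suc m) (\<lambda>y. g y - h y) < t - r} \<subseteq> U"
    proof
      fix g assume g: "g \<in> {g \<in> X. p (Suc m) (\<lambda>y. g y - h y) < t - r}"
      have "p (Suc m) (\<lambda>y. g y - f y) < t"
        using p_triangle [of "Suc m" g h f] g h t(1) by (auto simp del: of_nat_Suc)
      then show "g \<in> U" using t(3) g by blast
    qed
    then show "h \<in> core m U" using h r' unfolding core_def by blast
  qed
  then show "nbhd f (core m U)"
    unfolding nbhd_def using r by (intro exI [of _ "real (Suc m)"]) auto
qed

lemma S_vimage:
  assumes U: "openin \<T> U" and \<omega>: "\<omega> \<in> good"
  shows "S \<omega> \<in> U \<longleftrightarrow> (\<exists>m N. \<forall>n\<ge>N. part n \<omega> \<in> core m U)"
proof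
  assume "S \<omega> \<in> U"
  then have "nbhd (S \<omega>) U" using U by (simp add: openin_seminorm_iff)
  then obtain s \<epsilon> where s: "s > 0" "\<epsilon> > 0" "{g \<in> X. p s (\<lambda>y. g y - S \<omega> y) < \<epsilon>} \<subseteq> U"
    unfolding nbhd_def by blast
  \<comment> \<open>The scale must be fine enough that \<open>p (Suc m)\<close> dominates
    \<open>p s\<close> and that radius \<open>\<epsilon> / 2\<close> exceeds 1 / (m + 1). The other
    \<open>\<epsilon> / 2\<close> absorbs the distance from the partial sum to its limit.\<close>
  obtain m :: nat where m: "max s (2 / \<epsilon>) < m" using reals_Archimedean2 by blast
  have m': "s \<le> Suc m" "1 / Suc m < \<epsilon> / 2"
    using m s by (auto simp: field_simps)
  have "eventually (\<lambda>n. p s (\<lambda>y. part n \<omega> y - S \<omega> y) < \<epsilon> / 2) sequentially"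
    using part_tendsto [OF \<omega> s(1)] s(2) by (intro order_tendstoD) auto
  then obtain N where N: "\<And>n. n \<ge> N \<Longrightarrow> p s (\<lambda>y. part n \<omega> y - S \<omega> y) < \<epsilon> / 2"
    by (auto simp: eventually_sequentially)
  have "part n \<omega> \<in> core m U" if n: "n \<ge> N" for n
  proof -
    have "{g \<in> X. p (Suc m) (\<lambda>y. g y - part n \<omega> y) < \<epsilon> / 2} \<subseteq> U"
    proof
      fix g assume g: "g \<in> {g \<in> X. p (Suc m) (\<lambda>y. g y - part n \<omega> y) < \<epsilon> / 2}"
      have "p s (\<lambda>y. g y - part n \<omega> y) \<le> p (Suc m) (\<lambda>y. g y - part n \<omega> y)"
        using g s m' by (intro p_mono diff_closed part_closed) auto
      then have "p s (\<lambda>y. g y - S \<omega> y) < \<epsilon>"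
        using p_triangle [of s g "part n \<omega>" "S \<omega>"] g N [OF n] s(1) part_closed S_closed by auto
      then show "g \<in> U" using s(3) g by blast
    qed
    then show ?thesis
      using m'(2) part_closed unfolding core_def by blast
  qed
  then show "\<exists>m N. \<forall>n\<ge>N. part n \<omega> \<in> core m U" by blast
next
  assume "\<exists>m N. \<forall>n\<ge>N. part n \<omega> \<in> core m U"
  then obtain m N where mN: "\<And>n. n \<ge> N \<Longrightarrow> part n \<omega> \<in> core m U" by blast
  have "eventually (\<lambda>n. p (Suc m) (\<lambda>y. part n \<omega> y - S \<omega> y) < 1 / Suc m) sequentially"
    using part_tendsto [OF \<omega>, of "Suc m"] by (intro order_tendstoD) auto
  then have "eventually (\<lambda>n. n \<ge> N \<and> p (Suc m) (\<lambda>y. part n \<omega> y - S \<omega> y) < 1 / Suc m) sequentially"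
    by (intro eventually_conj eventually_ge_at_top)
  then obtain n where n: "n \<ge> N" "p (Suc m) (\<lambda>y. part n \<omega> y - S \<omega> y) < 1 / Suc m"
    using eventually_happens by fastforce
  obtain t where t: "t > 1 / Suc m" "{g \<in> X. p (Suc m) (\<lambda>y. g y - part n \<omega> y) < t} \<subseteq> U"
    using mN [OF n(1)] unfolding core_def by blast
  have "p (Suc m) (\<lambda>y. S \<omega> y - part n \<omega> y) < t"
    using n(2) t(1) p_swap [OF _ S_closed part_closed, of "Suc m" \<omega> n \<omega>] by simp
  then show "S \<omega> \<in> U" using t(2) S_closed by blast
qed

lemma S_measurable [measurable]: "S \<in> measurable gauss_seq (borel_measure_space \<T>)"
  unfolding borel_measure_space_def
proof (rule measurable_measure_of)
  show "{U. openin \<T> U} \<subseteq> Pow (topspace \<T>)" using openin_subset [of \<T>] by auto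
  show "S \<in> space gauss_seq \<rightarrow> topspace \<T>" using S_closed by auto
  fix U assume "U \<in> {U. openin \<T> U}"
  then have U: "openin \<T> U" by simp
  have [measurable]: "Measurable.pred gauss_seq (\<lambda>\<omega>. part n \<omega> \<in> core m U)" for n m
    using part_continuous [OF openin_core] by (simp add: pred_def sets_gauss_seq_borel)
  define Q where "Q \<omega> \<longleftrightarrow>
      (if \<omega> \<in> good then \<exists>m N. \<forall>n\<ge>N. part n \<omega> \<in> core m U else (\<lambda>y. 0) \<in> U)" for \<omega>
  have "S \<omega> \<in> U \<longleftrightarrow> Q \<omega>" for \<omega>
    using S_vimage [OF U, of \<omega>] by (simp add: S_def Q_def)
  then have "S -` U \<inter> space gauss_seq = {\<omega> \<in> space gauss_seq. Q \<omega>}"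
    by auto
  also have "\<dots> \<in> sets gauss_seq" unfolding Q_def by measurable
  finally show "S -` U \<inter> space gauss_seq \<in> sets gauss_seq" .
qed

text \<open>Evaluate at a point. The term of index \<open>\<pi> k\<close> of the image series is the
  \<open>k\<close>-th term of the shifted series, so the two are rearrangements of each other;
  goodness of the shifted sequence gives the absolute convergence that permits this.\<close>

lemma T_S:
  assumes \<omega>: "\<omega> \<in> good" and \<omega>': "coord_shift \<pi> \<omega> \<in> good"
  shows "T (S \<omega>) = S (coord_shift \<pi> \<omega>)"
proof
  fix y
  obtain s where s: "s > 0" "\<And>f. f \<in> X \<Longrightarrow> cmod (f y) \<le> p s f"
    using evaluation_bounded by blast
  define g where "g = (\<lambda>k. \<omega> k * T (x k) y)"
  have "limitin \<T> (\<lambda>N. T (part N \<omega>)) (T (S \<omega>)) sequentially"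
    by (rule operator_limit [OF T part_limitin [OF \<omega>]])
  then have "(\<lambda>N. T (part N \<omega>) y) \<longlonglongrightarrow> T (S \<omega>) y"
    by (rule limitin_pointwise [rotated 2]) (auto intro: operator_closed [OF T] S_closed part_closed)
  moreover have "T (part N \<omega>) y = (\<Sum>k<N. g k)" for N
    unfolding part_def g_def by (subst operator_sum [OF T]) (auto simp: x_closed)
  ultimately have 1: "g sums T (S \<omega>) y" by (simp add: sums_def)
  have g\<pi>: "g (\<pi> k) = coord_shift \<pi> \<omega> k * x k y" for k
    by (simp add: g_def T_x coord_shift_def)
  have "summable (\<lambda>k. norm (g (\<pi> k)))"
  proof (rule summable_comparison_test_ev [OF _ good_summable [OF \<omega>' s(1)]])
    show "\<forall>\<^sub>F k in sequentially. norm (norm (g (\<pi> k))) \<le> cmod (coord_shift \<pi> \<omega> k) * b s k"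
    proof (intro always_eventually allI)
      fix k
      have "cmod (x k y) \<le> b s k"
        using s(2) [OF x_closed, of k] p_x_le [OF s(1), of k] by (rule order_trans)
      then show "norm (norm (g (\<pi> k))) \<le> cmod (coord_shift \<pi> \<omega> k) * b s k"
        by (simp add: g\<pi> norm_mult mult_left_mono)
    qed
  qed
  moreover have "(\<lambda>k. g (\<pi> k)) sums S (coord_shift \<pi> \<omega>) y"
    using summable_norm_cancel [OF \<open>summable (\<lambda>k. norm (g (\<pi> k)))\<close>] \<omega>'
    by (simp add: S_def g\<pi> summable_sums)
  ultimately have "((\<lambda>k. g (\<pi> k)) has_sum S (coord_shift \<pi> \<omega>) y) UNIV"
    by (rule norm_summable_imp_has_sum)
  then have "(g has_sum S (coord_shift \<pi> \<omega>) y) UNIV"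
    by (subst (asm) has_sum_reindex_bij_betw [OF bij_\<pi>])
  then have "g sums S (coord_shift \<pi> \<omega>) y" by (rule has_sum_imp_sums)
  with 1 show "T (S \<omega>) y = S (coord_shift \<pi> \<omega>) y" by (rule sums_unique2)
qed

lemma inj_\<pi>: "inj \<pi>"
  using bij_\<pi> by (rule bij_is_inj)

lemma AE_good_shifts: "AE \<omega> in gauss_seq. \<forall>n. coord_shift (\<pi> ^^ n) \<omega> \<in> good"
proof -
  have "AE \<omega> in gauss_seq. coord_shift (\<pi> ^^ n) \<omega> \<in> good" for n
  proof -
    have "AE \<omega> in distr gauss_seq gauss_seq (coord_shift (\<pi> ^^ n)). \<omega> \<in> good"
      using AE_good by (simp only: distr_shift [OF inj_fn [OF inj_\<pi>]])
    then show ?thesis by (rule AE_distrD [OF measurable_shift])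
  qed
  then show ?thesis by (simp add: AE_all_countable)
qed

lemma AE_T_S: "AE \<omega> in gauss_seq. \<forall>n. (T ^^ n) (S \<omega>) = S (coord_shift (\<pi> ^^ n) \<omega>)"
  using AE_good_shifts
proof eventually_elim
  case (elim \<omega>)
  have "(T ^^ n) (S \<omega>) = S (coord_shift (\<pi> ^^ n) \<omega>)" for n
  proof (induction n)
    case 0
    then show ?case by (simp add: coord_shift_def)
  next
    case (Suc n)
    have eq: "coord_shift \<pi> (coord_shift (\<pi> ^^ n) \<omega>) = coord_shift (\<pi> ^^ Suc n) \<omega>"
      by (simp add: coord_shift_def funpow_swap1)
    have "T (S (coord_shift (\<pi> ^^ n) \<omega>)) = S (coord_shift \<pi> (coord_shift (\<pi> ^^ n) \<omega>))"
      by (rule T_S) (use elim in \<open>simp_all only: eq\<close>)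
    then show ?case
      using Suc by (simp add: eq comp_def)
  qed
  then show ?case by blast
qed

definition \<mu> :: "('a \<Rightarrow> complex) measure" where
  "\<mu> = distr gauss_seq (borel_measure_space \<T>) S"

lemma space_\<mu> [simp]: "space \<mu> = X"
  by (simp add: \<mu>_def borel_measure_space_def space_measure_of_conv)

lemma sets_\<mu>: "sets \<mu> = sets (borel_measure_space \<T>)"
  by (simp add: \<mu>_def)

lemma measurable_T: "T ^^ n \<in> measurable \<mu> \<mu>"
proof -
  have "T \<in> measurable (borel_measure_space \<T>) (borel_measure_space \<T>)"
    unfolding borel_measure_space_def
  proof (rule measurable_measure_of)
    show "{U. openin \<T> U} \<subseteq> Pow (topspace \<T>)" using openin_subset [of \<T>] by auto
    show "T \<in> space (sigma (topspace \<T>) {U. openin \<T> U}) \<rightarrow> topspace \<T>"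
      using operator_closed [OF T] by (auto simp: space_measure_of_conv)
    fix U assume "U \<in> {U. openin \<T> U}"
    then have "openin \<T> {f \<in> topspace \<T>. T f \<in> U}"
      using T openin_continuous_map_preimage [of \<T> \<T> T U] by (simp add: continuous_linear_operator_def)
    moreover have "T -` U \<inter> space (sigma (topspace \<T>) {U. openin \<T> U}) = {f \<in> topspace \<T>. T f \<in> U}"
      by (auto simp: space_measure_of_conv)
    moreover have "{U. openin \<T> U} \<subseteq> Pow (topspace \<T>)" using openin_subset [of \<T>] by auto
    ultimately show "T -` U \<inter> space (sigma (topspace \<T>) {U. openin \<T> U}) \<in> sets (sigma (topspace \<T>) {U. openin \<T> U})"
      by (simp only:) (rule in_measure_of, auto)
  qed
  then have "T \<in> measurable \<mu> \<mu>"
    using measurable_cong_sets [OF sets_\<mu> sets_\<mu>] by blast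
  note 1 = this
  show ?thesis
  proof (induction n)
    case (Suc n)
    then show ?case using measurable_comp [OF Suc 1] by (simp add: comp_def)
  qed simp
qed

lemma measure_\<mu>: "B \<in> sets \<mu> \<Longrightarrow> emeasure \<mu> B = emeasure gauss_seq (S -` B)"
  using emeasure_distr [OF S_measurable, of B] by (simp add: \<mu>_def)

lemma sets_S_vimage: "B \<in> sets \<mu> \<Longrightarrow> S -` B \<in> sets gauss_seq"
  using measurable_sets [OF S_measurable, of B] by (simp add: sets_\<mu>)

text \<open>\<open>S\<close> carries the shift to \<open>T\<close> only almost surely, so the two
  preimages agree up to a null set rather than as sets. Both invariance and mixing of the image
  measure are read off from this formula.\<close>

lemma measure_\<mu>_Int:
  assumes "B \<in> sets \<mu>" "D \<in> sets \<mu>"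
  shows "emeasure \<mu> (B \<inter> ((T ^^ n) -` D \<inter> space \<mu>))
       = emeasure gauss_seq (S -` B \<inter> coord_shift (\<pi> ^^ n) -` (S -` D))"
proof -
  have *: "(T ^^ n) -` D \<inter> space \<mu> \<in> sets \<mu>"
    by (rule measurable_sets [OF measurable_T assms(2)])
  have "emeasure \<mu> (B \<inter> ((T ^^ n) -` D \<inter> space \<mu>))
      = emeasure gauss_seq (S -` (B \<inter> ((T ^^ n) -` D \<inter> space \<mu>)))"
    by (rule measure_\<mu>) (use assms * in auto)
  also have "\<dots> = emeasure gauss_seq (S -` B \<inter> coord_shift (\<pi> ^^ n) -` (S -` D))"
  proof (rule emeasure_eq_AE)
    show "AE \<omega> in gauss_seq. \<omega> \<in> S -` (B \<inter> ((T ^^ n) -` D \<inter> space \<mu>)) \<longleftrightarrow>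
        \<omega> \<in> S -` B \<inter> coord_shift (\<pi> ^^ n) -` (S -` D)"
      using AE_T_S by eventually_elim (auto simp: S_closed)
    show "S -` (B \<inter> ((T ^^ n) -` D \<inter> space \<mu>)) \<in> sets gauss_seq"
      by (rule sets_S_vimage) (use assms * in auto)
    show "S -` B \<inter> coord_shift (\<pi> ^^ n) -` (S -` D) \<in> sets gauss_seq"
      using assms by (intro sets.Int sets_S_vimage sets_shift_vimage)
  qed
  finally show ?thesis .
qed

lemma \<mu>_gaussian: "gaussian_measure \<T> \<mu>"
  unfolding gaussian_measure_def
proof (intro exI conjI)
  show "prob_space gauss_seq" by (rule gauss_seq.prob_space_axioms)
  show "gauss_seq.indep_vars (\<lambda>_. borel) (\<lambda>k \<omega>. \<omega> k) UNIV" by (rule gauss_seq_indep)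
  show "\<forall>n. standard_complex_gaussian gauss_seq (\<lambda>\<omega>. \<omega> n)" by (simp add: gauss_seq_standard)
  show "\<forall>n. x n \<in> topspace \<T>" by (simp add: x_closed)
  show "S \<in> measurable gauss_seq (borel_measure_space \<T>)" by (rule S_measurable)
  show "AE \<omega> in gauss_seq. limitin \<T> (\<lambda>N y. \<Sum>n<N. \<omega> n * x n y) (S \<omega>) sequentially"
    using AE_good by eventually_elim (use part_limitin in \<open>auto simp: part_def\<close>)
  show "\<mu> = distr gauss_seq (borel_measure_space \<T>) S" by (rule \<mu>_def)
qed

end

section \<open>Full support of the gaussian law\<close>

context orbit_series
begin

lemma emeasure_cylinder_pos:
  assumes "0 < \<eta>"
  shows "0 < emeasure gauss_seq (cylinder {..<N} (\<lambda>k. ball (a k) \<eta>))"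
proof -
  have "0 < (\<Prod>k<N. emeasure cgauss (ball (a k) \<eta>))"
    using cgauss_ball_pos [OF assms] by (induction N) (auto simp: ennreal_zero_less_mult_iff)
  then show ?thesis by (subst emeasure_cylinder) auto
qed

lemma nn_integral_cylinder_component:
  assumes "N \<le> j" and D: "\<And>k. D k \<in> sets borel"
  shows "(\<integral>\<^sup>+\<omega>. indicator (cylinder {..<N} D) \<omega> * ennreal (cmod (\<omega> j)) \<partial>gauss_seq)
       = emeasure gauss_seq (cylinder {..<N} D) * (\<integral>\<^sup>+z. ennreal (cmod z) \<partial>cgauss)"
proof -
  \<comment> \<open>The indicator of the cylinder and the modulus of a later coordinate become one
    product of functions of separate coordinates, whose expectation factors by independence.\<close>
  define Y where "Y i z = (if i = j then ennreal (cmod z) else indicator (D i) z)" for i z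
  have Y [measurable]: "Y i \<in> borel_measurable borel" for i
    using D [of i] by (cases "i = j") (auto simp: Y_def [abs_def])
  have "gauss_seq.indep_vars (\<lambda>_. borel) (\<lambda>i \<omega>. Y i (\<omega> i)) {..<N}"
    "gauss_seq.indep_vars (\<lambda>_. borel) (\<lambda>i \<omega>. Y i (\<omega> i)) (insert j {..<N})"
    by (rule gauss_seq.indep_vars_compose2 [OF gauss_seq.indep_vars_subset [OF gauss_seq_indep]]; simp)+
  note indep = this
  have ind: "(\<Prod>i<N. Y i (\<omega> i)) = indicator (cylinder {..<N} D) \<omega>" for \<omega>
  proof -
    have "(\<Prod>i<N. Y i (\<omega> i)) = (\<Prod>i<N. indicator (D i) (\<omega> i))"
      using assms(1) by (intro prod.cong) (auto simp: Y_def)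
    also have "\<dots> = indicator (cylinder {..<N} D) \<omega>"
      by (auto simp: cylinder_def indicator_def)
    finally show ?thesis .
  qed
  have "(\<integral>\<^sup>+\<omega>. indicator (cylinder {..<N} D) \<omega> * ennreal (cmod (\<omega> j)) \<partial>gauss_seq)
      = (\<integral>\<^sup>+\<omega>. (\<Prod>i\<in>insert j {..<N}. Y i (\<omega> i)) \<partial>gauss_seq)"
    using assms(1) by (simp add: ind mult.commute) (simp add: Y_def)
  also have "\<dots> = (\<Prod>i\<in>insert j {..<N}. \<integral>\<^sup>+\<omega>. Y i (\<omega> i) \<partial>gauss_seq)"
    by (rule gauss_seq.indep_vars_nn_integral) (use indep in auto)
  also have "\<dots> = (\<integral>\<^sup>+\<omega>. Y j (\<omega> j) \<partial>gauss_seq) * (\<Prod>i<N. \<integral>\<^sup>+\<omega>. Y i (\<omega> i) \<partial>gauss_seq)"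
    using assms(1) by simp
  also have "(\<Prod>i<N. \<integral>\<^sup>+\<omega>. Y i (\<omega> i) \<partial>gauss_seq) = (\<integral>\<^sup>+\<omega>. (\<Prod>i<N. Y i (\<omega> i)) \<partial>gauss_seq)"
    by (rule gauss_seq.indep_vars_nn_integral [symmetric]) (use indep in auto)
  also have "\<dots> = emeasure gauss_seq (cylinder {..<N} D)"
    using D by (simp add: ind sets_cylinder)
  also have "(\<integral>\<^sup>+\<omega>. Y j (\<omega> j) \<partial>gauss_seq) = (\<integral>\<^sup>+z. ennreal (cmod z) \<partial>cgauss)"
    by (simp add: Y_def nn_integral_gauss_seq_component)
  finally show ?thesis by (simp add: mult.commute)
qed

text \<open>The tail of the series is controlled in mean on every cylinder over the first coordinates, as
  the coordinates are independent; hence it is small on a part of the cylinder of positive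
  measure.\<close>

lemma cylinder_small_tail_pos:
  assumes D: "\<And>k. D k \<in> sets borel" "emeasure gauss_seq (cylinder {..<N} D) > 0"
    and s: "0 < s" and \<delta>: "0 < \<delta>"
    and small: "(\<integral>\<^sup>+z. ennreal (cmod z) \<partial>cgauss) * ennreal (\<Sum>k. b s (k + N)) < ennreal \<delta>"
  shows "0 < emeasure gauss_seq
           (cylinder {..<N} D \<inter> {\<omega>. (\<Sum>k. ennreal (cmod (\<omega> (k + N)) * b s (k + N))) < ennreal \<delta>})"
    (is "0 < emeasure gauss_seq (?C \<inter> {\<omega>. ?t \<omega> < _})")
proof (rule ccontr)
  assume "\<not> ?thesis"
  then have z: "emeasure gauss_seq (?C \<inter> {\<omega>. ?t \<omega> < ennreal \<delta>}) = 0" by simp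
  let ?m1 = "\<integral>\<^sup>+z. ennreal (cmod z) \<partial>cgauss"
  have C [measurable]: "?C \<in> sets gauss_seq" using D by (intro sets_cylinder) auto
  have t [measurable]: "?t \<in> borel_measurable gauss_seq" by measurable
  have "{\<omega> \<in> space gauss_seq. ?t \<omega> < ennreal \<delta>} \<in> sets gauss_seq" by measurable
  then have "?C \<inter> {\<omega>. ?t \<omega> < ennreal \<delta>} \<in> null_sets gauss_seq"
    using C z by (auto simp: null_sets_def)
  then have ae: "AE \<omega> in gauss_seq. \<omega> \<notin> ?C \<inter> {\<omega>. ?t \<omega> < ennreal \<delta>}"
    by (rule AE_not_in)
  \<comment> \<open>Markov's argument: a tail that is at least \<open>\<delta>\<close> almost
    everywhere on the cylinder has mean at least \<open>\<delta>\<close> times the measure of the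
    cylinder, which contradicts \<open>small\<close>.\<close>
  have "ennreal \<delta> * emeasure gauss_seq ?C = (\<integral>\<^sup>+\<omega>. ennreal \<delta> * indicator ?C \<omega> \<partial>gauss_seq)"
    using C by (simp add: nn_integral_cmult_indicator)
  also have "\<dots> \<le> (\<integral>\<^sup>+\<omega>. indicator ?C \<omega> * ?t \<omega> \<partial>gauss_seq)"
    by (rule nn_integral_mono_AE)
      (use ae in eventually_elim, auto simp: indicator_def not_less)
  also have "\<dots> = (\<integral>\<^sup>+\<omega>. (\<Sum>k. indicator ?C \<omega> * ennreal (cmod (\<omega> (k + N))) * ennreal (b s (k + N))) \<partial>gauss_seq)"
  proof (rule nn_integral_cong)
    fix \<omega>
    have "indicator ?C \<omega> * ?t \<omega> = (\<Sum>k. indicator ?C \<omega> * ennreal (cmod (\<omega> (k + N)) * b s (k + N)))"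
      by (rule ennreal_suminf_cmult [symmetric])
    also have "\<dots> = (\<Sum>k. indicator ?C \<omega> * ennreal (cmod (\<omega> (k + N))) * ennreal (b s (k + N)))"
      using b_nonneg [OF s] by (intro suminf_cong) (simp only: ennreal_mult norm_ge_zero mult.assoc)
    finally show "indicator ?C \<omega> * ?t \<omega> =
        (\<Sum>k. indicator ?C \<omega> * ennreal (cmod (\<omega> (k + N))) * ennreal (b s (k + N)))" .
  qed
  also have "\<dots> = (\<Sum>k. (\<integral>\<^sup>+\<omega>. indicator ?C \<omega> * ennreal (cmod (\<omega> (k + N))) \<partial>gauss_seq) * ennreal (b s (k + N)))"
  proof (subst nn_integral_suminf)
    show "(\<lambda>\<omega>. indicator ?C \<omega> * ennreal (cmod (\<omega> (k + N))) * ennreal (b s (k + N))) \<in> borel_measurable gauss_seq" for k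
      by measurable
    show "(\<Sum>k. \<integral>\<^sup>+\<omega>. indicator ?C \<omega> * ennreal (cmod (\<omega> (k + N))) * ennreal (b s (k + N)) \<partial>gauss_seq)
        = (\<Sum>k. (\<integral>\<^sup>+\<omega>. indicator ?C \<omega> * ennreal (cmod (\<omega> (k + N))) \<partial>gauss_seq) * ennreal (b s (k + N)))"
      by (intro suminf_cong nn_integral_multc) measurable
  qed
  also have "\<dots> = (\<Sum>k. (emeasure gauss_seq ?C * ?m1) * ennreal (b s (k + N)))"
    using nn_integral_cylinder_component [OF _ D(1)] by simp
  also have "\<dots> = emeasure gauss_seq ?C * (?m1 * ennreal (\<Sum>k. b s (k + N)))"
    using summable_ignore_initial_segment [OF summable_b [OF s], of N] b_nonneg [OF s]
    by (simp only: ennreal_suminf_cmult suminf_ennreal2 mult.assoc)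
  also have "\<dots> < emeasure gauss_seq ?C * ennreal \<delta>"
    using small D(2)
    by (intro ennreal_mult_strict_left_mono) (auto simp: gauss_seq.emeasure_eq_measure)
  finally show False by (simp add: mult.commute)
qed

text \<open>Approximate a point \<open>f\<close> of \<open>U\<close> by a finite combination of the
  vectors, keep the first coordinates near its coefficients, and keep the tail small. This happens
  with positive probability, and approximation, head and tail each contribute at most
  \<open>\<delta>\<close>, a quarter of \<open>\<epsilon>\<close>.\<close>

lemma \<mu>_full_support:
  assumes U: "openin \<T> U" "U \<noteq> {}"
  shows "0 < emeasure \<mu> U"
proof -
  obtain f where f: "f \<in> U" using U by blast
  then have fX: "f \<in> X" using U(1) by (auto simp: openin_seminorm_iff)
  obtain s \<epsilon> where s: "s > 0" "\<epsilon> > 0" "{g \<in> X. p s (\<lambda>y. g y - f y) < \<epsilon>} \<subseteq> U"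
    using U(1) f unfolding openin_seminorm_iff nbhd_def by blast
  define \<delta> where "\<delta> = \<epsilon> / 4"
  have \<delta>: "\<delta> > 0" using s by (simp add: \<delta>_def)
  obtain N0 a0 where a0: "p s (\<lambda>y. f y - (\<Sum>k<N0. a0 k * x k y)) < \<delta>"
    using span_dense [OF fX s(1) \<delta>] by blast
  obtain m1 where m1: "(\<integral>\<^sup>+z. ennreal (cmod z) \<partial>cgauss) = ennreal m1" "0 \<le> m1"
    using cgauss_first_moment by (cases "\<integral>\<^sup>+z. ennreal (cmod z) \<partial>cgauss") auto
  have "(\<lambda>N. m1 * (\<Sum>k. b s (k + N))) \<longlonglongrightarrow> m1 * 0"
    by (intro tendsto_mult_left suminf_exist_split2 summable_b s)
  then have "eventually (\<lambda>N. m1 * (\<Sum>k. b s (k + N)) < \<delta>) sequentially"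
    using \<delta> by (intro order_tendstoD) auto
  then have "eventually (\<lambda>N. N \<ge> N0 \<and> m1 * (\<Sum>k. b s (k + N)) < \<delta>) sequentially"
    by (intro eventually_conj eventually_ge_at_top)
  then obtain N where N: "N \<ge> N0" "m1 * (\<Sum>k. b s (k + N)) < \<delta>"
    using eventually_happens by fastforce
  have bN: "summable (\<lambda>k. b s (k + N))" "0 \<le> (\<Sum>k. b s (k + N))"
    using summable_ignore_initial_segment [OF summable_b [OF s(1)], of N] b_nonneg [OF s(1)]
    by (auto intro: suminf_nonneg)
  \<comment> \<open>The tail may force \<open>N\<close> beyond the \<open>N0\<close> coefficients of
    the approximation; the coordinates in between are kept near 0.\<close>
  define a where "a k = (if k < N0 then a0 k else 0)" for k
  have "(\<Sum>k<N0. a0 k * x k y) = part N a y" for y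
  proof -
    have "part N a y = (\<Sum>k<N0. a k * x k y)"
      unfolding part_def using N(1) by (intro sum.mono_neutral_right) (auto simp: a_def)
    then show ?thesis by (simp add: a_def)
  qed
  then have a: "p s (\<lambda>y. f y - part N a y) < \<delta>" using a0 by simp
  define B where "B = (\<Sum>k<N. b s k)"
  have B: "0 \<le> B" unfolding B_def using b_nonneg s by (simp add: sum_nonneg)
  define \<eta> where "\<eta> = \<delta> / (B + 1)"
  have \<eta>: "0 < \<eta>" "\<eta> * B \<le> \<delta>"
    using \<delta> B by (auto simp: \<eta>_def field_simps)
  define C where "C = cylinder {..<N} (\<lambda>k. ball (a k) \<eta>)
      \<inter> {\<omega>. (\<Sum>k. ennreal (cmod (\<omega> (k + N)) * b s (k + N))) < ennreal \<delta>}"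
  have "0 < emeasure gauss_seq C"
    unfolding C_def
  proof (rule cylinder_small_tail_pos)
    show "(\<integral>\<^sup>+z. ennreal (cmod z) \<partial>cgauss) * ennreal (\<Sum>k. b s (k + N)) < ennreal \<delta>"
      using m1 N bN by (simp add: ennreal_mult [symmetric] ennreal_lessI \<delta>)
  qed (use s \<delta> \<eta> emeasure_cylinder_pos in auto)
  have "S \<omega> \<in> U" if \<omega>: "\<omega> \<in> C" "\<omega> \<in> good" for \<omega>
  proof -
    have head: "p s (\<lambda>y. part N \<omega> y - part N a y) \<le> \<delta>"
    proof -
      have "(\<Sum>k<N. cmod (\<omega> k - a k) * b s k) \<le> (\<Sum>k<N. \<eta> * b s k)"
        using \<omega>(1) b_nonneg [OF s(1)]
        by (intro sum_mono mult_right_mono) (auto simp: C_def cylinder_def dist_norm norm_minus_commute less_imp_le)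
      then show ?thesis
        using part_diff_le [OF s(1), of N \<omega> a] \<eta> by (simp add: B_def sum_distrib_left)
    qed
    define r where "r = (\<Sum>k. cmod (\<omega> (k + N)) * b s (k + N))"
    have sm: "summable (\<lambda>k. cmod (\<omega> (k + N)) * b s (k + N))"
      using summable_ignore_initial_segment [OF good_summable [OF \<omega>(2) s(1)], of N] .
    have "ennreal r < ennreal \<delta>"
      using \<omega>(1) b_nonneg [OF s(1)] sm by (simp add: C_def r_def suminf_ennreal2)
    then have r: "r < \<delta>" using \<delta> by (simp add: ennreal_less_iff r_def suminf_nonneg sm b_nonneg s)
    have part_le: "p s (\<lambda>y. part M \<omega> y - part N \<omega> y) \<le> r" if "M \<ge> N" for M
    proof -
      have "(\<lambda>y. part M \<omega> y - part N \<omega> y) = (\<lambda>y. \<Sum>k\<in>{N..<M}. \<omega> k * x k y)"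
        unfolding part_def using that by (simp add: sum_diff_nat_ivl lessThan_atLeast0 fun_eq_iff)
      then have "p s (\<lambda>y. part M \<omega> y - part N \<omega> y) \<le> (\<Sum>k\<in>{N..<M}. cmod (\<omega> k) * p s (x k))"
        using p_sum [OF s(1), of "{N..<M}" x \<omega>] x_closed by simp
      also have "\<dots> \<le> (\<Sum>k\<in>{N..<M}. cmod (\<omega> k) * b s k)"
        using p_x_le [OF s(1)] by (intro sum_mono mult_left_mono) auto
      also have "\<dots> = (\<Sum>k<M - N. cmod (\<omega> (k + N)) * b s (k + N))"
        using that sum.shift_bounds_nat_ivl [of "\<lambda>k. cmod (\<omega> k) * b s k" 0 N "M - N"]
        by (simp add: lessThan_atLeast0)
      also have "\<dots> \<le> r"
        unfolding r_def using sm b_nonneg [OF s(1)] by (intro sum_le_suminf) auto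
      finally show ?thesis .
    qed
    have tail: "p s (\<lambda>y. S \<omega> y - part N \<omega> y) \<le> r"
    proof (rule tendsto_lowerbound)
      show "(\<lambda>M. p s (\<lambda>y. part M \<omega> y - S \<omega> y) + r) \<longlonglongrightarrow> r"
        using tendsto_add [OF part_tendsto [OF \<omega>(2) s(1)] tendsto_const [of r]] by simp
      show "eventually (\<lambda>M. p s (\<lambda>y. S \<omega> y - part N \<omega> y)
          \<le> p s (\<lambda>y. part M \<omega> y - S \<omega> y) + r) sequentially"
        using eventually_ge_at_top [of N]
      proof eventually_elim
        case (elim M)
        show ?case
          using p_triangle [OF s(1) S_closed [of \<omega>] part_closed [of M \<omega>] part_closed [of N \<omega>]]
            part_le [OF elim] p_swap [OF s(1) S_closed [of \<omega>] part_closed [of M \<omega>]] by linarith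
      qed
    qed simp
    have "p s (\<lambda>y. S \<omega> y - f y) \<le> p s (\<lambda>y. S \<omega> y - part N \<omega> y) + p s (\<lambda>y. part N \<omega> y - f y)"
      by (rule p_triangle) (use s S_closed part_closed fX in auto)
    also have "p s (\<lambda>y. part N \<omega> y - f y)
        \<le> p s (\<lambda>y. part N \<omega> y - part N a y) + p s (\<lambda>y. part N a y - f y)"
      by (rule p_triangle) (use s part_closed fX in auto)
    finally have "p s (\<lambda>y. S \<omega> y - f y) < \<epsilon>"
      using tail r head a p_swap [OF s(1) part_closed fX, of N a] s(2) unfolding \<delta>_def by linarith
    then show ?thesis using s(3) S_closed by blast
  qed
  then have sub: "C \<inter> good \<subseteq> S -` U" by blast
  have Us: "U \<in> sets \<mu>"
    using U(1) openin_subset [of \<T>] unfolding sets_\<mu> borel_measure_space_def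
    by (intro in_measure_of) auto
  have "{\<omega> \<in> space gauss_seq. (\<Sum>k. ennreal (cmod (\<omega> (k + N)) * b s (k + N))) < ennreal \<delta>} \<in> sets gauss_seq"
    by measurable
  then have Cs: "C \<in> sets gauss_seq"
    unfolding C_def by (intro sets.Int sets_cylinder) auto
  have "emeasure gauss_seq C = emeasure gauss_seq (C \<inter> good)"
    by (rule emeasure_eq_AE) (use AE_good Cs in auto)
  also have "\<dots> \<le> emeasure gauss_seq (S -` U)"
    by (rule emeasure_mono [OF sub sets_S_vimage [OF Us]])
  also have "\<dots> = emeasure \<mu> U"
    by (rule measure_\<mu> [OF Us, symmetric])
  finally show ?thesis using \<open>0 < emeasure gauss_seq C\<close> by simp
qed

theorem strongly_mixing: "strongly_mixing_gaussian \<T> T"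
  unfolding strongly_mixing_gaussian_def
proof (intro conjI exI ballI allI impI)
  show "continuous_linear_operator \<T> T" by (rule T)
  show "gaussian_measure \<T> \<mu>" by (rule \<mu>_gaussian)
  show "emeasure \<mu> (T -` B \<inter> space \<mu>) = emeasure \<mu> B" if B: "B \<in> sets \<mu>" for B
  proof -
    have "emeasure \<mu> (T -` B \<inter> space \<mu>) = emeasure gauss_seq (coord_shift \<pi> -` (S -` B))"
    proof -
      \<comment> \<open>Invariance is the intersection formula for the whole space and one
        iterate.\<close>
      have "space \<mu> \<inter> ((T ^^ 1) -` B \<inter> space \<mu>) = T -` B \<inter> space \<mu>" by auto
      moreover have "S -` space \<mu> = UNIV" using S_closed by auto
      ultimately show ?thesis using measure_\<mu>_Int [OF sets.top B, of 1] by simp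
    qed
    also have "\<dots> = emeasure (distr gauss_seq gauss_seq (coord_shift \<pi>)) (S -` B)"
      using sets_S_vimage [OF B] by (simp add: emeasure_distr)
    also have "\<dots> = emeasure \<mu> B"
      by (simp add: distr_shift inj_\<pi> measure_\<mu> B)
    finally show ?thesis .
  qed
  show "0 < emeasure \<mu> U" if "openin \<T> U \<and> U \<noteq> {}" for U
    using that \<mu>_full_support by blast
  show "(\<lambda>n. measure \<mu> (B \<inter> ((T ^^ n) -` D \<inter> space \<mu>))) \<longlonglongrightarrow> measure \<mu> B * measure \<mu> D"
    if "B \<in> sets \<mu>" "D \<in> sets \<mu>" for B D
    using mixing_shift [OF inj_\<pi> wandering sets_S_vimage sets_S_vimage] that
    by (simp add: measure_def measure_\<mu> measure_\<mu>_Int del: space_\<mu>)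
qed

end

section \<open>Polynomial ideals\<close>

lemma (in complex_normed_space) minus_zero_right: "x \<in> vcarrier E \<Longrightarrow> vminus E x (vzero E) = x"
proof -
  assume x: "x \<in> vcarrier E"
  have "vscale E (-1) (vzero E) = vzero E"
    using add_neg [OF zero_closed] add_zero [OF zero_closed] add_commute zero_closed scale_closed
    by (metis add_zero)
  then show ?thesis using x by (simp add: vminus_def add_zero)
qed

lemma (in complex_normed_space) scale_zero_left: "x \<in> vcarrier E \<Longrightarrow> vscale E 0 x = vzero E"
  using add_scale [of x 1 "-1"] add_neg [of x] by (simp add: scale_one)

lemma (in complex_normed_space) norm_zero: "vnorm E (vzero E) = 0"
  using norm_eq_zero zero_closed by blast

lemma (in complex_normed_space) add_minus_cancel:
  "x \<in> vcarrier E \<Longrightarrow> y \<in> vcarrier E \<Longrightarrow> vadd E y (vminus E x y) = x"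
  unfolding vminus_def
  by (metis add_assoc add_commute add_neg add_zero scale_closed)

lemma (in complex_normed_space) unit_vector:
  assumes "v \<in> vcarrier E" "v \<noteq> vzero E"
  obtains u where "u \<in> vcarrier E" "vnorm E u = 1" "v = vscale E (vnorm E v) u"
proof
  have v: "vnorm E v > 0" using assms norm_nonneg norm_eq_zero by (metis order_le_less)
  let ?u = "vscale E (inverse (complex_of_real (vnorm E v))) v"
  show "?u \<in> vcarrier E" using assms scale_closed by blast
  show "vnorm E ?u = 1" using assms v by (simp add: norm_scale norm_inverse)
  show "v = vscale E (vnorm E v) ?u" using assms v by (simp add: scale_scale scale_one)
qed

text \<open>The copy of the complex numbers to which the normalisation clause of an ideal is applied.\<close>

definition line_space :: "'u cnormed \<Rightarrow> 'u \<Rightarrow> 'u cnormed" where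
  "line_space E v = \<lparr>vcarrier = range (\<lambda>a. vscale E a v), vzero = vzero E, vadd = vadd E,
     vscale = vscale E, vnorm = vnorm E\<rparr>"

definition line_coord :: "'u cnormed \<Rightarrow> 'u \<Rightarrow> 'u \<Rightarrow> complex" where
  "line_coord E v = inv (\<lambda>a. vscale E a v)"

section \<open>Complex lines as isometric copies of the scalars\<close>

context complex_banach
begin

context
  fixes v assumes v: "v \<in> vcarrier E" "vnorm E v = 1"
begin

lemma line_scale_eq_iff: "vscale E a v = vscale E b v \<longleftrightarrow> a = b"
proof
  assume eq: "vscale E a v = vscale E b v"
  have "vscale E (a - b) v = vadd E (vscale E a v) (vscale E (-1) (vscale E b v))"
    using v by (simp add: scale_scale add_scale [symmetric])
  also have "\<dots> = vzero E" using v eq by (simp add: add_neg scale_closed)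
  finally have "vnorm E (vscale E (a - b) v) = 0" by (simp add: norm_zero)
  then show "a = b" using v by (simp add: norm_scale)
qed simp

lemma line_coord [simp]: "line_coord E v (vscale E a v) = a"
  unfolding line_coord_def by (rule inv_f_f) (simp add: inj_on_def line_scale_eq_iff)

lemma line_add: "vadd E (vscale E a v) (vscale E b v) = vscale E (a + b) v"
  using v by (simp add: add_scale)

lemma line_minus: "vminus E (vscale E a v) (vscale E b v) = vscale E (a - b) v"
  using v line_add [of a "-b"] by (simp add: vminus_def scale_scale)

lemma line_norm: "vnorm E (vscale E a v) = cmod a"
  using v by (simp add: norm_scale)

lemma line_normed: "complex_normed_space (line_space E v)"
proof -
  have "vzero E = vscale E 0 v" using v by (simp add: scale_zero_left)
  then have z: "vzero E \<in> range (\<lambda>a. vscale E a v)" by blast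
  have in_E: "x \<in> vcarrier E" if "x \<in> range (\<lambda>a. vscale E a v)" for x
    using that v scale_closed by auto
  show ?thesis
    unfolding line_space_def
  proof (unfold_locales, simp_all only: cnormed.simps)
    show "vadd E x y \<in> range (\<lambda>a. vscale E a v)"
      if "x \<in> range (\<lambda>a. vscale E a v)" "y \<in> range (\<lambda>a. vscale E a v)" for x y
      using that line_add by fastforce
    show "vscale E a x \<in> range (\<lambda>a. vscale E a v)" if "x \<in> range (\<lambda>a. vscale E a v)" for a x
      using that v by (auto simp: scale_scale)
  qed (use z in_E in \<open>auto simp: add_assoc add_zero add_neg scale_add add_scale scale_scale scale_one
      norm_nonneg norm_eq_zero norm_scale norm_triangle intro: add_commute\<close>)
qed

lemma line_banach: "complex_banach (line_space E v)"
proof -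
  interpret L: complex_normed_space "line_space E v" by (rule line_normed)
  have d: "vdist (line_space E v) (vscale E a v) (vscale E b v) = cmod (a - b)" for a b
  proof -
    have "vminus (line_space E v) (vscale E a v) (vscale E b v) = vminus E (vscale E a v) (vscale E b v)"
      by (simp add: vminus_def line_space_def)
    then show ?thesis
      by (simp add: vdist_def line_minus line_norm) (simp add: line_space_def line_norm)
  qed
  have "L.mcomplete"
    unfolding L.mcomplete_def
  proof (intro allI impI)
    fix \<sigma> assume \<sigma>: "L.MCauchy \<sigma>"
    then have "\<sigma> i \<in> vcarrier (line_space E v)" for i
      by (auto simp: L.MCauchy_def)
    then have "\<forall>i. \<exists>a. \<sigma> i = vscale E a v"
      by (simp add: line_space_def image_iff)
    then obtain a where a: "\<And>i. \<sigma> i = vscale E (a i) v" by metis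
    have "Cauchy a"
      using \<sigma> unfolding L.MCauchy_def Cauchy_def by (auto simp: a d dist_norm)
    then obtain l where l: "a \<longlonglongrightarrow> l" using Cauchy_convergent_iff convergent_def by blast
    have "limitin L.mtopology \<sigma> (vscale E l v) sequentially"
      unfolding L.limit_metric_sequentially
    proof (intro conjI allI impI)
      show "vscale E l v \<in> vcarrier (line_space E v)" by (simp add: line_space_def)
      fix \<epsilon> :: real assume "\<epsilon> > 0"
      then obtain N where "\<And>i. i \<ge> N \<Longrightarrow> cmod (a i - l) < \<epsilon>"
        using LIMSEQ_D [OF l] by blast
      then show "\<exists>N. \<forall>i\<ge>N. \<sigma> i \<in> vcarrier (line_space E v) \<and> vdist (line_space E v) (\<sigma> i) (vscale E l v) < \<epsilon>"
        by (intro exI [of _ N]) (simp add: a d, simp add: line_space_def)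
    qed
    then show "\<exists>x. limitin L.mtopology \<sigma> x sequentially" by blast
  qed
  then show ?thesis by unfold_locales
qed

lemma line_coord_isometry:
  "bounded_linear_map (line_space E v) complex_space (line_coord E v)"
  "bij_betw (line_coord E v) (vcarrier (line_space E v)) UNIV"
  "z \<in> vcarrier (line_space E v) \<Longrightarrow> cmod (line_coord E v z) = vnorm (line_space E v) z"
proof -
  show "bounded_linear_map (line_space E v) complex_space (line_coord E v)"
    unfolding bounded_linear_map_def
    using v by (auto simp: line_space_def complex_space_def line_add scale_scale line_norm intro: exI [of _ 1])
  show "bij_betw (line_coord E v) (vcarrier (line_space E v)) UNIV"
    by (rule bij_betw_byWitness [where f' = "\<lambda>a. vscale E a v"]) (auto simp: line_space_def)
  show "cmod (line_coord E v z) = vnorm (line_space E v) z" if "z \<in> vcarrier (line_space E v)"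
    using that by (auto simp: line_space_def line_norm)
qed

end

end

section \<open>Continuous linear functionals\<close>

lemma op_norm_cong:
  assumes "\<And>x. x \<in> vcarrier E \<Longrightarrow> vnorm F (R x) = vnorm G (Q x)"
  shows "op_norm E F R = op_norm E G Q"
  unfolding op_norm_def using assms by (intro SUP_cong) auto

context complex_normed_space
begin

text \<open>At the zero vector the quotient in \<open>op_norm\<close> is 0 by the convention for
  division; the assumption \<open>0 \<le> K\<close> covers it.\<close>

lemma op_norm_le:
  assumes "\<And>x. x \<in> vcarrier E \<Longrightarrow> vnorm F (R x) \<le> K * vnorm E x" "0 \<le> K"
  shows "op_norm E F R \<le> K"
  unfolding op_norm_def
proof (rule cSUP_least)
  show "vcarrier E \<noteq> {}" using zero_closed by blast
  fix x assume x: "x \<in> vcarrier E"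
  show "vnorm F (R x) / vnorm E x \<le> K"
    using assms(1) [OF x] norm_nonneg [OF x] assms(2)
    by (cases "vnorm E x = 0") (auto simp: divide_le_eq)
qed

lemma op_norm_bdd:
  assumes "\<And>x. x \<in> vcarrier E \<Longrightarrow> vnorm F (R x) \<le> K * vnorm E x"
  shows "bdd_above ((\<lambda>x. vnorm F (R x) / vnorm E x) ` vcarrier E)"
proof (rule bdd_aboveI2)
  fix x assume x: "x \<in> vcarrier E"
  show "vnorm F (R x) / vnorm E x \<le> max 0 K"
    using assms(1) [OF x] norm_nonneg [OF x]
    by (cases "vnorm E x = 0") (auto simp: divide_le_eq le_max_iff_disj)
qed

lemma op_norm_bound:
  assumes "\<And>x. x \<in> vcarrier E \<Longrightarrow> vnorm F (R x) \<le> K * vnorm E x" "x \<in> vcarrier E"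
  shows "vnorm F (R x) \<le> op_norm E F R * vnorm E x"
proof (cases "vnorm E x = 0")
  case True
  then show ?thesis using assms by fastforce
next
  case False
  then have "vnorm E x > 0" using norm_nonneg [OF assms(2)] by simp
  moreover have "vnorm F (R x) / vnorm E x \<le> op_norm E F R"
    unfolding op_norm_def by (rule cSUP_upper [OF assms(2) op_norm_bdd [OF assms(1)]])
  ultimately show ?thesis by (simp add: divide_le_eq)
qed

lemma op_norm_nonneg:
  assumes "\<And>x. x \<in> vcarrier E \<Longrightarrow> vnorm F (R x) \<le> K * vnorm E x"
    "\<And>x. x \<in> vcarrier E \<Longrightarrow> 0 \<le> vnorm F (R x)"
  shows "0 \<le> op_norm E F R"
proof -
  have "0 \<le> vnorm F (R (vzero E)) / vnorm E (vzero E)"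
    using assms(2) [OF zero_closed] by (simp add: norm_zero)
  also have "\<dots> \<le> op_norm E F R"
    unfolding op_norm_def by (rule cSUP_upper [OF zero_closed op_norm_bdd [OF assms(1)]])
  finally show ?thesis .
qed

abbreviation dual :: "('u \<Rightarrow> complex) set" where "dual \<equiv> vcarrier (dual_space E)"

abbreviation dnorm :: "('u \<Rightarrow> complex) \<Rightarrow> real" where "dnorm \<equiv> op_norm E complex_space"

lemma dual_iff: "\<gamma> \<in> dual \<longleftrightarrow>
    bounded_linear_map E complex_space \<gamma> \<and> (\<forall>x. x \<notin> vcarrier E \<longrightarrow> \<gamma> x = 0)"
  by (simp add: dual_space_def function_space_def)

lemma dual_add: "\<gamma> \<in> dual \<Longrightarrow> x \<in> vcarrier E \<Longrightarrow> y \<in> vcarrier E \<Longrightarrow> \<gamma> (vadd E x y) = \<gamma> x + \<gamma> y"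
  by (simp add: dual_iff bounded_linear_map_def complex_space_def)

lemma dual_scale: "\<gamma> \<in> dual \<Longrightarrow> x \<in> vcarrier E \<Longrightarrow> \<gamma> (vscale E a x) = a * \<gamma> x"
  by (simp add: dual_iff bounded_linear_map_def complex_space_def)

lemma dual_off: "\<gamma> \<in> dual \<Longrightarrow> x \<notin> vcarrier E \<Longrightarrow> \<gamma> x = 0"
  by (simp add: dual_iff)

lemma dual_bounded: "\<gamma> \<in> dual \<Longrightarrow> \<exists>K. \<forall>x\<in>vcarrier E. cmod (\<gamma> x) \<le> K * vnorm E x"
  by (simp add: dual_iff bounded_linear_map_def complex_space_def)

lemma dual_bound: "\<gamma> \<in> dual \<Longrightarrow> x \<in> vcarrier E \<Longrightarrow> cmod (\<gamma> x) \<le> dnorm \<gamma> * vnorm E x"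
  using dual_bounded [of \<gamma>] op_norm_bound [of complex_space \<gamma> _ x] by (auto simp: complex_space_def)

lemma dnorm_nonneg: "\<gamma> \<in> dual \<Longrightarrow> 0 \<le> dnorm \<gamma>"
  using dual_bounded [of \<gamma>] op_norm_nonneg [of complex_space \<gamma>] by (auto simp: complex_space_def)

lemma dnorm_le: "(\<And>x. x \<in> vcarrier E \<Longrightarrow> cmod (\<gamma> x) \<le> K * vnorm E x) \<Longrightarrow> 0 \<le> K \<Longrightarrow> dnorm \<gamma> \<le> K"
  using op_norm_le [of complex_space \<gamma> K] by (simp add: complex_space_def)

lemma dual_lin:
  assumes "\<gamma> \<in> dual" "\<delta> \<in> dual"
  shows "(\<lambda>x. a * \<gamma> x + b * \<delta> x) \<in> dual" "dnorm (\<lambda>x. a * \<gamma> x + b * \<delta> x) \<le> cmod a * dnorm \<gamma> + cmod b * dnorm \<delta>"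
proof -
  have le: "cmod (a * \<gamma> x + b * \<delta> x) \<le> (cmod a * dnorm \<gamma> + cmod b * dnorm \<delta>) * vnorm E x"
    if "x \<in> vcarrier E" for x
  proof -
    have "cmod (a * \<gamma> x + b * \<delta> x) \<le> cmod a * cmod (\<gamma> x) + cmod b * cmod (\<delta> x)"
      by (metis norm_mult norm_triangle_ineq)
    also have "\<dots> \<le> cmod a * (dnorm \<gamma> * vnorm E x) + cmod b * (dnorm \<delta> * vnorm E x)"
      using dual_bound [OF assms(1) that] dual_bound [OF assms(2) that]
      by (intro add_mono mult_left_mono) auto
    finally show ?thesis by (simp add: algebra_simps)
  qed
  show "(\<lambda>x. a * \<gamma> x + b * \<delta> x) \<in> dual"
    unfolding dual_iff bounded_linear_map_def
  proof (intro conjI)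
    show "\<exists>K. \<forall>x\<in>vcarrier E. vnorm complex_space (a * \<gamma> x + b * \<delta> x) \<le> K * vnorm E x"
      using le by (auto simp: complex_space_def)
  qed (use assms in \<open>auto simp: complex_space_def dual_add dual_scale dual_off algebra_simps\<close>)
  show "dnorm (\<lambda>x. a * \<gamma> x + b * \<delta> x) \<le> cmod a * dnorm \<gamma> + cmod b * dnorm \<delta>"
    by (rule dnorm_le [OF le]) (use assms in \<open>auto simp: dnorm_nonneg\<close>)
qed

lemma dual_zero: "(\<lambda>x. 0) \<in> dual"
  unfolding dual_iff bounded_linear_map_def
  by (auto simp: complex_space_def norm_nonneg intro!: exI [of _ 1])

lemma dual_normed: "complex_normed_space (dual_space E)"
proof
  note [simp] = dual_space_def function_space_def
  have scale: "(\<lambda>x. a * \<gamma> x) \<in> dual" "dnorm (\<lambda>x. a * \<gamma> x) \<le> cmod a * dnorm \<gamma>" if "\<gamma> \<in> dual" for a \<gamma>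
    using dual_lin [OF that that, of a 0] by simp_all
  show "vadd (dual_space E) \<gamma> \<delta> \<in> dual"
    "vnorm (dual_space E) (vadd (dual_space E) \<gamma> \<delta>) \<le> vnorm (dual_space E) \<gamma> + vnorm (dual_space E) \<delta>"
    if "\<gamma> \<in> dual" "\<delta> \<in> dual" for \<gamma> \<delta>
    using dual_lin [OF that, of 1 1] by simp_all
  show "vscale (dual_space E) a \<gamma> \<in> dual" if "\<gamma> \<in> dual" for a \<gamma>
    using scale [OF that] by simp
  show "vnorm (dual_space E) (vscale (dual_space E) a \<gamma>) = cmod a * vnorm (dual_space E) \<gamma>"
    if \<gamma>: "\<gamma> \<in> dual" for a \<gamma>
  proof (cases "a = 0")
    case True
    then show ?thesis using scale(2) [OF \<gamma>, of 0] dnorm_nonneg [OF dual_zero] by simp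
  next
    case False
    have "dnorm \<gamma> \<le> cmod (inverse a) * dnorm (\<lambda>x. a * \<gamma> x)"
      using scale(2) [OF scale(1) [OF \<gamma>, of a], of "inverse a"] False by (simp add: mult.assoc [symmetric])
    then have "cmod a * dnorm \<gamma> \<le> dnorm (\<lambda>x. a * \<gamma> x)"
      using False by (simp add: norm_inverse norm_divide field_simps)
    then show ?thesis using scale(2) [OF \<gamma>, of a] by simp
  qed
  show "vzero (dual_space E) \<in> dual" using dual_zero by simp
  show "0 \<le> vnorm (dual_space E) \<gamma>" if "\<gamma> \<in> dual" for \<gamma>
    using dnorm_nonneg [OF that] by simp
  show "vnorm (dual_space E) \<gamma> = 0 \<longleftrightarrow> \<gamma> = vzero (dual_space E)" if \<gamma>: "\<gamma> \<in> dual" for \<gamma>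
  proof
    assume "vnorm (dual_space E) \<gamma> = 0"
    then have "\<gamma> x = 0" for x
      using dual_bound [OF \<gamma>, of x] dual_off [OF \<gamma>, of x] by (cases "x \<in> vcarrier E") auto
    then show "\<gamma> = vzero (dual_space E)" by auto
  next
    assume "\<gamma> = vzero (dual_space E)"
    then show "vnorm (dual_space E) \<gamma> = 0"
      using scale(2) [OF dual_zero, of 0] dnorm_nonneg [OF dual_zero] by simp
  qed
qed (auto simp: dual_space_def function_space_def algebra_simps)

end

section \<open>Homogeneous polynomials and Taylor series\<close>

lemma sums_powser_unique:
  fixes a b :: "nat \<Rightarrow> complex"
  assumes "0 < r" "\<And>t. cmod t < r \<Longrightarrow> (\<lambda>k. a k * t ^ k) sums g t"
    "\<And>t. cmod t < r \<Longrightarrow> (\<lambda>k. b k * t ^ k) sums g t"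
  shows "a = b"
proof -
  have ev: "eventually (\<lambda>t. cmod t < r) (nhds (0 :: complex))"
    using assms(1) by (auto simp: eventually_nhds_metric dist_norm)
  have "g has_fps_expansion Abs_fps a"
    by (rule has_fps_expansionI) (use ev in eventually_elim, simp add: assms)
  moreover have "g has_fps_expansion Abs_fps b"
    by (rule has_fps_expansionI) (use ev in eventually_elim, simp add: assms)
  ultimately have "Abs_fps a = Abs_fps b" by (rule fps_expansion_unique_complex)
  then show ?thesis by (metis fps_nth_Abs_fps ext)
qed

text \<open>Turns the root condition in the definition of the space into finiteness of all its
  seminorms, the form used in every later estimate. The index 0 is skipped, as \<open>root 0\<close>
  is constantly 0.\<close>

lemma root_tendsto_zero_iff:
  fixes a :: "nat \<Rightarrow> real"
  assumes "\<And>k. 0 \<le> a k"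
  shows "(\<lambda>k. root k (a k)) \<longlonglongrightarrow> 0 \<longleftrightarrow> (\<forall>s>0. summable (\<lambda>k. s ^ k * a k))"
proof
  assume lim: "(\<lambda>k. root k (a k)) \<longlonglongrightarrow> 0"
  show "\<forall>s>0. summable (\<lambda>k. s ^ k * a k)"
  proof (intro allI impI)
    fix s :: real assume s: "0 < s"
    have "eventually (\<lambda>k. root k (a k) < 1 / (2 * s)) sequentially"
      using s by (intro order_tendstoD(2) [OF lim]) auto
    then have "eventually (\<lambda>k. norm (s ^ k * a k) \<le> (1 / 2) ^ k) sequentially"
      using eventually_gt_at_top [of 0]
    proof eventually_elim
      case (elim k)
      have "a k = root k (a k) ^ k" using assms elim by (simp add: real_root_pow_pos2)
      also have "\<dots> \<le> (1 / (2 * s)) ^ k"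
        using elim assms by (intro power_mono) auto
      finally have "s ^ k * a k \<le> s ^ k * (1 / (2 * s)) ^ k"
        using s by (intro mult_left_mono) auto
      also have "\<dots> = (1 / 2) ^ k" using s by (simp add: power_mult_distrib [symmetric])
      finally show ?case using s assms by simp
    qed
    then show "summable (\<lambda>k. s ^ k * a k)"
      by (rule summable_comparison_test_ev) simp
  qed
next
  assume sm: "\<forall>s>0. summable (\<lambda>k. s ^ k * a k)"
  show "(\<lambda>k. root k (a k)) \<longlonglongrightarrow> 0"
  proof (rule LIMSEQ_I)
    fix \<epsilon> :: real assume \<epsilon>: "0 < \<epsilon>"
    have "(\<lambda>k. (1 / \<epsilon>) ^ k * a k) \<longlonglongrightarrow> 0"
      using sm \<epsilon> by (intro summable_LIMSEQ_zero) auto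
    then have "eventually (\<lambda>k. (1 / \<epsilon>) ^ k * a k < 1) sequentially"
      by (rule order_tendstoD) simp
    then have "eventually (\<lambda>k. norm (root k (a k) - 0) < \<epsilon>) sequentially"
      using eventually_gt_at_top [of 0]
    proof eventually_elim
      case (elim k)
      have "a k < \<epsilon> ^ k" using elim \<epsilon> by (simp add: power_divide divide_less_eq)
      then have "root k (a k) < root k (\<epsilon> ^ k)" using elim by simp
      also have "\<dots> = \<epsilon>" using elim \<epsilon> by (simp add: real_root_power_cancel)
      finally show ?case using real_root_ge_zero [OF assms [of k], of k] by simp
    qed
    then show "\<exists>no. \<forall>k\<ge>no. norm (root k (a k) - 0) < \<epsilon>"
      by (simp add: eventually_sequentially)
  qed
qed

context complex_normed_space
begin

lemma multilinear_replicate: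
  assumes L: "multilinear_form E k L" and y: "y \<in> vcarrier E" and "j \<le> k"
  shows "L (replicate j (vscale E t y) @ replicate (k - j) y) = t ^ j * L (replicate k y)"
  using \<open>j \<le> k\<close>
proof (induction j)
  case (Suc j)
  let ?xs = "replicate j (vscale E t y) @ replicate (k - j) y"
  \<comment> \<open>Multilinearity is stated for combinations of two vectors, so a scalar multiple
    is written with a second coefficient 0.\<close>
  have ty: "vscale E t y = vadd E (vscale E t y) (vscale E 0 y)"
    using y by (simp add: add_scale [symmetric])
  have "replicate (Suc j) (vscale E t y) @ replicate (k - Suc j) y = ?xs[j := vscale E t y]"
  proof (rule nth_equalityI)
    fix i assume "i < length (replicate (Suc j) (vscale E t y) @ replicate (k - Suc j) y)"
    then show "(replicate (Suc j) (vscale E t y) @ replicate (k - Suc j) y) ! i = ?xs[j := vscale E t y] ! i"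
      using Suc.prems by (cases "i < j"; cases "i = j") (auto simp: nth_append simp del: replicate_Suc)
  qed (use Suc.prems in auto)
  also have "L \<dots> = L (?xs[j := vadd E (vscale E t y) (vscale E 0 y)])"
    using ty by simp
  also have "\<dots> = t * L (?xs[j := y]) + 0 * L (?xs[j := y])"
    by (rule L [unfolded multilinear_form_def, rule_format])
      (use Suc.prems y scale_closed in auto)
  also have "?xs[j := y] = ?xs"
    using Suc.prems by (intro list_update_same_conv [THEN iffD2]) (auto simp: nth_append)
  finally show ?case using Suc by simp
qed simp

lemma hpoly_scale:
  assumes P: "P \<in> hpoly E k" and y: "y \<in> vcarrier E"
  shows "P (vscale E t y) = t ^ k * P y"
proof -
  obtain L where L: "multilinear_form E k L" "\<And>x. x \<in> vcarrier E \<Longrightarrow> P x = L (replicate k x)"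
    using P by (auto simp: hpoly_def)
  then show ?thesis
    using multilinear_replicate [OF L(1) y, of k t] y by (simp add: scale_closed)
qed

lemma hpoly_off: "P \<in> hpoly E k \<Longrightarrow> x \<notin> vcarrier E \<Longrightarrow> P x = 0"
  by (simp add: hpoly_def)

lemma hpoly_lin:
  assumes P: "P \<in> hpoly E k" and Q: "Q \<in> hpoly E k"
  shows "(\<lambda>x. a * P x + b * Q x) \<in> hpoly E k"
proof -
  obtain L where L: "multilinear_form E k L" "\<And>x. x \<in> vcarrier E \<Longrightarrow> P x = L (replicate k x)"
    using P by (auto simp: hpoly_def)
  obtain M where M: "multilinear_form E k M" "\<And>x. x \<in> vcarrier E \<Longrightarrow> Q x = M (replicate k x)"
    using Q by (auto simp: hpoly_def)
  have "multilinear_form E k (\<lambda>xs. a * L xs + b * M xs)"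
    using L(1) M(1) unfolding multilinear_form_def by (auto simp: algebra_simps)
  moreover have "\<forall>x\<in>vcarrier E. a * P x + b * Q x = a * L (replicate k x) + b * M (replicate k x)"
    using L(2) M(2) by simp
  moreover have cont: "continuous_map (norm_topology E) euclidean (\<lambda>x. c * R x)"
    if R: "R \<in> hpoly E k" for c R
  proof -
    have "continuous_map (norm_topology E) euclidean R" using R by (simp add: hpoly_def)
    then have "continuous_map (norm_topology E) euclidean ((\<lambda>z. c * z) \<circ> R)"
      by (rule continuous_map_compose) (auto intro!: continuous_intros)
    then show ?thesis by (simp add: comp_def)
  qed
  moreover have "continuous_map (norm_topology E) euclidean (\<lambda>x. a * P x + b * Q x)"
    by (intro continuous_map_add cont P Q)
  moreover have "\<forall>x. x \<notin> vcarrier E \<longrightarrow> a * P x + b * Q x = 0"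
    using P Q by (simp add: hpoly_off)
  ultimately show ?thesis
    unfolding hpoly_def by blast
qed

lemma taylor_pointwise:
  assumes "taylor_series_at E f (vzero E) P"
  obtains r where "r > 0" "\<And>y. y \<in> vcarrier E \<Longrightarrow> vnorm E y < r \<Longrightarrow> (\<lambda>k. P k y) sums f y"
proof -
  obtain r where r: "r > 0" "uniform_limit {x \<in> vcarrier E. vnorm E (vminus E x (vzero E)) < r}
        (\<lambda>N x. \<Sum>k<N. P k (vminus E x (vzero E))) f sequentially"
    using assms by (auto simp: taylor_series_at_def)
  have "(\<lambda>k. P k y) sums f y" if "y \<in> vcarrier E" "vnorm E y < r" for y
    using tendsto_uniform_limitI [OF r(2), of y] that by (simp add: minus_zero_right sums_def)
  then show ?thesis using that r(1) by blast
qed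

text \<open>On each complex line through the origin both series are power series of the same
  function near 0, so their coefficients agree. This is what gives the definite description in
  \<open>taylor_term\<close> its meaning.\<close>

lemma taylor_unique:
  assumes P: "taylor_series_at E f (vzero E) P" and Q: "taylor_series_at E f (vzero E) Q"
  shows "P = Q"
proof (intro ext)
  fix k y
  have hP: "P k \<in> hpoly E k" and hQ: "Q k \<in> hpoly E k" for k
    using P Q by (auto simp: taylor_series_at_def)
  show "P k y = Q k y"
  proof (cases "y \<in> vcarrier E")
    case False
    then show ?thesis using hpoly_off [OF hP False] hpoly_off [OF hQ False] by simp
  next
    case y: True
    obtain r1 where r1: "r1 > 0" "\<And>y. y \<in> vcarrier E \<Longrightarrow> vnorm E y < r1 \<Longrightarrow> (\<lambda>k. P k y) sums f y"
      by (rule taylor_pointwise [OF P]) blast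
    obtain r2 where r2: "r2 > 0" "\<And>y. y \<in> vcarrier E \<Longrightarrow> vnorm E y < r2 \<Longrightarrow> (\<lambda>k. Q k y) sums f y"
      by (rule taylor_pointwise [OF Q]) blast
    define r where "r = min r1 r2 / (vnorm E y + 1)"
    have n: "0 \<le> vnorm E y" using y by (rule norm_nonneg)
    then have r: "r > 0" using r1 r2 by (simp add: r_def)
    have small: "vnorm E (vscale E t y) < min r1 r2" if "cmod t < r" for t
    proof -
      have "vnorm E (vscale E t y) \<le> cmod t * (vnorm E y + 1)"
        using y by (simp add: norm_scale mult_left_mono)
      also have "\<dots> < r * (vnorm E y + 1)"
        using that n by (intro mult_strict_right_mono) auto
      also have "\<dots> = min r1 r2" using n by (simp add: r_def)
      finally show ?thesis .
    qed
    have "(\<lambda>k. P k y) = (\<lambda>k. Q k y)"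
    proof (rule sums_powser_unique [OF r, of _ "\<lambda>t. f (vscale E t y)"])
      fix t assume "cmod t < r"
      then show "(\<lambda>k. P k y * t ^ k) sums f (vscale E t y)" "(\<lambda>k. Q k y * t ^ k) sums f (vscale E t y)"
        using r1(2) [of "vscale E t y"] r2(2) [of "vscale E t y"] small [of t] y
        by (simp_all add: scale_closed hpoly_scale [OF hP y] hpoly_scale [OF hQ y] mult.commute)
    qed
    then show ?thesis by meson
  qed
qed

lemma taylor_term_eq: "taylor_series_at E f (vzero E) P \<Longrightarrow> taylor_term E f = P"
  unfolding taylor_term_def by (rule the_equality) (assumption, erule taylor_unique)

lemma taylor_lin:
  assumes P: "taylor_series_at E f c P" and Q: "taylor_series_at E g c Q"
  shows "taylor_series_at E (\<lambda>x. a * f x + b * g x) c (\<lambda>k x. a * P k x + b * Q k x)"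
proof -
  obtain r1 where r1: "r1 > 0" "uniform_limit {x \<in> vcarrier E. vnorm E (vminus E x c) < r1}
        (\<lambda>N x. \<Sum>k<N. P k (vminus E x c)) f sequentially"
    using P by (auto simp: taylor_series_at_def)
  obtain r2 where r2: "r2 > 0" "uniform_limit {x \<in> vcarrier E. vnorm E (vminus E x c) < r2}
        (\<lambda>N x. \<Sum>k<N. Q k (vminus E x c)) g sequentially"
    using Q by (auto simp: taylor_series_at_def)
  define B where "B = {x \<in> vcarrier E. vnorm E (vminus E x c) < min r1 r2}"
  have "uniform_limit B (\<lambda>N x. \<Sum>k<N. P k (vminus E x c)) f sequentially"
    "uniform_limit B (\<lambda>N x. \<Sum>k<N. Q k (vminus E x c)) g sequentially"
    by (rule uniform_limit_on_subset [OF r1(2)] uniform_limit_on_subset [OF r2(2)]; auto simp: B_def)+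
  then have "uniform_limit B (\<lambda>N x. a * (\<Sum>k<N. P k (vminus E x c)) + b * (\<Sum>k<N. Q k (vminus E x c)))
      (\<lambda>x. a * f x + b * g x) sequentially"
    by (intro uniform_limit_intros)
  then have "uniform_limit B (\<lambda>N x. \<Sum>k<N. a * P k (vminus E x c) + b * Q k (vminus E x c))
      (\<lambda>x. a * f x + b * g x) sequentially"
    by (simp add: sum.distrib sum_distrib_left)
  moreover have "min r1 r2 > 0" using r1 r2 by simp
  moreover have "(\<lambda>x. a * P k x + b * Q k x) \<in> hpoly E k" for k
    using P Q by (intro hpoly_lin) (auto simp: taylor_series_at_def)
  ultimately show ?thesis
    unfolding taylor_series_at_def B_def by blast
qed

lemma holomorphic_taylor_term:
  assumes "f \<in> holomorphic_functions E"
  shows "taylor_series_at E f (vzero E) (taylor_term E f)"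
proof -
  obtain P where P: "taylor_series_at E f (vzero E) P"
    using assms zero_closed unfolding holomorphic_functions_def by blast
  then show ?thesis using taylor_term_eq [OF P] by simp
qed

lemma holomorphic_functions_lin:
  assumes "f \<in> holomorphic_functions E" "g \<in> holomorphic_functions E"
  shows "(\<lambda>x. a * f x + b * g x) \<in> holomorphic_functions E"
    "taylor_term E (\<lambda>x. a * f x + b * g x) = (\<lambda>k x. a * taylor_term E f k x + b * taylor_term E g k x)"
proof -
  have "\<exists>P. taylor_series_at E (\<lambda>x. a * f x + b * g x) c P" if "c \<in> vcarrier E" for c
    using assms that taylor_lin [of f c _ g _ a b] unfolding holomorphic_functions_def by blast
  then show "(\<lambda>x. a * f x + b * g x) \<in> holomorphic_functions E"
    using assms by (simp add: holomorphic_functions_def)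
  show "taylor_term E (\<lambda>x. a * f x + b * g x) = (\<lambda>k x. a * taylor_term E f k x + b * taylor_term E g k x)"
    by (rule taylor_term_eq [OF taylor_lin [OF holomorphic_taylor_term holomorphic_taylor_term]]) fact+
qed

text \<open>The restriction of a holomorphic function to a complex line is entire.\<close>

lemma holomorphic_on_line:
  assumes f: "f \<in> holomorphic_functions E" and y: "y \<in> vcarrier E"
  shows "(\<lambda>t. f (vscale E t y)) holomorphic_on UNIV"
proof -
  have "\<exists>r>0. (\<lambda>t. f (vscale E t y)) holomorphic_on ball c r" for c
  proof -
    obtain Q where Q: "taylor_series_at E f (vscale E c y) Q"
      using f scale_closed [OF y, of c] unfolding holomorphic_functions_def by blast
    then obtain r where r: "r > 0" "uniform_limit {x \<in> vcarrier E. vnorm E (vminus E x (vscale E c y)) < r}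
        (\<lambda>N x. \<Sum>k<N. Q k (vminus E x (vscale E c y))) f sequentially"
      by (auto simp: taylor_series_at_def)
    have hQ: "Q k \<in> hpoly E k" for k using Q by (auto simp: taylor_series_at_def)
    define d where "d = r / (vnorm E y + 1)"
    have n: "0 \<le> vnorm E y" using y by (rule norm_nonneg)
    have d: "d > 0" using r n by (simp add: d_def)
    have "(\<lambda>k. Q k y * (t - c) ^ k) sums f (vscale E t y)" if t: "t \<in> ball c d" for t
    proof -
      have m: "vminus E (vscale E t y) (vscale E c y) = vscale E (t - c) y"
        using y by (simp add: vminus_def scale_scale add_scale [symmetric])
      have "vnorm E (vscale E (t - c) y) \<le> cmod (t - c) * (vnorm E y + 1)"
        using y by (simp add: norm_scale mult_left_mono)
      also have "\<dots> < d * (vnorm E y + 1)"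
        using t n by (intro mult_strict_right_mono) (auto simp: dist_norm norm_minus_commute)
      also have "\<dots> = r" using n by (simp add: d_def)
      finally have "(\<lambda>N. \<Sum>k<N. Q k (vscale E (t - c) y)) \<longlonglongrightarrow> f (vscale E t y)"
        using tendsto_uniform_limitI [OF r(2), of "vscale E t y"] y by (simp add: m scale_closed)
      then show ?thesis
        by (simp add: sums_def hpoly_scale [OF hQ y] mult.commute)
    qed
    then have "(\<lambda>t. f (vscale E t y)) holomorphic_on ball c d"
      by (rule power_series_holomorphic)
    then show ?thesis using d by blast
  qed
  then have "(\<lambda>t. f (vscale E t y)) analytic_on UNIV"
    by (simp add: analytic_on_def)
  then show ?thesis by (simp add: analytic_imp_holomorphic)
qed

text \<open>The Taylor series is known to represent \<open>f\<close> only near the origin. Along the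
  line through \<open>y\<close> both the function and the sum of the series are entire, so the
  identity theorem carries the equality to the parameter 1.\<close>

lemma holomorphic_sums:
  assumes f: "f \<in> holomorphic_functions E" and y: "y \<in> vcarrier E"
    and sm: "\<And>t. summable (\<lambda>k. taylor_term E f k y * t ^ k)"
  shows "(\<lambda>k. taylor_term E f k y) sums f y"
proof -
  note T = holomorphic_taylor_term [OF f]
  obtain r where r: "r > 0" "\<And>y. y \<in> vcarrier E \<Longrightarrow> vnorm E y < r \<Longrightarrow> (\<lambda>k. taylor_term E f k y) sums f y"
    by (rule taylor_pointwise [OF T]) blast
  have h: "taylor_term E f k \<in> hpoly E k" for k using T by (auto simp: taylor_series_at_def)
  define g where "g t = (\<Sum>k. taylor_term E f k y * t ^ k)" for t
  have g: "(\<lambda>k. taylor_term E f k y * t ^ k) sums g t" for t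
    unfolding g_def using sm by (rule summable_sums)
  have gR: "g holomorphic_on ball 0 R" for R
    by (rule power_series_holomorphic [where a = "\<lambda>k. taylor_term E f k y"]) (simp add: g)
  then have "g analytic_on UNIV"
    unfolding analytic_on_def
  proof (intro ballI exI conjI)
    fix z :: complex
    have "ball z 1 \<subseteq> ball 0 (cmod z + 1)" by (simp add: ball_subset_ball_iff dist_norm)
    then show "g holomorphic_on ball z 1"
      using gR holomorphic_on_subset by blast
  qed simp
  then have gh: "g holomorphic_on UNIV" by (simp add: analytic_imp_holomorphic)
  define d where "d = r / (vnorm E y + 1)"
  have n: "0 \<le> vnorm E y" using y by (rule norm_nonneg)
  have d: "d > 0" using r n by (simp add: d_def)
  have fg: "f (vscale E t y) = g t" if t: "t \<in> ball 0 d" for t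
  proof -
    have "vnorm E (vscale E t y) \<le> cmod t * (vnorm E y + 1)"
      using y by (simp add: norm_scale mult_left_mono)
    also have "\<dots> < d * (vnorm E y + 1)"
      using t n by (intro mult_strict_right_mono) auto
    also have "\<dots> = r" using n by (simp add: d_def)
    finally have "(\<lambda>k. taylor_term E f k (vscale E t y)) sums f (vscale E t y)"
      using r(2) y scale_closed by blast
    then show ?thesis
      using g [of t] by (simp add: hpoly_scale [OF h y] mult.commute sums_unique2)
  qed
  have "f (vscale E 1 y) = g 1"
  proof (rule analytic_continuation_open [where f = "\<lambda>t. f (vscale E t y)" and g = g])
    show "ball 0 d \<noteq> ({} :: complex set)" using d by simp
    show "f (vscale E z y) = g z" if "z \<in> ball 0 d" for z by (rule fg [OF that])
    show "(\<lambda>t. f (vscale E t y)) holomorphic_on UNIV" by (rule holomorphic_on_line [OF f y])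
    show "g holomorphic_on UNIV" by (rule gh)
  qed (simp_all add: connected_UNIV)
  then show ?thesis using g [of 1] y by (simp add: scale_one)
qed

end

lemma function_space_simps [simp]:
  "vcarrier (function_space F nn) = F" "vzero (function_space F nn) = (\<lambda>x. 0)"
  "vadd (function_space F nn) f g = (\<lambda>x. f x + g x)" "vscale (function_space F nn) c f = (\<lambda>x. c * f x)"
  "vnorm (function_space F nn) f = nn f"
  by (simp_all add: function_space_def)

lemma vdist_function_space:
  "f \<in> F \<Longrightarrow> g \<in> F \<Longrightarrow> vdist (function_space F nn) f g = nn (\<lambda>x. f x - g x)"
  by (simp add: vdist_def vminus_def)

text \<open>A nonzero vector supplies the copy of the complex numbers inside \<open>E\<close> on
  which the ideal norms are normalised; the zero space is handled separately at the end.\<close>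

locale poly_ideals = complex_banach E for E :: "'u cnormed" +
  fixes A :: "nat \<Rightarrow> 'u cnormed \<Rightarrow> ('u \<Rightarrow> complex) set"
    and n :: "nat \<Rightarrow> 'u cnormed \<Rightarrow> ('u \<Rightarrow> complex) \<Rightarrow> real"
  assumes ideal: "banach_ideal k (A k) (n k)"
    and nontrivial: "\<exists>v\<in>vcarrier E. v \<noteq> vzero E"
begin

lemma A_banach: "complex_banach F \<Longrightarrow> complex_banach (function_space (A k F) (n k F))"
  using ideal [of k] unfolding banach_ideal_def by blast

lemma A_hpoly: "P \<in> A k E \<Longrightarrow> P \<in> hpoly E k"
  using ideal [of k] complex_banach_axioms unfolding banach_ideal_def by blast

lemma A_off: "P \<in> A k E \<Longrightarrow> x \<notin> vcarrier E \<Longrightarrow> P x = 0"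
  using A_hpoly hpoly_off by blast

lemma A_compose:
  "complex_banach F \<Longrightarrow> complex_banach G \<Longrightarrow> bounded_linear_map F G R \<Longrightarrow> P \<in> A k G \<Longrightarrow>
     zero_off F (P \<circ> R) \<in> A k F \<and> n k F (zero_off F (P \<circ> R)) \<le> n k G P * op_norm F G R ^ k"
  using ideal [of k] unfolding banach_ideal_def by blast

lemma A_line:
  assumes "v \<in> vcarrier E" "vnorm E v = 1"
  shows "zero_off (line_space E v) (\<lambda>z. line_coord E v z ^ k) \<in> A k (line_space E v)"
    "n k (line_space E v) (zero_off (line_space E v) (\<lambda>z. line_coord E v z ^ k)) = 1"
  using ideal [of k] line_banach [OF assms] line_coord_isometry [OF assms]
  unfolding banach_ideal_def by blast+

context
  fixes k :: nat
begin

interpretation P: complex_banach "function_space (A k E) (n k E)"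
  by (rule A_banach [OF complex_banach_axioms])

lemma A_scale: "P \<in> A k E \<Longrightarrow> (\<lambda>x. a * P x) \<in> A k E"
  using P.scale_closed by simp

lemma A_add: "P \<in> A k E \<Longrightarrow> Q \<in> A k E \<Longrightarrow> (\<lambda>x. P x + Q x) \<in> A k E"
  using P.add_closed by simp

lemma A_zero: "(\<lambda>x. 0) \<in> A k E"
  using P.zero_closed by simp

lemma A_lin: "P \<in> A k E \<Longrightarrow> Q \<in> A k E \<Longrightarrow> (\<lambda>x. a * P x + b * Q x) \<in> A k E"
  by (rule A_add [OF A_scale A_scale])

lemma A_diff: "P \<in> A k E \<Longrightarrow> Q \<in> A k E \<Longrightarrow> (\<lambda>x. P x - Q x) \<in> A k E"
  using A_lin [of P Q 1 "-1"] by simp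

lemma n_nonneg: "P \<in> A k E \<Longrightarrow> 0 \<le> n k E P"
  using P.norm_nonneg by simp

lemma n_zero: "n k E (\<lambda>x. 0) = 0"
  using P.norm_zero by simp

lemma n_scale: "P \<in> A k E \<Longrightarrow> n k E (\<lambda>x. a * P x) = cmod a * n k E P"
  using P.norm_scale by simp

lemma n_add: "P \<in> A k E \<Longrightarrow> Q \<in> A k E \<Longrightarrow> n k E (\<lambda>x. P x + Q x) \<le> n k E P + n k E Q"
  using P.norm_triangle by simp

lemma n_lin: "P \<in> A k E \<Longrightarrow> Q \<in> A k E \<Longrightarrow>
    n k E (\<lambda>x. a * P x + b * Q x) \<le> cmod a * n k E P + cmod b * n k E Q"
  using n_add [OF A_scale A_scale, of P Q a b] by (simp add: n_scale)

lemma n_swap: "P \<in> A k E \<Longrightarrow> Q \<in> A k E \<Longrightarrow> n k E (\<lambda>x. P x - Q x) = n k E (\<lambda>x. Q x - P x)"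
  using n_scale [OF A_diff, of Q P "-1"] by simp

lemma A_sum: "(\<And>i. i \<in> I \<Longrightarrow> P i \<in> A k E) \<Longrightarrow> (\<lambda>x. \<Sum>i\<in>I. P i x) \<in> A k E"
proof (induction I rule: infinite_finite_induct)
  case (insert i I)
  then show ?case using A_add [of "P i" "\<lambda>x. \<Sum>i\<in>I. P i x"] by simp
qed (auto simp: A_zero)

lemma n_sum:
  assumes "\<And>i. i \<in> I \<Longrightarrow> P i \<in> A k E"
  shows "n k E (\<lambda>x. \<Sum>i\<in>I. P i x) \<le> (\<Sum>i\<in>I. n k E (P i))"
  using assms
proof (induction I rule: infinite_finite_induct)
  case (insert i I)
  then show ?case using n_add [of "P i" "\<lambda>x. \<Sum>i\<in>I. P i x"] A_sum [of I P] by simp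
qed (auto simp: n_zero)

text \<open>Restricting to the line through \<open>y\<close> and using the normalisation of the ideal norm there shows
  that the ideal norm dominates the supremum norm.\<close>

lemma A_bound:
  assumes P: "P \<in> A k E" and y: "y \<in> vcarrier E"
  shows "cmod (P y) \<le> n k E P * vnorm E y ^ k"
proof -
  have unit: "cmod (P v) \<le> n k E P" if v: "v \<in> vcarrier E" "vnorm E v = 1" for v
  proof -
    let ?C = "line_space E v"
    let ?q = "zero_off ?C (\<lambda>z. line_coord E v z ^ k)"
    interpret C: complex_banach ?C by (rule line_banach [OF v])
    interpret Q: complex_banach "function_space (A k ?C) (n k ?C)" by (rule A_banach) unfold_locales
    have incl: "vnorm E x \<le> 1 * vnorm ?C x" for x by (simp add: line_space_def)
    have R: "bounded_linear_map ?C E (\<lambda>x. x)"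
      unfolding bounded_linear_map_def
      using v scale_closed by (auto simp: line_space_def intro: exI [of _ 1])
    have op: "op_norm ?C E (\<lambda>x. x) \<le> 1" "0 \<le> op_norm ?C E (\<lambda>x. x)"
      using C.op_norm_le [of E "\<lambda>x. x" 1] C.op_norm_nonneg [of E "\<lambda>x. x" 1]
        C.norm_nonneg by (auto simp: line_space_def)
    have "zero_off ?C (P \<circ> (\<lambda>x. x)) = (\<lambda>x. P v * ?q x)"
    proof
      fix x
      show "zero_off ?C (P \<circ> (\<lambda>x. x)) x = P v * ?q x"
      proof (cases "x \<in> vcarrier ?C")
        case True
        then obtain a where "x = vscale E a v" by (auto simp: line_space_def)
        then show ?thesis
          using True hpoly_scale [OF A_hpoly [OF P] v(1), of a] v by (simp add: zero_off_def)
      qed (simp add: zero_off_def)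
    qed
    moreover have "n k ?C (\<lambda>x. P v * ?q x) = cmod (P v)"
      using Q.norm_scale [of ?q "P v"] A_line [OF v, of k] by simp
    ultimately have "cmod (P v) \<le> n k E P * op_norm ?C E (\<lambda>x. x) ^ k"
      using A_compose [OF C.complex_banach_axioms complex_banach_axioms R P] by simp
    also have "\<dots> \<le> n k E P * 1"
      using op n_nonneg [OF P] by (intro mult_left_mono power_le_one) auto
    finally show ?thesis by simp
  qed
  obtain w where w: "w \<in> vcarrier E" "w \<noteq> vzero E" using nontrivial by blast
  obtain v where v: "v \<in> vcarrier E" "vnorm E v = 1" "y = vscale E (vnorm E y) v"
  proof (cases "y = vzero E")
    \<comment> \<open>At the origin any unit vector serves, with scalar 0. For \<open>k = 0\<close>
      the factor \<open>0 ^ 0\<close> is 1, so the bound has content there too.\<close>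
    case True
    obtain u where u: "u \<in> vcarrier E" "vnorm E u = 1" by (rule unit_vector [OF w])
    then show ?thesis using that [of u] True by (simp add: norm_zero scale_zero_left)
  next
    case False
    then show ?thesis using unit_vector [OF y] that by blast
  qed
  have "P y = complex_of_real (vnorm E y) ^ k * P v"
    using hpoly_scale [OF A_hpoly [OF P] v(1), of "vnorm E y"] v(3) by simp
  then have "cmod (P y) = vnorm E y ^ k * cmod (P v)"
    using norm_nonneg [OF y] by (simp add: norm_mult norm_power)
  also have "\<dots> \<le> vnorm E y ^ k * n k E P"
    using unit [OF v(1,2)] norm_nonneg [OF y] by (intro mult_left_mono) auto
  finally show ?thesis by (simp add: mult.commute)
qed

text \<open>An absolutely convergent series in the Banach space of the ideal has a norm limit; since
  the ideal norm controls point values, this limit is the pointwise sum.\<close>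

lemma A_series:
  assumes P: "\<And>i :: nat. P i \<in> A k E" and sm: "summable (\<lambda>i. n k E (P i))"
  shows "(\<lambda>y. \<Sum>i. P i y) \<in> A k E" "n k E (\<lambda>y. \<Sum>i. P i y) \<le> (\<Sum>i. n k E (P i))"
    "(\<lambda>i. P i y) sums (\<Sum>i. P i y)"
proof -
  define S where "S N = (\<lambda>x. \<Sum>i<N. P i x)" for N
  have S: "S N \<in> A k E" for N unfolding S_def by (rule A_sum) (rule P)
  have diff: "n k E (\<lambda>x. S N x - S M x) \<le> (\<Sum>i<N. n k E (P i)) - (\<Sum>i<M. n k E (P i))"
    if "M \<le> N" for M N
  proof -
    have "(\<lambda>x. S N x - S M x) = (\<lambda>x. \<Sum>i\<in>{M..<N}. P i x)"
      unfolding S_def using that by (simp add: sum_diff_nat_ivl lessThan_atLeast0 fun_eq_iff)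
    then have "n k E (\<lambda>x. S N x - S M x) \<le> (\<Sum>i\<in>{M..<N}. n k E (P i))"
      using n_sum [of "{M..<N}" P] P by simp
    also have "\<dots> = (\<Sum>i<N. n k E (P i)) - (\<Sum>i<M. n k E (P i))"
      using that by (simp add: sum_diff_nat_ivl lessThan_atLeast0)
    finally show ?thesis .
  qed
  have cauchy: "Cauchy (\<lambda>N. \<Sum>i<N. n k E (P i))"
    using sm by (simp add: summable_iff_convergent Cauchy_convergent_iff)
  have C: "\<exists>K. \<forall>N\<ge>K. \<forall>M\<ge>K. n k E (\<lambda>x. S N x - S M x) < \<epsilon>" if \<epsilon>: "\<epsilon> > 0" for \<epsilon>
  proof -
    obtain K where K: "\<And>N M. N \<ge> K \<Longrightarrow> M \<ge> K \<Longrightarrow> dist (\<Sum>i<N. n k E (P i)) (\<Sum>i<M. n k E (P i)) < \<epsilon>"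
      using cauchy \<epsilon> unfolding Cauchy_def by meson
    have "n k E (\<lambda>x. S N x - S M x) < \<epsilon>" if "N \<ge> K" "M \<ge> K" for N M
      using diff [of M N] diff [of N M] K [OF that] n_swap [OF S S, of N M]
      by (cases "M \<le> N") (auto simp: dist_real_def)
    then show ?thesis by blast
  qed
  have vd: "vdist (function_space (A k E) (n k E)) f g = n k E (\<lambda>x. f x - g x)"
    if "f \<in> A k E" "g \<in> A k E" for f g
    using that by (rule vdist_function_space)
  have "P.MCauchy S"
    unfolding P.MCauchy_def
  proof (intro conjI allI impI)
    show "range S \<subseteq> vcarrier (function_space (A k E) (n k E))" using S by auto
    fix \<epsilon> :: real assume "\<epsilon> > 0"
    then obtain K where "\<forall>N\<ge>K. \<forall>M\<ge>K. n k E (\<lambda>x. S N x - S M x) < \<epsilon>" using C by blast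
    then show "\<exists>N. \<forall>m m'. N \<le> m \<longrightarrow> N \<le> m' \<longrightarrow> vdist (function_space (A k E) (n k E)) (S m) (S m') < \<epsilon>"
      using vd [OF S S] by (intro exI [of _ K]) simp
  qed
  then obtain Q where QL: "limitin P.mtopology S Q sequentially"
    using P.complete unfolding P.mcomplete_def by blast
  then have QA: "Q \<in> A k E"
    unfolding P.limit_metric_sequentially by simp
  have Q: "\<exists>K. \<forall>N\<ge>K. n k E (\<lambda>x. S N x - Q x) < \<epsilon>" if \<epsilon>: "\<epsilon> > 0" for \<epsilon>
  proof -
    obtain K where "\<forall>N\<ge>K. vdist (function_space (A k E) (n k E)) (S N) Q < \<epsilon>"
      using QL \<epsilon> unfolding P.limit_metric_sequentially by meson
    then show ?thesis using vd [OF S QA] by auto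
  qed
  note Q = QA Q
  have lim: "(\<lambda>N. n k E (\<lambda>x. S N x - Q x)) \<longlonglongrightarrow> 0"
  proof (rule LIMSEQ_I)
    fix \<epsilon> :: real assume "\<epsilon> > 0"
    then obtain K where "\<forall>N\<ge>K. n k E (\<lambda>x. S N x - Q x) < \<epsilon>" using Q(2) by blast
    then show "\<exists>K. \<forall>N\<ge>K. norm (n k E (\<lambda>x. S N x - Q x) - 0) < \<epsilon>"
      using n_nonneg [OF A_diff [OF S Q(1)]] by (intro exI [of _ K]) simp
  qed
  have pw: "(\<lambda>i. P i y) sums Q y" for y
  proof (cases "y \<in> vcarrier E")
    case True
    have "(\<lambda>N. S N y - Q y) \<longlonglongrightarrow> 0"
    proof (rule Lim_null_comparison)
      show "eventually (\<lambda>N. norm (S N y - Q y) \<le> n k E (\<lambda>x. S N x - Q x) * vnorm E y ^ k) sequentially"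
        using A_bound [OF A_diff [OF S Q(1)] True] by simp
      show "(\<lambda>N. n k E (\<lambda>x. S N x - Q x) * vnorm E y ^ k) \<longlonglongrightarrow> 0"
        using tendsto_mult_right [OF lim, of "vnorm E y ^ k"] by simp
    qed
    then show ?thesis by (simp add: sums_def S_def LIM_zero_iff)
  next
    case False
    then show ?thesis using A_off [OF P] A_off [OF Q(1)] by simp
  qed
  have eq: "(\<lambda>y. \<Sum>i. P i y) = Q"
    using sums_unique [OF pw] by (simp add: fun_eq_iff)
  then show "(\<lambda>y. \<Sum>i. P i y) \<in> A k E"
    using Q(1) by simp
  show "(\<lambda>i. P i y) sums (\<Sum>i. P i y)"
    using pw [of y] sums_unique [OF pw, of y] by simp
  have "n k E Q \<le> n k E (\<lambda>x. S N x - Q x) + (\<Sum>i. n k E (P i))" for N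
  proof -
    have "n k E (\<lambda>x. (Q x - S N x) + S N x) \<le> n k E (\<lambda>x. Q x - S N x) + n k E (S N)"
      by (rule n_add [OF A_diff [OF Q(1) S] S])
    moreover have "n k E (S N) \<le> (\<Sum>i<N. n k E (P i))"
      unfolding S_def using n_sum [of "{..<N}" P] P by simp
    moreover have "(\<Sum>i<N. n k E (P i)) \<le> (\<Sum>i. n k E (P i))"
      by (rule sum_le_suminf [OF sm]) (use n_nonneg [OF P] in auto)
    ultimately show ?thesis using n_swap [OF S Q(1), of N] by simp
  qed
  then have "n k E Q \<le> 0 + (\<Sum>i. n k E (P i))"
    by (intro tendsto_lowerbound [OF tendsto_add [OF lim tendsto_const]] always_eventually allI) auto
  then show "n k E (\<lambda>y. \<Sum>i. P i y) \<le> (\<Sum>i. n k E (P i))" using eq by simp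
qed

end

text \<open>The power of a functional is the normalised power on a line, composed with the map
  sending \<open>y\<close> to \<open>\<gamma> y\<close> times a unit vector; this map has the norm
  of the functional, and the ideal property applies.\<close>

lemma power_in_A:
  assumes \<gamma>: "\<gamma> \<in> dual"
  shows "zero_off E (\<lambda>y. \<gamma> y ^ k) \<in> A k E" "n k E (zero_off E (\<lambda>y. \<gamma> y ^ k)) \<le> dnorm \<gamma> ^ k"
proof -
  obtain w where w: "w \<in> vcarrier E" "w \<noteq> vzero E" using nontrivial by blast
  obtain v where v: "v \<in> vcarrier E" "vnorm E v = 1" by (rule unit_vector [OF w])
  let ?C = "line_space E v"
  let ?q = "zero_off ?C (\<lambda>z. line_coord E v z ^ k)"
  define R where "R = (\<lambda>y. vscale E (\<gamma> y) v)"
  have nR: "vnorm ?C (R y) = cmod (\<gamma> y)" for y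
    using v by (simp add: R_def line_space_def norm_scale)
  obtain K where K: "\<forall>x\<in>vcarrier E. cmod (\<gamma> x) \<le> K * vnorm E x"
    using dual_bounded [OF \<gamma>] by blast
  have R: "bounded_linear_map E ?C R"
    unfolding bounded_linear_map_def nR
  proof (intro conjI)
    show "\<exists>K. \<forall>x\<in>vcarrier E. cmod (\<gamma> x) \<le> K * vnorm E x" using K by blast
  qed (use v \<gamma> in \<open>auto simp: R_def line_space_def dual_add dual_scale line_add [OF v] scale_scale\<close>)
  have "op_norm E ?C R = dnorm \<gamma>"
    by (rule op_norm_cong) (simp add: nR complex_space_def)
  moreover have "zero_off E (?q \<circ> R) = zero_off E (\<lambda>y. \<gamma> y ^ k)"
  proof
    fix y
    have "R y \<in> vcarrier ?C" by (simp add: R_def line_space_def)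
    then show "zero_off E (?q \<circ> R) y = zero_off E (\<lambda>y. \<gamma> y ^ k) y"
      by (simp add: zero_off_def) (simp add: R_def line_coord [OF v])
  qed
  ultimately show "zero_off E (\<lambda>y. \<gamma> y ^ k) \<in> A k E" "n k E (zero_off E (\<lambda>y. \<gamma> y ^ k)) \<le> dnorm \<gamma> ^ k"
    using A_compose [OF complex_banach_axioms line_banach [OF v] R A_line(1) [OF v], of k]
      A_line(2) [OF v, of k] by simp_all
qed

end

section \<open>Holomorphic functions of bounded ideal type\<close>

lemma HbA_topology_eq: "HbA_topology A n E = seminorm_topology (HbA A n E) (HbA_seminorm n E)"
  by (simp add: HbA_topology_def seminorm_topology_def)

context poly_ideals
begin

abbreviation H :: "('u \<Rightarrow> complex) set" where "H \<equiv> HbA A n E"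
abbreviation p :: "real \<Rightarrow> ('u \<Rightarrow> complex) \<Rightarrow> real" where "p \<equiv> HbA_seminorm n E"

text \<open>The factorial in the definition is absorbed by scaling inside the ideal, and the root
  condition becomes summability at every radius.\<close>

lemma HbA_iff: "f \<in> H \<longleftrightarrow> f \<in> holomorphic_functions E \<and> (\<forall>k. taylor_term E f k \<in> A k E) \<and>
    (\<forall>s>0. summable (\<lambda>k. s ^ k * n k E (taylor_term E f k)))"
proof -
  have "(\<lambda>x. fact k * taylor_term E f k x) \<in> A k E \<longleftrightarrow> taylor_term E f k \<in> A k E" for k
    using A_scale [of "\<lambda>x. fact k * taylor_term E f k x" k "1 / fact k"] A_scale [of "taylor_term E f k" k "fact k"]
    by auto
  moreover have "(\<lambda>k. root k (n k E (taylor_term E f k))) \<longlonglongrightarrow> 0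
      \<longleftrightarrow> (\<forall>s>0. summable (\<lambda>k. s ^ k * n k E (taylor_term E f k)))"
    if "\<forall>k. taylor_term E f k \<in> A k E"
    by (rule root_tendsto_zero_iff) (use that n_nonneg in blast)
  ultimately show ?thesis by (auto simp: HbA_def)
qed

lemma HbA_A: "f \<in> H \<Longrightarrow> taylor_term E f k \<in> A k E"
  by (simp add: HbA_iff)

lemma HbA_n_nonneg: "f \<in> H \<Longrightarrow> 0 \<le> n k E (taylor_term E f k)"
  using HbA_A n_nonneg by blast

lemma HbA_summable: "f \<in> H \<Longrightarrow> 0 < s \<Longrightarrow> summable (\<lambda>k. s ^ k * n k E (taylor_term E f k))"
  by (simp add: HbA_iff)

lemma HbA_off: "f \<in> H \<Longrightarrow> x \<notin> vcarrier E \<Longrightarrow> f x = 0"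
  by (simp add: HbA_iff holomorphic_functions_def)

lemma HbA_sums:
  assumes f: "f \<in> H" and y: "y \<in> vcarrier E"
  shows "(\<lambda>k. taylor_term E f k y) sums f y"
proof (rule holomorphic_sums)
  show "f \<in> holomorphic_functions E" using f by (simp add: HbA_iff)
  show "summable (\<lambda>k. taylor_term E f k y * t ^ k)" for t
  proof (rule summable_comparison_test)
    let ?s = "vnorm E y * cmod t + 1"
    have s: "?s > 0" using norm_nonneg [OF y] by (simp add: add_nonneg_pos)
    show "summable (\<lambda>k. ?s ^ k * n k E (taylor_term E f k))" by (rule HbA_summable [OF f s])
    have "norm (taylor_term E f k y * t ^ k) \<le> ?s ^ k * n k E (taylor_term E f k)" for k
    proof -
      have "norm (taylor_term E f k y * t ^ k) \<le> (n k E (taylor_term E f k) * vnorm E y ^ k) * cmod t ^ k"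
        using A_bound [OF HbA_A [OF f] y] by (simp add: norm_mult norm_power mult_right_mono)
      also have "\<dots> = (vnorm E y * cmod t) ^ k * n k E (taylor_term E f k)"
        by (simp add: power_mult_distrib)
      also have "\<dots> \<le> ?s ^ k * n k E (taylor_term E f k)"
        using norm_nonneg [OF y] HbA_n_nonneg [OF f] by (intro mult_right_mono power_mono) auto
      finally show ?thesis .
    qed
    then show "\<exists>N. \<forall>k\<ge>N. norm (taylor_term E f k y * t ^ k) \<le> ?s ^ k * n k E (taylor_term E f k)"
      by blast
  qed
qed (rule y)

lemma HbA_bound:
  assumes f: "f \<in> H" and y: "y \<in> vcarrier E" "vnorm E y \<le> s" and s: "0 < s"
  shows "cmod (f y) \<le> p s f"
proof -
  have le: "norm (taylor_term E f k y) \<le> s ^ k * n k E (taylor_term E f k)" for k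
  proof -
    have "norm (taylor_term E f k y) \<le> n k E (taylor_term E f k) * vnorm E y ^ k"
      by (rule A_bound [OF HbA_A [OF f] y(1)])
    also have "\<dots> \<le> n k E (taylor_term E f k) * s ^ k"
      using norm_nonneg [OF y(1)] y(2) HbA_n_nonneg [OF f] by (intro mult_left_mono power_mono) auto
    finally show ?thesis by (simp add: mult.commute)
  qed
  have "f y = (\<Sum>k. taylor_term E f k y)"
    using HbA_sums [OF f y(1)] by (simp add: sums_iff)
  also have "cmod \<dots> \<le> (\<Sum>k. s ^ k * n k E (taylor_term E f k))"
    by (rule norm_suminf_le [OF le HbA_summable [OF f s]])
  finally show ?thesis by (simp add: HbA_seminorm_def)
qed

lemma HbA_lin:
  assumes f: "f \<in> H" and g: "g \<in> H"
  shows "(\<lambda>x. a * f x + b * g x) \<in> H"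
    "0 < s \<Longrightarrow> p s (\<lambda>x. a * f x + b * g x) \<le> cmod a * p s f + cmod b * p s g"
proof -
  have hol: "f \<in> holomorphic_functions E" "g \<in> holomorphic_functions E"
    using f g by (auto simp: HbA_iff)
  note tt = holomorphic_functions_lin [OF hol, of a b]
  have le: "s ^ k * n k E (taylor_term E (\<lambda>x. a * f x + b * g x) k)
      \<le> cmod a * (s ^ k * n k E (taylor_term E f k)) + cmod b * (s ^ k * n k E (taylor_term E g k))"
    if "0 < s" for s k
  proof -
    have "s ^ k * n k E (taylor_term E (\<lambda>x. a * f x + b * g x) k)
        \<le> s ^ k * (cmod a * n k E (taylor_term E f k) + cmod b * n k E (taylor_term E g k))"
      unfolding tt(2) using that by (intro mult_left_mono n_lin HbA_A f g) auto
    then show ?thesis by (simp add: algebra_simps)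
  qed
  have A: "taylor_term E (\<lambda>x. a * f x + b * g x) k \<in> A k E" for k
    unfolding tt(2) by (intro A_lin HbA_A f g)
  have sm: "summable (\<lambda>k. cmod a * (s ^ k * n k E (taylor_term E f k)) + cmod b * (s ^ k * n k E (taylor_term E g k)))"
    if "0 < s" for s
    by (intro summable_add summable_mult HbA_summable f g that)
  have sm': "summable (\<lambda>k. s ^ k * n k E (taylor_term E (\<lambda>x. a * f x + b * g x) k))"
    if "0 < s" for s
    by (rule summable_comparison_test' [OF sm [OF that], of 0])
      (use le [OF that] n_nonneg [OF A] that in simp)
  show "(\<lambda>x. a * f x + b * g x) \<in> H"
    using tt(1) A sm' by (simp add: HbA_iff)
  show "p s (\<lambda>x. a * f x + b * g x) \<le> cmod a * p s f + cmod b * p s g" if s: "0 < s"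
  proof -
    have "p s (\<lambda>x. a * f x + b * g x)
        \<le> (\<Sum>k. cmod a * (s ^ k * n k E (taylor_term E f k)) + cmod b * (s ^ k * n k E (taylor_term E g k)))"
      unfolding HbA_seminorm_def by (rule suminf_le [OF le [OF s] sm' [OF s] sm [OF s]])
    also have "\<dots> = cmod a * p s f + cmod b * p s g"
      unfolding HbA_seminorm_def
      by (subst suminf_add [symmetric]) (auto intro!: summable_mult HbA_summable f g s simp: suminf_mult HbA_summable f g s)
    finally show ?thesis .
  qed
qed

text \<open>Stronger than \<open>taylor_series_at\<close>: the coefficients lie in the ideals, their
  norms are summable at every radius, and the series represents \<open>f\<close> on all of the
  space.\<close>

definition expands_at :: "('u \<Rightarrow> complex) \<Rightarrow> 'u \<Rightarrow> (nat \<Rightarrow> 'u \<Rightarrow> complex) \<Rightarrow> bool" where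
  "expands_at f a Q \<longleftrightarrow> (\<forall>j. Q j \<in> A j E) \<and> (\<forall>s>0. summable (\<lambda>j. s ^ j * n j E (Q j))) \<and>
     (\<forall>y\<in>vcarrier E. (\<lambda>j. Q j y) sums f (vadd E a y))"

lemma expands_taylor:
  assumes Q: "expands_at f a Q" and a: "a \<in> vcarrier E"
  shows "taylor_series_at E f a Q"
  unfolding taylor_series_at_def
proof (intro conjI allI exI)
  show "Q k \<in> hpoly E k" for k using Q A_hpoly by (auto simp: expands_at_def)
  let ?B = "{x \<in> vcarrier E. vnorm E (vminus E x a) < 1}"
  have "uniform_limit ?B (\<lambda>N x. \<Sum>k<N. Q k (vminus E x a)) (\<lambda>x. \<Sum>k. Q k (vminus E x a)) sequentially"
  proof (rule Weierstrass_m_test)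
    show "summable (\<lambda>j. 1 ^ j * n j E (Q j))"
      using Q zero_less_one unfolding expands_at_def by blast
    show "norm (Q k (vminus E x a)) \<le> 1 ^ k * n k E (Q k)" if "x \<in> ?B" for k x
    proof -
      have m: "vminus E x a \<in> vcarrier E" using that a by (simp add: minus_closed)
      have QA: "Q k \<in> A k E" using Q by (simp add: expands_at_def)
      have "norm (Q k (vminus E x a)) \<le> n k E (Q k) * vnorm E (vminus E x a) ^ k"
        by (rule A_bound [OF QA m])
      also have "\<dots> \<le> n k E (Q k) * 1"
        using that norm_nonneg [OF m] n_nonneg [OF QA] by (intro mult_left_mono power_le_one) auto
      finally show ?thesis by simp
    qed
  qed
  moreover have "(\<Sum>k. Q k (vminus E x a)) = f x" if "x \<in> ?B" for x
    using that Q a by (auto simp: expands_at_def sums_iff minus_closed add_minus_cancel)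
  then have "uniform_limit ?B (\<lambda>N x. \<Sum>k<N. Q k (vminus E x a)) (\<lambda>x. \<Sum>k. Q k (vminus E x a)) sequentially
      \<longleftrightarrow> uniform_limit ?B (\<lambda>N x. \<Sum>k<N. Q k (vminus E x a)) f sequentially"
    by (intro uniform_limit_cong') simp_all
  ultimately show "uniform_limit ?B (\<lambda>N x. \<Sum>k<N. Q k (vminus E x a)) f sequentially"
    by blast
qed simp

lemma zero_add: "y \<in> vcarrier E \<Longrightarrow> vadd E (vzero E) y = y"
  using add_commute add_zero zero_closed by metis

lemma expands_HbA:
  assumes off: "\<And>x. x \<notin> vcarrier E \<Longrightarrow> f x = 0" and ex: "\<And>a. a \<in> vcarrier E \<Longrightarrow> \<exists>Q. expands_at f a Q"
  shows "f \<in> H"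
proof -
  have "f \<in> holomorphic_functions E"
    unfolding holomorphic_functions_def using off ex expands_taylor by blast
  moreover obtain Q where Q: "expands_at f (vzero E) Q" using ex zero_closed by blast
  moreover have "taylor_term E f = Q"
    by (rule taylor_term_eq [OF expands_taylor [OF Q zero_closed]])
  ultimately show ?thesis by (auto simp: HbA_iff expands_at_def)
qed

lemma expands_seminorm:
  assumes "expands_at f (vzero E) Q"
  shows "p s f = (\<Sum>k. s ^ k * n k E (Q k))"
  unfolding HbA_seminorm_def taylor_term_eq [OF expands_taylor [OF assms zero_closed]] ..

text \<open>Functions with an explicit bound of exponential type for the Taylor expansions at all points.
  The bound is chosen so that sums of such functions are again in the space, without any
  appeal to translations of general elements.\<close>

definition tame :: "real \<Rightarrow> real \<Rightarrow> ('u \<Rightarrow> complex) \<Rightarrow> bool" where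
  "tame C B f \<longleftrightarrow> 0 \<le> B \<and> (\<forall>x. x \<notin> vcarrier E \<longrightarrow> f x = 0) \<and>
     (\<forall>a\<in>vcarrier E. \<exists>Q. (\<forall>j. Q j \<in> A j E \<and> n j E (Q j) \<le> C * exp (B * vnorm E a) * B ^ j / fact j) \<and>
        (\<forall>y\<in>vcarrier E. (\<lambda>j. Q j y) sums f (vadd E a y)))"

lemma power_fact_le_exp: "0 \<le> (x :: real) \<Longrightarrow> x ^ j / fact j \<le> exp x"
  using sum_le_suminf [OF summable_exp [of x], of "{j}"] by (simp add: exp_def scaleR_conv_of_real divide_inverse mult.commute)

lemma tame_nonneg:
  assumes "tame C B f"
  shows "0 \<le> C" "0 \<le> B"
proof -
  obtain Q where Q: "\<And>j. Q j \<in> A j E \<and> n j E (Q j) \<le> C * exp (B * vnorm E (vzero E)) * B ^ j / fact j"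
    using assms zero_closed unfolding tame_def by blast
  have "0 \<le> n 0 E (Q 0)" using Q n_nonneg by blast
  then show "0 \<le> C" using Q [of 0] by (simp add: norm_zero)
  show "0 \<le> B" using assms by (simp add: tame_def)
qed

lemma tame_scale:
  assumes "tame C B f"
  shows "tame (cmod c * C) B (\<lambda>x. c * f x)"
  unfolding tame_def
proof (intro conjI ballI)
  show "0 \<le> B" "\<forall>x. x \<notin> vcarrier E \<longrightarrow> c * f x = 0" using assms by (auto simp: tame_def)
  fix a assume "a \<in> vcarrier E"
  then obtain Q where Q: "\<And>j. Q j \<in> A j E \<and> n j E (Q j) \<le> C * exp (B * vnorm E a) * B ^ j / fact j"
    "\<And>y. y \<in> vcarrier E \<Longrightarrow> (\<lambda>j. Q j y) sums f (vadd E a y)"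
    using assms unfolding tame_def by meson
  have "n j E (\<lambda>x. c * Q j x) \<le> cmod c * C * exp (B * vnorm E a) * B ^ j / fact j" for j
  proof -
    have "n j E (\<lambda>x. c * Q j x) = cmod c * n j E (Q j)" using Q(1) n_scale by blast
    also have "\<dots> \<le> cmod c * (C * exp (B * vnorm E a) * B ^ j / fact j)"
      using Q(1) by (intro mult_left_mono) auto
    finally show ?thesis by (simp add: mult.assoc)
  qed
  then show "\<exists>Q. (\<forall>j. Q j \<in> A j E \<and> n j E (Q j) \<le> cmod c * C * exp (B * vnorm E a) * B ^ j / fact j) \<and>
        (\<forall>y\<in>vcarrier E. (\<lambda>j. Q j y) sums (c * f (vadd E a y)))"
    using Q A_scale sums_mult by (intro exI [of _ "\<lambda>j x. c * Q j x"]) blast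
qed

text \<open>The factor 2 in the bound buys a geometric factor, which makes an interchange of two series of
  norms unnecessary.\<close>

lemma tame_series:
  fixes f :: "nat \<Rightarrow> 'u \<Rightarrow> complex"
  assumes f: "\<And>k. tame (C k) (B k) (f k)" and sm: "\<And>s. 0 < s \<Longrightarrow> summable (\<lambda>k. C k * exp (B k * s))"
  shows "(\<lambda>y. \<Sum>k. f k y) \<in> H"
    "0 < s \<Longrightarrow> p s (\<lambda>y. \<Sum>k. f k y) \<le> 2 * (\<Sum>k. C k * exp (B k * (2 * s)))"
    "(\<lambda>k. f k y) sums (\<Sum>k. f k y)"
proof -
  note C = tame_nonneg(1) [OF f] and B = tame_nonneg(2) [OF f]
  have "\<exists>Q. expands_at (\<lambda>y. \<Sum>k. f k y) a Q \<and> (\<forall>y\<in>vcarrier E. summable (\<lambda>k. f k (vadd E a y))) \<and>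
      (\<forall>s>0. (\<Sum>j. s ^ j * n j E (Q j)) \<le> 2 * (\<Sum>k. C k * exp (B k * (vnorm E a + 2 * s))))"
    if a: "a \<in> vcarrier E" for a
  proof -
    have na: "0 \<le> vnorm E a" using a by (rule norm_nonneg)
    have "\<exists>Q. (\<forall>j. Q j \<in> A j E \<and> n j E (Q j) \<le> C k * exp (B k * vnorm E a) * B k ^ j / fact j) \<and>
        (\<forall>y\<in>vcarrier E. (\<lambda>j. Q j y) sums f k (vadd E a y))" for k
      using f [of k] a unfolding tame_def by blast
    then obtain Q where QA: "\<And>k j. Q k j \<in> A j E"
      and Qn: "\<And>k j. n j E (Q k j) \<le> C k * exp (B k * vnorm E a) * B k ^ j / fact j"
      and Qs: "\<And>k y. y \<in> vcarrier E \<Longrightarrow> (\<lambda>j. Q k j y) sums f k (vadd E a y)"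
      by metis
    have Qt: "t ^ j * n j E (Q k j) \<le> C k * exp (B k * (vnorm E a + t))" if t: "0 < t" for t k j
    proof -
      have "t ^ j * n j E (Q k j) \<le> t ^ j * (C k * exp (B k * vnorm E a) * B k ^ j / fact j)"
        using t Qn by (intro mult_left_mono) auto
      also have "\<dots> = C k * exp (B k * vnorm E a) * ((B k * t) ^ j / fact j)"
        by (simp add: power_mult_distrib)
      also have "\<dots> \<le> C k * exp (B k * vnorm E a) * exp (B k * t)"
        using t B C by (intro mult_left_mono power_fact_le_exp) auto
      also have "\<dots> = C k * exp (B k * (vnorm E a + t))"
        by (simp add: distrib_left exp_add)
      finally show ?thesis .
    qed
    have smt: "summable (\<lambda>k. C k * exp (B k * (vnorm E a + t)))" if "0 < t" for t
      using sm [of "vnorm E a + t"] that na by simp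
    have smn: "summable (\<lambda>k. n j E (Q k j))" for j
      by (rule summable_comparison_test' [OF smt [of 1], of 0])
        (use Qt [of 1 j] n_nonneg [OF QA] in auto)
    define R where "R j = (\<lambda>y. \<Sum>k. Q k j y)" for j
    have RA: "R j \<in> A j E" for j
      unfolding R_def by (rule A_series(1) [OF QA smn])
    have Rn: "s ^ j * n j E (R j) \<le> (1 / 2) ^ j * (\<Sum>k. C k * exp (B k * (vnorm E a + 2 * s)))"
      if s: "0 < s" for s j
    proof -
      have "(2 * s) ^ j * n j E (R j) \<le> (2 * s) ^ j * (\<Sum>k. n j E (Q k j))"
        unfolding R_def using s A_series(2) [OF QA smn] by (intro mult_left_mono) auto
      also have "\<dots> = (\<Sum>k. (2 * s) ^ j * n j E (Q k j))"
        using smn by (simp add: suminf_mult)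
      also have "\<dots> \<le> (\<Sum>k. C k * exp (B k * (vnorm E a + 2 * s)))"
        using Qt [of "2 * s"] s by (intro suminf_le summable_mult smn smt) auto
      finally show ?thesis
        by (simp add: power_mult_distrib power_divide field_simps)
    qed
    have geo: "summable (\<lambda>j. (1 / 2) ^ j * K)" "(\<Sum>j. (1 / 2) ^ j * K) = 2 * K" for K :: real
      using suminf_geometric [of "1 / 2 :: real"] by (simp_all add: summable_mult2 suminf_mult2 [symmetric])
    have smR: "summable (\<lambda>j. s ^ j * n j E (R j))" if "0 < s" for s
      by (rule summable_comparison_test' [OF geo(1), of 0]) (use Rn [OF that] n_nonneg [OF RA] that in auto)
    have le: "(\<Sum>j. s ^ j * n j E (R j)) \<le> 2 * (\<Sum>k. C k * exp (B k * (vnorm E a + 2 * s)))" if "0 < s" for s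
      using suminf_le [OF Rn [OF that] smR [OF that] geo(1)] geo(2) by simp
    have pw: "(\<lambda>j. R j y) sums (\<Sum>k. f k (vadd E a y)) \<and> summable (\<lambda>k. f k (vadd E a y))"
      if y: "y \<in> vcarrier E" for y
    proof -
      \<comment> \<open>A radius at least twice the norm of \<open>y\<close> yields the geometric
        factor in \<open>j\<close>; the summand 2 keeps it positive at the origin.\<close>
      define t where "t = 2 * vnorm E y + 2"
      have t: "0 < t" "2 * vnorm E y \<le> t" using norm_nonneg [OF y] by (auto simp: t_def)
      define M where "M k = C k * exp (B k * (vnorm E a + t))" for k
      have Qy: "norm (Q k j y) \<le> (1 / 2) ^ j * M k" for k j
      proof -
        have "norm (Q k j y) \<le> n j E (Q k j) * vnorm E y ^ j" by (rule A_bound [OF QA y])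
        also have "\<dots> \<le> n j E (Q k j) * (t / 2) ^ j"
          using t norm_nonneg [OF y] n_nonneg [OF QA] by (intro mult_left_mono power_mono) auto
        also have "\<dots> = (1 / 2) ^ j * (t ^ j * n j E (Q k j))" by (simp add: power_divide)
        also have "\<dots> \<le> (1 / 2) ^ j * M k" unfolding M_def using Qt [OF t(1)] by (intro mult_left_mono) auto
        finally show ?thesis .
      qed
      have part: "norm (\<Sum>j<J. Q k j y) \<le> 2 * M k" for k J
      proof -
        have "norm (\<Sum>j<J. Q k j y) \<le> (\<Sum>j<J. (1 / 2) ^ j * M k)"
          by (rule sum_norm_le) (rule Qy)
        also have "\<dots> \<le> (\<Sum>j. (1 / 2) ^ j * M k)"
          using C by (intro sum_le_suminf geo(1)) (auto simp: M_def)
        finally show ?thesis using geo(2) by simp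
      qed
      have M: "summable (\<lambda>k. 2 * M k)" unfolding M_def by (intro summable_mult smt t)
      \<comment> \<open>Tannery's theorem interchanges the sum over the functions with the limit of
        their partial Taylor sums; the majorant does not depend on the number of Taylor
        terms.\<close>
      have "eventually (\<lambda>(k, J). norm (\<Sum>j<J. Q k j y) \<le> 2 * M k) (at_top \<times>\<^sub>F sequentially)"
        using part by (simp add: always_eventually)
      moreover have "(\<lambda>J. \<Sum>j<J. Q k j y) \<longlonglongrightarrow> f k (vadd E a y)" for k
        using Qs [OF y, of k] by (simp add: sums_def)
      ultimately have T: "summable (\<lambda>k. norm (f k (vadd E a y)))"
        "(\<lambda>J. \<Sum>k. \<Sum>j<J. Q k j y) \<longlonglongrightarrow> (\<Sum>k. f k (vadd E a y))"
        using tannerys_theorem [of "\<lambda>k J. \<Sum>j<J. Q k j y" "\<lambda>k. f k (vadd E a y)" sequentially "\<lambda>k. 2 * M k"] M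
        by auto
      have "summable (\<lambda>k. Q k j y)" for j
        using A_series(3) [OF QA smn] sums_summable by blast
      then have "(\<Sum>k. \<Sum>j<J. Q k j y) = (\<Sum>j<J. R j y)" for J
        unfolding R_def by (intro suminf_sum)
      then show ?thesis using T summable_norm_cancel by (auto simp: sums_def)
    qed
    have "expands_at (\<lambda>y. \<Sum>k. f k y) a R"
      using RA smR pw by (simp add: expands_at_def)
    then show ?thesis using pw le by blast
  qed
  note ex = this
  have off: "f k y = 0" if "y \<notin> vcarrier E" for k y
    using f [of k] that by (simp add: tame_def)
  show "(\<lambda>y. \<Sum>k. f k y) \<in> H"
    by (rule expands_HbA) (simp add: off, use ex in blast)
  obtain Q where Q: "expands_at (\<lambda>y. \<Sum>k. f k y) (vzero E) Q"
    "\<And>y. y \<in> vcarrier E \<Longrightarrow> summable (\<lambda>k. f k (vadd E (vzero E) y))"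
    "\<And>s. s > 0 \<Longrightarrow> (\<Sum>j. s ^ j * n j E (Q j)) \<le> 2 * (\<Sum>k. C k * exp (B k * (vnorm E (vzero E) + 2 * s)))"
    using ex [OF zero_closed] by meson
  show "p s (\<lambda>y. \<Sum>k. f k y) \<le> 2 * (\<Sum>k. C k * exp (B k * (2 * s)))" if "0 < s"
    using Q(3) [OF that] unfolding expands_seminorm [OF Q(1)] norm_zero by (simp only: add_0)
  have "summable (\<lambda>k. f k y)"
    using Q(2) [of y] off by (cases "y \<in> vcarrier E") (auto simp: zero_add)
  then show "(\<lambda>k. f k y) sums (\<Sum>k. f k y)" by (rule summable_sums)
qed

lemma tame_HbA:
  assumes "tame C B f"
  shows "f \<in> H" "0 < s \<Longrightarrow> p s f \<le> C * exp (B * s)"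
proof -
  note CB = tame_nonneg [OF assms]
  have ex: "\<exists>Q. expands_at f a Q \<and> (\<forall>s>0. (\<Sum>j. s ^ j * n j E (Q j)) \<le> C * exp (B * vnorm E a) * exp (B * s))"
    if a: "a \<in> vcarrier E" for a
  proof -
    obtain Q where Q: "\<And>j. Q j \<in> A j E" "\<And>j. n j E (Q j) \<le> C * exp (B * vnorm E a) * B ^ j / fact j"
      "\<And>y. y \<in> vcarrier E \<Longrightarrow> (\<lambda>j. Q j y) sums f (vadd E a y)"
      using assms a unfolding tame_def by meson
    have le: "s ^ j * n j E (Q j) \<le> C * exp (B * vnorm E a) * ((B * s) ^ j / fact j)" if "0 < s" for s j
    proof -
      have "s ^ j * n j E (Q j) \<le> s ^ j * (C * exp (B * vnorm E a) * B ^ j / fact j)"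
        using that Q by (intro mult_left_mono) auto
      then show ?thesis by (simp add: power_mult_distrib mult_ac)
    qed
    have ex: "(\<lambda>j. C * exp (B * vnorm E a) * ((B * s) ^ j / fact j)) sums (C * exp (B * vnorm E a) * exp (B * s))" for s
      using exp_converges [of "B * s"] by (intro sums_mult) (simp add: scaleR_conv_of_real divide_inverse mult.commute)
    have sm: "summable (\<lambda>j. s ^ j * n j E (Q j))" if "0 < s" for s
      by (rule summable_comparison_test' [OF sums_summable [OF ex], of 0])
        (use le [OF that] n_nonneg [OF Q(1)] that in auto)
    have "(\<Sum>j. s ^ j * n j E (Q j)) \<le> C * exp (B * vnorm E a) * exp (B * s)" if "0 < s" for s
      using suminf_le [OF le [OF that] sm [OF that] sums_summable [OF ex]] sums_unique [OF ex, of s] by simp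
    moreover have "expands_at f a Q" using Q sm by (simp add: expands_at_def)
    ultimately show ?thesis by blast
  qed
  show "f \<in> H" by (rule expands_HbA) (use assms in \<open>simp add: tame_def\<close>, use ex in blast)
  show "p s f \<le> C * exp (B * s)" if "0 < s"
    using ex [OF zero_closed] expands_seminorm that by (auto simp: norm_zero)
qed

text \<open>The remainder after \<open>N\<close> terms is minus a tame series with shifted index, so
  its seminorm is bounded by the tail of a convergent series.\<close>

lemma tame_series_limit:
  fixes f :: "nat \<Rightarrow> 'u \<Rightarrow> complex"
  assumes f: "\<And>k. tame (C k) (B k) (f k)" and sm: "\<And>s. 0 < s \<Longrightarrow> summable (\<lambda>k. C k * exp (B k * s))"
    and s: "0 < s"
  shows "(\<lambda>N. p s (\<lambda>y. (\<Sum>k<N. f k y) - (\<Sum>k. f k y))) \<longlonglongrightarrow> 0"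
proof (rule tendsto_sandwich [of "\<lambda>_. 0"])
  have tail: "p s (\<lambda>y. (\<Sum>k<N. f k y) - (\<Sum>k. f k y)) \<le> 2 * (\<Sum>k. C (k + N) * exp (B (k + N) * (2 * s)))"
    and nonneg: "0 \<le> p s (\<lambda>y. (\<Sum>k<N. f k y) - (\<Sum>k. f k y))" for N
  proof -
    have smN: "summable (\<lambda>k. C (k + N) * exp (B (k + N) * s))" if "0 < s" for s
      using summable_ignore_initial_segment [OF sm [OF that], of N] .
    have tsH: "(\<lambda>y. \<Sum>k. f (k + N) y) \<in> H"
      by (rule tame_series(1) [OF f smN])
    have tsp: "p s (\<lambda>y. \<Sum>k. f (k + N) y) \<le> 2 * (\<Sum>k. C (k + N) * exp (B (k + N) * (2 * s)))"
      by (rule tame_series(2) [OF f smN s])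
    have "(\<lambda>k. f k y) sums (\<Sum>k. f k y)" for y
      by (rule tame_series(3) [OF f sm])
    then have "(\<Sum>k. f k y) = (\<Sum>k. f (k + N) y) + (\<Sum>k<N. f k y)" for y
      by (intro suminf_split_initial_segment sums_summable)
    then have eq: "(\<lambda>y. (\<Sum>k<N. f k y) - (\<Sum>k. f k y)) = (\<lambda>y. -1 * (\<Sum>k. f (k + N) y) + 0 * (\<Sum>k. f (k + N) y))"
      by auto
    have "p s (\<lambda>y. (\<Sum>k<N. f k y) - (\<Sum>k. f k y)) \<le> p s (\<lambda>y. \<Sum>k. f (k + N) y)"
      unfolding eq using HbA_lin(2) [OF tsH tsH s, of "-1" 0] by simp
    then show "p s (\<lambda>y. (\<Sum>k<N. f k y) - (\<Sum>k. f k y)) \<le> 2 * (\<Sum>k. C (k + N) * exp (B (k + N) * (2 * s)))"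
      using tsp by simp
    have "(\<lambda>y. (\<Sum>k<N. f k y) - (\<Sum>k. f k y)) \<in> H"
      unfolding eq by (rule HbA_lin(1) [OF tsH tsH])
    then show "0 \<le> p s (\<lambda>y. (\<Sum>k<N. f k y) - (\<Sum>k. f k y))"
      unfolding HbA_seminorm_def using s HbA_n_nonneg HbA_summable by (intro suminf_nonneg) auto
  qed
  show "(\<lambda>N. 2 * (\<Sum>k. C (k + N) * exp (B (k + N) * (2 * s)))) \<longlonglongrightarrow> 0"
    using tendsto_mult_left [OF suminf_exist_split2 [OF sm [of "2 * s"]], of 2] s by simp
  show "\<forall>\<^sub>F N in sequentially. 0 \<le> p s (\<lambda>y. (\<Sum>k<N. f k y) - (\<Sum>k. f k y))"
    using nonneg by (rule always_eventually [OF allI])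
  show "\<forall>\<^sub>F N in sequentially. p s (\<lambda>y. (\<Sum>k<N. f k y) - (\<Sum>k. f k y))
      \<le> 2 * (\<Sum>k. C (k + N) * exp (B (k + N) * (2 * s)))"
    using tail by (rule always_eventually [OF allI])
qed simp

lemma tame_zero: "tame 0 0 (\<lambda>x. 0)"
  unfolding tame_def using A_zero n_zero by (auto intro!: exI [of _ "\<lambda>_ _. 0"])

sublocale seminormed_functions H p
proof
  show "H \<noteq> {}" using tame_HbA(1) [OF tame_zero] by blast
  show "0 \<le> p s f" if "0 < s" "f \<in> H" for s f
    unfolding HbA_seminorm_def using that HbA_n_nonneg HbA_summable by (intro suminf_nonneg) auto
  show "p s f \<le> p t f" if "0 < s" "s \<le> t" "f \<in> H" for s t f
    unfolding HbA_seminorm_def using that HbA_n_nonneg HbA_summable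
    by (intro suminf_le mult_right_mono power_mono) auto
  show "\<exists>s>0. \<forall>f\<in>H. cmod (f y) \<le> p s f" for y
  proof (cases "y \<in> vcarrier E")
    case True
    then show ?thesis using HbA_bound [OF _ True, of _ "max 1 (vnorm E y)"]
      by (intro exI [of _ "max 1 (vnorm E y)"]) auto
  next
    case False
    have "cmod (f y) \<le> p 1 f" if "f \<in> H" for f
      unfolding HbA_off [OF that False] HbA_seminorm_def
      using that HbA_n_nonneg HbA_summable [OF that, of 1] by (simp add: suminf_nonneg)
    then show ?thesis by (intro exI [of _ 1]) auto
  qed
qed (use HbA_lin in auto)

end

section \<open>Entire functions of exponential type\<close>

definition exp_type :: "real \<Rightarrow> real \<Rightarrow> (nat \<Rightarrow> complex) \<Rightarrow> bool" where
  "exp_type K R c \<longleftrightarrow> 0 \<le> K \<and> 0 < R \<and> (\<forall>j. cmod (c j) \<le> K * R ^ j)"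

text \<open>The exponential generating function of \<open>c\<close>: the coefficients are the
  derivatives at 0, so shifting the sequence is differentiation, and \<open>exp_type\<close>
  expresses exponential type at most \<open>R\<close>.\<close>

definition egf :: "(nat \<Rightarrow> complex) \<Rightarrow> complex \<Rightarrow> complex" where
  "egf c t = (\<Sum>j. c j * t ^ j / fact j)"

lemma exp_type_shift:
  assumes "exp_type K R c"
  shows "exp_type (K * R ^ m) R (\<lambda>j. c (j + m))"
proof -
  have "cmod (c (j + m)) \<le> K * R ^ m * R ^ j" for j
  proof -
    have "cmod (c (j + m)) \<le> K * R ^ (j + m)" using assms by (simp add: exp_type_def)
    then show ?thesis by (simp add: power_add mult_ac)
  qed
  then show ?thesis using assms by (simp add: exp_type_def)
qed

lemma sums_real_exp: "(\<lambda>j. x ^ j / fact j) sums exp (x :: real)"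
  using exp_converges [of x] by (simp add: scaleR_conv_of_real divide_inverse mult.commute)

lemma egf_norm_summable:
  assumes "exp_type K R c"
  shows "summable (\<lambda>j. norm (c j * t ^ j / fact j))" "cmod (egf c t) \<le> K * exp (R * cmod t)"
proof -
  have le: "norm (c j * t ^ j / fact j) \<le> K * ((R * cmod t) ^ j / fact j)" for j
  proof -
    have "norm (c j * t ^ j / fact j) = cmod (c j) * (cmod t ^ j / fact j)"
      by (simp add: norm_mult norm_divide norm_power)
    also have "\<dots> \<le> (K * R ^ j) * (cmod t ^ j / fact j)"
      using assms by (intro mult_right_mono) (auto simp: exp_type_def)
    finally show ?thesis by (simp add: power_mult_distrib mult_ac)
  qed
  have s: "(\<lambda>j. K * ((R * cmod t) ^ j / fact j)) sums (K * exp (R * cmod t))"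
    by (rule sums_mult [OF sums_real_exp])
  show sm: "summable (\<lambda>j. norm (c j * t ^ j / fact j))"
    by (rule summable_comparison_test' [OF sums_summable [OF s], of 0]) (use le in simp)
  have "cmod (egf c t) \<le> (\<Sum>j. norm (c j * t ^ j / fact j))"
    unfolding egf_def by (rule summable_norm [OF sm])
  also have "\<dots> \<le> K * exp (R * cmod t)"
    using suminf_le [OF le sm sums_summable [OF s]] sums_unique [OF s] by simp
  finally show "cmod (egf c t) \<le> K * exp (R * cmod t)" .
qed

lemma egf_sums: "exp_type K R c \<Longrightarrow> (\<lambda>j. c j * t ^ j / fact j) sums egf c t"
  unfolding egf_def by (rule summable_sums [OF summable_norm_cancel [OF egf_norm_summable(1)]])

lemma egf_deriv:
  assumes "exp_type K R c"
  shows "(egf c has_field_derivative egf (\<lambda>j. c (Suc j)) t) (at t)"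
proof -
  have "((\<lambda>t. \<Sum>j. (c j / fact j) * t ^ j) has_field_derivative (\<Sum>j. diffs (\<lambda>j. c j / fact j) j * t ^ j)) (at t)"
    by (rule termdiffs_strong_converges_everywhere)
      (use egf_sums [OF assms] sums_summable in \<open>force simp: mult_ac\<close>)
  moreover have "diffs (\<lambda>j. c j / fact j) j = c (Suc j) / fact j" for j
    by (simp add: diffs_def field_simps del: of_nat_Suc)
  ultimately show ?thesis
    by (simp add: egf_def [abs_def] mult_ac)
qed

lemma egf_higher_deriv:
  assumes "exp_type K R c"
  shows "(deriv ^^ m) (egf c) = egf (\<lambda>j. c (j + m))"
proof (induction m)
  case (Suc m)
  have "deriv (egf (\<lambda>j. c (j + m))) = egf (\<lambda>j. c (j + Suc m))"
    using egf_deriv [OF exp_type_shift [OF assms, of m]] by (intro ext DERIV_imp_deriv) simp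
  then show ?case using Suc by simp
qed simp

lemma egf_holomorphic: "exp_type K R c \<Longrightarrow> egf c holomorphic_on S"
  unfolding holomorphic_on_def field_differentiable_def
  using has_field_derivative_at_within [OF egf_deriv] by blast

text \<open>Taylor's expansion at \<open>a\<close>, whose derivatives there are the generating
  functions of the shifted sequences.\<close>

lemma egf_add:
  assumes "exp_type K R c"
  shows "egf c (a + b) = egf (\<lambda>m. egf (\<lambda>j. c (j + m)) a) b"
proof -
  have "(\<lambda>m. (deriv ^^ m) (egf c) a / fact m * (a + b - a) ^ m) sums egf c (a + b)"
    by (rule holomorphic_power_series [of _ _ "cmod b + 1"])
      (auto intro: egf_holomorphic [OF assms] simp: dist_norm)
  then show ?thesis
    unfolding egf_def [of "\<lambda>m. egf (\<lambda>j. c (j + m)) a" b]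
    by (simp add: egf_higher_deriv [OF assms] sums_iff)
qed

lemma exp_type_egf_shift:
  assumes "exp_type K R c"
  shows "exp_type (K * exp (R * cmod a)) R (\<lambda>m. egf (\<lambda>j. c (j + m)) a)"
  using egf_norm_summable(2) [OF exp_type_shift [OF assms]] assms
  by (simp add: exp_type_def mult_ac)

lemma egf_power: "egf (\<lambda>j. w ^ j) t = exp (w * t)"
  using exp_converges [of "w * t"]
  by (simp add: egf_def sums_iff power_mult_distrib scaleR_conv_of_real divide_inverse mult_ac)

text \<open>Orthogonality of the characters of the cyclic group of order k + 1. The exponent
  \<open>Suc k - j\<close> stands for -j modulo the order; the total exponent \<open>e\<close> lies
  strictly between 0 and 2 (k + 1), so it is a multiple of the order only for
  \<open>i = j\<close>.\<close>

lemma sum_root_unity: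
  assumes "i \<le> k" "j \<le> k"
  defines "\<omega> \<equiv> exp (2 * of_real pi * \<i> / of_nat (Suc k))"
  shows "(\<Sum>l\<le>k. \<omega> ^ (l * (Suc k - j)) * \<omega> ^ (l * i)) = (if i = j then of_nat (Suc k) else 0)"
proof -
  define e where "e = Suc k - j + i"
  have pow: "\<omega> ^ m = exp (2 * of_real pi * \<i> * of_nat m / of_nat (Suc k))" for m
    unfolding \<omega>_def exp_of_nat_mult [symmetric] by (simp add: mult_ac del: of_nat_Suc)
  have \<omega>1: "\<omega> ^ m = 1 \<longleftrightarrow> Suc k dvd m" for m
    unfolding pow by (rule complex_root_unity_eq_1) simp
  have "(\<Sum>l\<le>k. \<omega> ^ (l * (Suc k - j)) * \<omega> ^ (l * i)) = (\<Sum>l<Suc k. (\<omega> ^ e) ^ l)"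
    by (intro sum.cong) (auto simp: e_def power_add [symmetric] power_mult [symmetric] algebra_simps)
  also have "\<dots> = (if i = j then of_nat (Suc k) else 0)"
  proof (cases "i = j")
    case True
    then have "\<omega> ^ e = 1" using assms(2) by (simp only: \<omega>1 e_def) simp
    then show ?thesis using True by (simp del: sum.lessThan_Suc)
  next
    case False
    have "\<not> Suc k dvd e"
    proof
      assume "Suc k dvd e"
      then obtain q where "e = Suc k * q" by blast
      moreover have "0 < e" "e < Suc k * 2" "e \<noteq> Suc k" using assms False by (auto simp: e_def)
      ultimately show False
        by (metis One_nat_def Suc_1 less_2_cases mult_0_right mult_1_right mult_less_cancel1 less_irrefl)
    qed
    then have "\<omega> ^ e \<noteq> 1" by (simp add: \<omega>1)
    moreover have "(\<omega> ^ e) ^ Suc k = 1"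
      unfolding power_mult [symmetric] \<omega>1 by (rule dvd_triv_right)
    ultimately show ?thesis using False geometric_sum [of "\<omega> ^ e" "Suc k"] by simp
  qed
  finally show ?thesis .
qed

lemma norm_root_unity: "cmod (exp (2 * of_real pi * \<i> / of_nat (Suc k)) ^ m) = 1"
  by (simp add: norm_power norm_exp_eq_Re del: of_nat_Suc)

section \<open>Exponentials times entire functions of a second functional\<close>

context poly_ideals
begin

lemmas vadd_closed = complex_normed_space.add_closed [OF complex_normed_space_axioms]

text \<open>The coefficient sequence w^j gives the exponential of
  \<open>\<gamma> + w \<delta>\<close>. The expression is linear in \<open>c\<close>, so averaging
  exponentials over a curve of parameters \<open>w\<close> amounts to averaging the scalars
  w^j.\<close>

definition expfun :: "('u \<Rightarrow> complex) \<Rightarrow> ('u \<Rightarrow> complex) \<Rightarrow> (nat \<Rightarrow> complex) \<Rightarrow> 'u \<Rightarrow> complex" where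
  "expfun \<gamma> \<delta> c = zero_off E (\<lambda>y. exp (\<gamma> y) * egf c (\<delta> y))"

definition prodpoly :: "('u \<Rightarrow> complex) \<Rightarrow> ('u \<Rightarrow> complex) \<Rightarrow> nat \<Rightarrow> nat \<Rightarrow> 'u \<Rightarrow> complex" where
  "prodpoly \<gamma> \<delta> k j = zero_off E (\<lambda>y. \<gamma> y ^ (k - j) / fact (k - j) * (\<delta> y ^ j / fact j))"

text \<open>By a discrete Cauchy formula over roots of unity, the mixed monomials are averages of powers of
  functionals, which belong to the ideal; this also gives the Cauchy estimate.\<close>

lemma prodpoly_in_A:
  assumes \<gamma>: "\<gamma> \<in> dual" and \<delta>: "\<delta> \<in> dual" and j: "j \<le> k" and r: "0 < r"
  shows "prodpoly \<gamma> \<delta> k j \<in> A k E"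
    "n k E (prodpoly \<gamma> \<delta> k j) \<le> (dnorm \<gamma> + r * dnorm \<delta>) ^ k / fact k / r ^ j"
proof -
  define \<omega> :: complex where "\<omega> = exp (2 * of_real pi * \<i> / of_nat (Suc k))"
  define \<eta> where "\<eta> l = (\<lambda>y. 1 * \<gamma> y + (r * \<omega> ^ l) * \<delta> y)" for l
  have n1: "cmod (\<omega> ^ m) = 1" for m unfolding \<omega>_def by (rule norm_root_unity)
  have \<eta>: "\<eta> l \<in> dual" for l unfolding \<eta>_def by (rule dual_lin(1) [OF \<gamma> \<delta>])
  have n\<eta>: "dnorm (\<eta> l) \<le> dnorm \<gamma> + r * dnorm \<delta>" for l
    using dual_lin(2) [OF \<gamma> \<delta>, of 1 "r * \<omega> ^ l"] r by (simp add: \<eta>_def norm_mult n1)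
  define P where "P l = zero_off E (\<lambda>y. \<eta> l y ^ k)" for l
  \<comment> \<open>Averaging (\<open>\<gamma> + r \<omega>^l \<delta>\<close>)^k against these
    weights extracts the binomial term with \<open>\<delta>\<close>^j and removes the factor
    r^j.\<close>
  define co where "co l = \<omega> ^ (l * (Suc k - j)) / (of_nat (Suc k) * r ^ j * fact k)" for l
  have PA: "P l \<in> A k E" and nP: "n k E (P l) \<le> (dnorm \<gamma> + r * dnorm \<delta>) ^ k" for l
  proof -
    show "P l \<in> A k E" unfolding P_def by (rule power_in_A(1) [OF \<eta>])
    have "n k E (P l) \<le> dnorm (\<eta> l) ^ k" unfolding P_def by (rule power_in_A(2) [OF \<eta>])
    also have "\<dots> \<le> (dnorm \<gamma> + r * dnorm \<delta>) ^ k"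
      by (intro power_mono n\<eta> dnorm_nonneg \<eta>)
    finally show "n k E (P l) \<le> (dnorm \<gamma> + r * dnorm \<delta>) ^ k" .
  qed
  have eq: "prodpoly \<gamma> \<delta> k j = (\<lambda>y. \<Sum>l\<le>k. co l * P l y)"
  proof
    fix y
    show "prodpoly \<gamma> \<delta> k j y = (\<Sum>l\<le>k. co l * P l y)"
    proof (cases "y \<in> vcarrier E")
      case True
      let ?b = "\<lambda>i. of_nat (k choose i) * \<gamma> y ^ (k - i) * \<delta> y ^ i * r ^ i"
      have "P l y = (\<Sum>i\<le>k. ?b i * \<omega> ^ (l * i))" for l
        using True unfolding P_def zero_off_def \<eta>_def
        by (subst add.commute, subst binomial_ring)
          (simp add: power_mult_distrib power_mult [symmetric] mult_ac)
      then have "\<omega> ^ (l * (Suc k - j)) * P l y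
          = (\<Sum>i\<le>k. ?b i * (\<omega> ^ (l * (Suc k - j)) * \<omega> ^ (l * i)))" for l
        by (simp only: sum_distrib_left mult.left_commute [of "\<omega> ^ (l * (Suc k - j))"])
      then have "(\<Sum>l\<le>k. \<omega> ^ (l * (Suc k - j)) * P l y)
          = (\<Sum>l\<le>k. \<Sum>i\<le>k. ?b i * (\<omega> ^ (l * (Suc k - j)) * \<omega> ^ (l * i)))"
        by (simp only:)
      also have "\<dots> = (\<Sum>i\<le>k. ?b i * (\<Sum>l\<le>k. \<omega> ^ (l * (Suc k - j)) * \<omega> ^ (l * i)))"
        by (subst sum.swap) (simp only: sum_distrib_left)
      also have "\<dots> = (\<Sum>i\<le>k. if i = j then ?b i * of_nat (Suc k) else 0)"
      proof (intro sum.cong refl)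
        fix i assume "i \<in> {..k}"
        then show "?b i * (\<Sum>l\<le>k. \<omega> ^ (l * (Suc k - j)) * \<omega> ^ (l * i))
            = (if i = j then ?b i * of_nat (Suc k) else 0)"
          using sum_root_unity [of i k j] j unfolding \<omega>_def by (simp only: atMost_iff) simp
      qed
      also have "\<dots> = ?b j * of_nat (Suc k)"
        using j by (subst sum.delta) auto
      finally have *: "(\<Sum>l\<le>k. \<omega> ^ (l * (Suc k - j)) * P l y) = ?b j * of_nat (Suc k)" .
      have "(\<Sum>l\<le>k. co l * P l y)
          = (\<Sum>l\<le>k. \<omega> ^ (l * (Suc k - j)) * P l y) / (of_nat (Suc k) * r ^ j * fact k)"
        by (simp add: co_def sum_divide_distrib)
      also have "\<dots> = ?b j / (r ^ j * fact k)"
        unfolding * by (simp del: of_nat_Suc)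
      also have "\<dots> = of_nat (k choose j) / fact k * (\<gamma> y ^ (k - j) * \<delta> y ^ j)"
        using r by simp
      also have "of_nat (k choose j) / fact k = (1 / (fact j * fact (k - j)) :: complex)"
        using j by (simp add: binomial_fact)
      finally show ?thesis using True by (simp add: prodpoly_def zero_off_def)
    qed (simp add: prodpoly_def P_def zero_off_def)
  qed
  show "prodpoly \<gamma> \<delta> k j \<in> A k E"
    unfolding eq by (intro A_sum A_scale PA)
  have "n k E (prodpoly \<gamma> \<delta> k j) \<le> (\<Sum>l\<le>k. n k E (\<lambda>y. co l * P l y))"
    unfolding eq by (intro n_sum A_scale PA)
  also have "\<dots> \<le> (\<Sum>l\<le>k. 1 / (of_nat (Suc k) * r ^ j * fact k) * (dnorm \<gamma> + r * dnorm \<delta>) ^ k)"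
  proof (intro sum_mono)
    fix l
    have "n k E (\<lambda>y. co l * P l y) = cmod (co l) * n k E (P l)" by (rule n_scale [OF PA])
    also have "cmod (co l) = 1 / (of_nat (Suc k) * r ^ j * fact k)"
      using r n1 [of 1] by (simp add: co_def norm_divide norm_mult norm_power del: of_nat_Suc)
    also have "1 / (of_nat (Suc k) * r ^ j * fact k) * n k E (P l)
        \<le> 1 / (of_nat (Suc k) * r ^ j * fact k) * (dnorm \<gamma> + r * dnorm \<delta>) ^ k"
      using r by (intro mult_left_mono nP) simp
    finally show "n k E (\<lambda>y. co l * P l y) \<le> 1 / (of_nat (Suc k) * r ^ j * fact k) * (dnorm \<gamma> + r * dnorm \<delta>) ^ k" .
  qed
  also have "\<dots> = real (Suc k) * (1 / (of_nat (Suc k) * r ^ j * fact k) * (dnorm \<gamma> + r * dnorm \<delta>) ^ k)"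
    by (simp only: sum_constant card_atMost)
  also have "\<dots> = (dnorm \<gamma> + r * dnorm \<delta>) ^ k / fact k / r ^ j"
    by (simp del: of_nat_Suc)
  finally show "n k E (prodpoly \<gamma> \<delta> k j) \<le> (dnorm \<gamma> + r * dnorm \<delta>) ^ k / fact k / r ^ j" .
qed

text \<open>At a point \<open>a\<close> the function is exp(\<open>\<gamma> a\<close>) times the
  product of exp(\<open>\<gamma> y\<close>) with the generating function re-expanded at
  \<open>\<delta> a\<close>. The Cauchy product sorts it into homogeneous parts, each a combination
  of mixed monomials of the ideal. The factor 2 in front is the sum of a geometric series.\<close>

lemma expfun_tame:
  assumes \<gamma>: "\<gamma> \<in> dual" and \<delta>: "\<delta> \<in> dual" and c: "exp_type K R c"
  shows "tame (2 * K) (dnorm \<gamma> + 2 * R * dnorm \<delta>) (expfun \<gamma> \<delta> c)"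
  unfolding tame_def
proof (intro conjI ballI allI impI)
  have R: "0 < R" and K: "0 \<le> K" using c by (auto simp: exp_type_def)
  let ?B = "dnorm \<gamma> + 2 * R * dnorm \<delta>"
  show B: "0 \<le> ?B" using dnorm_nonneg [OF \<gamma>] dnorm_nonneg [OF \<delta>] R by simp
  show "expfun \<gamma> \<delta> c x = 0" if "x \<notin> vcarrier E" for x
    using that by (simp add: expfun_def zero_off_def)
  fix a assume a: "a \<in> vcarrier E"
  define c' where "c' m = egf (\<lambda>j. c (j + m)) (\<delta> a)" for m
  have c': "exp_type (K * exp (R * cmod (\<delta> a))) R c'"
    unfolding c'_def by (rule exp_type_egf_shift [OF c])
  define Q where "Q k = (\<lambda>y. \<Sum>j\<le>k. (exp (\<gamma> a) * c' j) * prodpoly \<gamma> \<delta> k j y)" for k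
  have "Q k \<in> A k E" for k
    unfolding Q_def using R by (intro A_sum A_scale prodpoly_in_A(1) [OF \<gamma> \<delta>, of _ _ R]) auto
  moreover have "n k E (Q k) \<le> 2 * K * exp (?B * vnorm E a) * ?B ^ k / fact k" for k
  proof -
    let ?L = "K * exp (?B * vnorm E a)"
    have co: "cmod (exp (\<gamma> a) * c' j) \<le> ?L * R ^ j" for j
    proof -
      have "cmod (exp (\<gamma> a)) \<le> exp (dnorm \<gamma> * vnorm E a)"
        using abs_Re_le_cmod [of "\<gamma> a"] dual_bound [OF \<gamma> a] by (simp add: norm_exp_eq_Re)
      moreover have "cmod (c' j) \<le> (K * exp (R * cmod (\<delta> a))) * R ^ j"
        using c' by (simp add: exp_type_def)
      moreover have "\<dots> \<le> (K * exp (R * (dnorm \<delta> * vnorm E a))) * R ^ j"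
        using dual_bound [OF \<delta> a] R K by (intro mult_right_mono mult_left_mono) auto
      ultimately have "cmod (exp (\<gamma> a) * c' j)
          \<le> exp (dnorm \<gamma> * vnorm E a) * ((K * exp (R * (dnorm \<delta> * vnorm E a))) * R ^ j)"
        unfolding norm_mult by (intro mult_mono) auto
      also have "\<dots> = K * (exp (dnorm \<gamma> * vnorm E a) * exp (R * (dnorm \<delta> * vnorm E a))) * R ^ j"
        by (simp only: mult_ac)
      also have "\<dots> = K * exp ((dnorm \<gamma> + R * dnorm \<delta>) * vnorm E a) * R ^ j"
        by (simp only: exp_add [symmetric] distrib_right mult.assoc)
      also have "\<dots> \<le> ?L * R ^ j"
        using R K norm_nonneg [OF a] dnorm_nonneg [OF \<delta>]
        by (intro mult_right_mono mult_left_mono) (auto intro!: mult_right_mono)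
      finally show ?thesis .
    qed
    have "n k E (Q k) \<le> (\<Sum>j\<le>k. n k E (\<lambda>y. (exp (\<gamma> a) * c' j) * prodpoly \<gamma> \<delta> k j y))"
      unfolding Q_def using R by (intro n_sum A_scale prodpoly_in_A(1) [OF \<gamma> \<delta>, of _ _ R]) auto
    also have "\<dots> \<le> (\<Sum>j\<le>k. ?L * (?B ^ k / fact k) * (1 / 2) ^ j)"
    proof (intro sum_mono)
      fix j assume "j \<in> {..k}"
      then have j: "j \<le> k" by simp
      \<comment> \<open>Cauchy's estimate at radius 2R against coefficients of size R^j leaves the
        summable factor (1/2)^j.\<close>
      have R2: "0 < 2 * R" using R by simp
      have "n k E (\<lambda>y. (exp (\<gamma> a) * c' j) * prodpoly \<gamma> \<delta> k j y)
          = cmod (exp (\<gamma> a) * c' j) * n k E (prodpoly \<gamma> \<delta> k j)"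
        by (rule n_scale [OF prodpoly_in_A(1) [OF \<gamma> \<delta> j R]])
      also have "\<dots> \<le> (?L * R ^ j) * (?B ^ k / fact k / (2 * R) ^ j)"
        using co prodpoly_in_A [OF \<gamma> \<delta> j R2] K R n_nonneg by (intro mult_mono) auto
      also have "\<dots> = ?L * (?B ^ k / fact k) * (1 / 2) ^ j"
        using R by (simp add: power_mult_distrib power_divide)
      finally show "n k E (\<lambda>y. (exp (\<gamma> a) * c' j) * prodpoly \<gamma> \<delta> k j y) \<le> ?L * (?B ^ k / fact k) * (1 / 2) ^ j" .
    qed
    also have "\<dots> = ?L * (?B ^ k / fact k) * (\<Sum>j\<le>k. (1 / 2) ^ j)"
      by (simp only: sum_distrib_left)
    also have "\<dots> \<le> ?L * (?B ^ k / fact k) * 2"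
    proof (intro mult_left_mono)
      show "(\<Sum>j\<le>k. (1 / 2) ^ j) \<le> (2 :: real)"
        using sum_le_suminf [of "\<lambda>j. (1 / 2 :: real) ^ j" "{..k}"] suminf_geometric [of "1 / 2 :: real"] by simp
    qed (use K B in simp)
    finally show ?thesis by (simp add: mult_ac)
  qed
  moreover have "(\<lambda>k. Q k y) sums expfun \<gamma> \<delta> c (vadd E a y)" if y: "y \<in> vcarrier E" for y
  proof -
    have "(\<lambda>k. \<Sum>j\<le>k. (c' j * \<delta> y ^ j / fact j) * (\<gamma> y ^ (k - j) /\<^sub>R fact (k - j)))
        sums ((\<Sum>j. c' j * \<delta> y ^ j / fact j) * (\<Sum>j. \<gamma> y ^ j /\<^sub>R fact j))"
      by (rule Cauchy_product_sums [OF egf_norm_summable(1) [OF c'] summable_norm_exp])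
    moreover have "(\<Sum>j. c' j * \<delta> y ^ j / fact j) = egf c (\<delta> a + \<delta> y)"
    proof -
      have "c' = (\<lambda>m. egf (\<lambda>j. c (j + m)) (\<delta> a))" by (simp add: c'_def fun_eq_iff)
      then have "egf c (\<delta> a + \<delta> y) = egf c' (\<delta> y)" by (simp only: egf_add [OF c])
      then show ?thesis by (simp only: egf_def [of c'])
    qed
    moreover have "(\<Sum>j. \<gamma> y ^ j /\<^sub>R fact j) = exp (\<gamma> y)" by (simp add: exp_def)
    ultimately have "(\<lambda>k. exp (\<gamma> a) * (\<Sum>j\<le>k. (c' j * \<delta> y ^ j / fact j) * (\<gamma> y ^ (k - j) /\<^sub>R fact (k - j))))
        sums (exp (\<gamma> a) * (egf c (\<delta> a + \<delta> y) * exp (\<gamma> y)))"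
      by (intro sums_mult) simp
    moreover have "exp (\<gamma> a) * (\<Sum>j\<le>k. (c' j * \<delta> y ^ j / fact j) * (\<gamma> y ^ (k - j) /\<^sub>R fact (k - j))) = Q k y" for k
    proof -
      have "exp (\<gamma> a) * ((c' j * \<delta> y ^ j / fact j) * (\<gamma> y ^ (k - j) /\<^sub>R fact (k - j)))
          = (exp (\<gamma> a) * c' j) * prodpoly \<gamma> \<delta> k j y" for j
        using y by (simp add: prodpoly_def zero_off_def scaleR_conv_of_real divide_inverse)
      then show ?thesis by (simp only: Q_def sum_distrib_left)
    qed
    moreover have "exp (\<gamma> a) * (egf c (\<delta> a + \<delta> y) * exp (\<gamma> y)) = expfun \<gamma> \<delta> c (vadd E a y)"
      using a y by (simp add: expfun_def zero_off_def vadd_closed dual_add [OF \<gamma>] dual_add [OF \<delta>] exp_add)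
    ultimately show ?thesis by simp
  qed
  ultimately show "\<exists>Q. (\<forall>j. Q j \<in> A j E \<and> n j E (Q j) \<le> 2 * K * exp (?B * vnorm E a) * ?B ^ j / fact j) \<and>
        (\<forall>y\<in>vcarrier E. (\<lambda>j. Q j y) sums expfun \<gamma> \<delta> c (vadd E a y))"
    by (intro exI [of _ Q]) simp
qed

definition expo :: "('u \<Rightarrow> complex) \<Rightarrow> 'u \<Rightarrow> complex" where
  "expo \<gamma> = zero_off E (\<lambda>y. exp (\<gamma> y))"

text \<open>The coefficient of w^j in the expansion of the exponential of
  \<open>\<gamma> + w \<delta>\<close>.\<close>

abbreviation jet :: "('u \<Rightarrow> complex) \<Rightarrow> ('u \<Rightarrow> complex) \<Rightarrow> nat \<Rightarrow> 'u \<Rightarrow> complex" where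
  "jet \<gamma> \<delta> j \<equiv> expfun \<gamma> \<delta> (\<lambda>i. if i = j then 1 else 0)"

lemma expfun_power: "expfun \<gamma> \<delta> (\<lambda>j. w ^ j) = expo (\<lambda>y. \<gamma> y + w * \<delta> y)"
  by (auto simp: expfun_def expo_def zero_off_def egf_power exp_add)

lemma exp_type_power: "exp_type 1 (cmod w + 1) (\<lambda>j. w ^ j)"
  unfolding exp_type_def norm_power by (simp add: add_nonneg_pos power_mono)

text \<open>Every radius is admissible, at the price 1 / R^j; choosing it large is what makes series
  of jets converge.\<close>

lemma exp_type_delta: "0 < R \<Longrightarrow> exp_type (1 / R ^ j) R (\<lambda>i. if i = j then 1 else 0)"
  unfolding exp_type_def by simp

lemma jet_apply: "y \<in> vcarrier E \<Longrightarrow> jet \<gamma> \<delta> j y = exp (\<gamma> y) * (\<delta> y ^ j / fact j)"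
proof -
  have "egf (\<lambda>i. if i = j then 1 else 0) t = t ^ j / fact j" for t
  proof -
    have "(\<lambda>i. (if i = j then 1 else 0) * t ^ i / fact i) = (\<lambda>i. if i = j then t ^ i / fact i else 0)"
      by auto
    then show ?thesis
      using sums_single [of j "\<lambda>i. t ^ i / fact i"] by (simp add: egf_def sums_iff)
  qed
  then show "y \<in> vcarrier E \<Longrightarrow> ?thesis" by (simp add: expfun_def zero_off_def)
qed

lemma jet_tame:
  assumes "\<gamma> \<in> dual" "\<delta> \<in> dual" "0 < R"
  shows "tame (2 * (1 / R ^ j)) (dnorm \<gamma> + 2 * R * dnorm \<delta>) (jet \<gamma> \<delta> j)"
  by (rule expfun_tame [OF assms(1,2) exp_type_delta [OF assms(3)]])

lemma expfun_in_H: "\<gamma> \<in> dual \<Longrightarrow> \<delta> \<in> dual \<Longrightarrow> exp_type K R c \<Longrightarrow> expfun \<gamma> \<delta> c \<in> H"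
  by (rule tame_HbA(1) [OF expfun_tame])

lemma jet_in_H: "\<gamma> \<in> dual \<Longrightarrow> \<delta> \<in> dual \<Longrightarrow> jet \<gamma> \<delta> j \<in> H"
  by (rule tame_HbA(1) [OF jet_tame [OF _ _ zero_less_one]])

lemma expo_in_H:
  assumes "\<gamma> \<in> dual"
  shows "expo \<gamma> \<in> H"
proof -
  have "expfun \<gamma> \<gamma> (\<lambda>j. 0 ^ j) \<in> H"
    by (rule expfun_in_H [OF assms assms exp_type_power])
  then have "expo (\<lambda>y. \<gamma> y + 0 * \<gamma> y) \<in> H" by (simp only: expfun_power)
  then show ?thesis by simp
qed

text \<open>Jets are measured at radius 2R against coefficients of type \<open>R\<close>, so their
  bounds decay like (1/2)^j with a common exponential type. Convergence in the topology of the space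
  lets a continuous operator be applied term by term.\<close>

lemma expfun_series:
  assumes \<gamma>: "\<gamma> \<in> dual" and \<delta>: "\<delta> \<in> dual" and c: "exp_type K R c"
  shows "limitin \<T> (\<lambda>N y. \<Sum>j<N. c j * jet \<gamma> \<delta> j y) (expfun \<gamma> \<delta> c) sequentially"
proof -
  have R: "0 < R" and K: "0 \<le> K" using c by (auto simp: exp_type_def)
  have R2: "0 < 2 * R" using R by simp
  define C where "C j = cmod (c j) * (2 * (1 / (2 * R) ^ j))" for j
  let ?B = "dnorm \<gamma> + 2 * (2 * R) * dnorm \<delta>"
  have tame: "tame (C j) ?B (\<lambda>y. c j * jet \<gamma> \<delta> j y)" for j
    unfolding C_def by (rule tame_scale [OF jet_tame [OF \<gamma> \<delta> R2]])
  have "summable C"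
  proof (rule summable_comparison_test' [of "\<lambda>j. (2 * K) * (1 / 2) ^ j" 0])
    show "norm (C j) \<le> (2 * K) * (1 / 2) ^ j" for j
    proof -
      have "cmod (c j) * (2 * (1 / (2 * R) ^ j)) \<le> (K * R ^ j) * (2 * (1 / (2 * R) ^ j))"
        using c R by (intro mult_right_mono) (auto simp: exp_type_def)
      also have "\<dots> = (2 * K) * (1 / 2) ^ j" using R by (simp add: power_mult_distrib power_divide)
      finally show ?thesis using R by (simp add: C_def)
    qed
  qed (intro summable_mult summable_geometric, simp)
  then have sm: "summable (\<lambda>j. C j * exp (?B * s))" for s by (rule summable_mult2)
  have eq: "expfun \<gamma> \<delta> c = (\<lambda>y. \<Sum>j. c j * jet \<gamma> \<delta> j y)"
  proof
    fix y
    show "expfun \<gamma> \<delta> c y = (\<Sum>j. c j * jet \<gamma> \<delta> j y)"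
    proof (cases "y \<in> vcarrier E")
      case True
      have "(\<lambda>j. exp (\<gamma> y) * (c j * \<delta> y ^ j / fact j)) sums (exp (\<gamma> y) * egf c (\<delta> y))"
        by (rule sums_mult [OF egf_sums [OF c]])
      then show ?thesis
        using True by (simp add: jet_apply expfun_def [of _ _ c] zero_off_def sums_iff mult_ac)
    qed (simp add: expfun_def zero_off_def)
  qed
  show ?thesis
    unfolding eq using tame_series_limit [OF tame sm]
    by (subst limitin_seminorm [OF tame_series(1) [OF tame sm]])
      (auto intro!: sum_closed jet_in_H \<gamma> \<delta>)
qed

end

section \<open>Eigenvalue curves on the unit circle\<close>

text \<open>By Picard's little theorem a non-constant entire function takes all values of the unit circle but
  at most one, so one of them is not a critical value.\<close>

lemma entire_unimodular_regular_value:
  assumes f: "f holomorphic_on UNIV" and nc: "f a \<noteq> f b"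
  obtains w where "cmod (f w) = 1" "deriv f w \<noteq> 0"
proof -
  have df: "deriv f holomorphic_on UNIV" by (rule holomorphic_deriv [OF f open_UNIV])
  have "\<not> (\<forall>w. deriv f w = 0)"
  proof
    assume z: "\<forall>w. deriv f w = 0"
    have "(f has_field_derivative 0) (at w)" for w
      using holomorphic_derivI [OF f open_UNIV UNIV_I, of w] z by simp
    then have "f constant_on UNIV"
      by (intro has_field_derivative_0_imp_constant_on) (auto simp: connected_UNIV)
    then show False using nc by (auto simp: constant_on_def)
  qed
  then have cnt: "countable {w. deriv f w = 0}"
    using holomorphic_countable_equal_UNIV [OF df holomorphic_on_const [of 0]] by metis
  have unc: "uncountable (sphere (0 :: complex) 1)"
    by (rule connected_uncountable [of _ 1 "-1"]) (simp_all add: connected_sphere)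
  have "countable (f ` {w. deriv f w = 0})" using cnt by simp
  then have unc': "uncountable (sphere 0 1 - f ` {w. deriv f w = 0})"
    using unc by (simp add: uncountable_minus_countable)
  then obtain \<alpha> where \<alpha>: "\<alpha> \<in> sphere 0 1 - f ` {w. deriv f w = 0}"
    by (metis countable_empty ex_in_conv)
  have "uncountable (sphere 0 1 - f ` {w. deriv f w = 0} - {\<alpha>})"
    using unc' by (simp add: uncountable_minus_countable)
  then obtain \<beta> where \<beta>: "\<beta> \<in> sphere 0 1 - f ` {w. deriv f w = 0} - {\<alpha>}"
    by (metis countable_empty ex_in_conv)
  have "range f \<inter> {\<alpha>, \<beta>} \<noteq> {}"
  proof
    assume "range f \<inter> {\<alpha>, \<beta>} = {}"
    then obtain c where "f = (\<lambda>x. c)" using little_Picard [OF f, of \<alpha> \<beta>] \<beta> by blast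
    then show False using nc by simp
  qed
  then obtain w where "f w \<in> {\<alpha>, \<beta>}" by blast
  then have w: "f w \<in> sphere 0 1 - f ` {w. deriv f w = 0}" using \<alpha> \<beta> by blast
  then have "deriv f w \<noteq> 0" by blast
  moreover have "cmod (f w) = 1" using w by simp
  ultimately show ?thesis using that by blast
qed

text \<open>At a regular point \<open>f\<close> has a holomorphic local inverse; composing it with
  the arc t |-> f(0) exp(it) gives the parameter as a function of the angle of the
  eigenvalue.\<close>

lemma eigenvalue_curve:
  assumes f: "f holomorphic_on UNIV" and nz: "deriv f 0 \<noteq> 0" "f 0 \<noteq> 0"
  obtains u d R where "0 < d" "d \<le> 1" "0 < R" "u holomorphic_on ball 0 d" "u 0 = 0"
    "\<And>t. t \<in> ball 0 d \<Longrightarrow> f (u t) = f 0 * exp (\<i> * t)" "\<And>t. t \<in> ball 0 d \<Longrightarrow> cmod (u t) \<le> R"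
    "\<And>t. 0 < t \<Longrightarrow> t < d \<Longrightarrow> u (of_real t) \<noteq> 0"
proof -
  obtain r where r: "r > 0" "open (f ` ball 0 r)" "inj_on f (ball 0 r)"
    by (rule has_complex_derivative_locally_invertible [OF f UNIV_I open_UNIV nz(1)])
  have fr: "f holomorphic_on ball 0 r" using f holomorphic_on_subset by blast
  obtain g where g: "g holomorphic_on f ` ball 0 r" "\<And>z. z \<in> ball 0 r \<Longrightarrow> g (f z) = z"
    using holomorphic_has_inverse [OF fr open_ball r(3)] by metis
  define e where "e t = f 0 * exp (\<i> * t)" for t :: complex
  have "open (e -` (f ` ball 0 r))"
    unfolding e_def [abs_def] using r(2) by (intro open_vimage continuous_intros)
  moreover have "0 \<in> e -` (f ` ball 0 r)" using r(1) by (auto simp: e_def)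
  ultimately obtain d0 where d0: "d0 > 0" "ball 0 d0 \<subseteq> e -` (f ` ball 0 r)"
    using openE by blast
  \<comment> \<open>Up to 1, which is less than pi, the sine is positive; hence exp(it) differs from
    1 and \<open>u\<close> does not vanish on the open interval.\<close>
  define d where "d = min d0 1"
  have d: "0 < d" "d \<le> 1" "ball 0 d \<subseteq> e -` (f ` ball 0 r)" using d0 by (auto simp: d_def)
  define u where "u = (\<lambda>t. g (e t))"
  have u: "f (u t) = e t" "u t \<in> ball 0 r" if t: "t \<in> ball 0 d" for t
  proof -
    obtain z where "z \<in> ball 0 r" "e t = f z" using d(3) t by blast
    then show "f (u t) = e t" "u t \<in> ball 0 r" using g(2) by (auto simp: u_def)
  qed
  have "u holomorphic_on ball 0 d"
    unfolding u_def
  proof (rule holomorphic_on_compose_gen [unfolded o_def, OF _ g(1)])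
    show "e holomorphic_on ball 0 d" unfolding e_def [abs_def] by (intro holomorphic_intros)
    show "e ` ball 0 d \<subseteq> f ` ball 0 r" using d(3) by blast
  qed
  moreover have "u 0 = 0" using g(2) [of 0] r(1) by (simp add: u_def e_def)
  moreover have "u (of_real t) \<noteq> 0" if t: "0 < t" "t < d" for t
  proof
    assume "u (of_real t) = 0"
    then have "exp (\<i> * of_real t) = 1"
      using u(1) [of "of_real t"] t nz(2) by (simp add: e_def)
    then have "Im (exp (\<i> * of_real t)) = 0" by simp
    then have "sin t = 0" by (simp add: Im_exp)
    moreover have "0 < sin t" using t d pi_gt3 by (intro sin_gt_zero) auto
    ultimately show False by simp
  qed
  ultimately show ?thesis
    using that [of d r u] d r(1) u by (auto simp: e_def less_imp_le)
qed

section \<open>Fourier coefficients of smooth bumps\<close>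

text \<open>A polynomial with double zeros at both ends: the boundary terms of two integrations by
  parts vanish, while products with holomorphic functions stay holomorphic, so Cauchy's inequality
  controls their derivatives.\<close>

definition bump :: "real \<Rightarrow> real \<Rightarrow> complex \<Rightarrow> complex" where
  "bump a b t = ((t - of_real a) * (t - of_real b))\<^sup>2"

text \<open>The \<open>n\<close>-th power of the eigenvalue with angle
  \<open>\<theta> + t\<close>.\<close>

definition osc :: "real \<Rightarrow> int \<Rightarrow> complex \<Rightarrow> complex" where
  "osc \<theta> n t = exp (\<i> * of_int n * (of_real \<theta> + t))"

lemma norm_osc: "cmod (osc \<theta> n (of_real t)) = 1"
proof -
  have "\<i> * of_int n * (of_real \<theta> + of_real t) = \<i> * of_real (of_int n * (\<theta> + t))" by simp
  then show ?thesis unfolding osc_def by (simp only: norm_exp_i_times)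
qed

lemma osc_deriv: "(osc \<theta> n has_field_derivative \<i> * of_int n * osc \<theta> n t) (at t)"
  unfolding osc_def by (auto intro!: derivative_eq_intros)

lemma bump_deriv_zero:
  assumes G: "G holomorphic_on S" "open S" "of_real a \<in> S" "of_real b \<in> S"
  shows "deriv (\<lambda>t. bump a b t * G t) (of_real a) = 0" "deriv (\<lambda>t. bump a b t * G t) (of_real b) = 0"
proof -
  have "((\<lambda>t. bump a b t * G t) has_field_derivative 0) (at c)" if "c = of_real a \<or> c = of_real b" for c
  proof -
    have "(G has_field_derivative deriv G c) (at c)"
      using that G holomorphic_derivI by blast
    then show ?thesis
      unfolding bump_def using that by (auto intro!: derivative_eq_intros)
  qed
  then show "deriv (\<lambda>t. bump a b t * G t) (of_real a) = 0" "deriv (\<lambda>t. bump a b t * G t) (of_real b) = 0"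
    by (auto intro: DERIV_imp_deriv)
qed

text \<open>Integration by parts twice; the boundary terms vanish because the bump vanishes to second order.\<close>

lemma bump_fourier_decay:
  assumes d: "0 < d" and ab: "- d / 2 < a" "a \<le> b" "b < d / 2"
  shows "\<exists>K\<ge>0. \<forall>G M n. G holomorphic_on ball 0 d \<longrightarrow> (\<forall>t\<in>ball 0 d. cmod (G t) \<le> M) \<longrightarrow>
    cmod (integral {a..b} (\<lambda>t. osc \<theta> n (of_real t) * (bump a b (of_real t) * G (of_real t))))
      \<le> K * M / (1 + (of_int n)\<^sup>2)"
proof -
  define B where "B = ((2 * d) * (2 * d))\<^sup>2"
  \<comment> \<open>Length of the interval times the bounds for the weighted function and for its
    second derivative, per unit bound on \<open>G\<close>. The final factor 2 comes from 1 / n^2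
    \<le> 2 / (1 + n^2) for nonzero n.\<close>
  define K where "K = (b - a) * (B + 2 * B / (d / 4)\<^sup>2) * 2"
  have B: "0 \<le> B" by (simp add: B_def)
  have K: "0 \<le> K" using ab B d by (simp add: K_def)
  have "cmod (integral {a..b} (\<lambda>t. osc \<theta> n (of_real t) * (bump a b (of_real t) * G (of_real t))))
      \<le> K * M / (1 + (of_int n)\<^sup>2)"
    if G: "G holomorphic_on ball 0 d" and GM: "\<And>t. t \<in> ball 0 d \<Longrightarrow> cmod (G t) \<le> M" for G M n
  proof -
    have M: "0 \<le> M" using GM [of 0] d norm_ge_zero order_trans by (metis centre_in_ball)
    define h where "h t = bump a b t * G t" for t
    have h: "h holomorphic_on ball 0 d"
      unfolding h_def [abs_def] bump_def by (intro holomorphic_intros G)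
    have hB: "cmod (h t) \<le> B * M" if t: "t \<in> ball 0 d" for t
    proof -
      have "cmod (t - of_real c) \<le> 2 * d" if "\<bar>c\<bar> \<le> d" for c
        using norm_triangle_ineq4 [of t "of_real c"] t that by simp
      then have "cmod (t - of_real a) \<le> 2 * d" "cmod (t - of_real b) \<le> 2 * d" using ab by auto
      then have "cmod (bump a b t) \<le> B"
        unfolding bump_def B_def norm_power norm_mult using d by (intro power_mono mult_mono) auto
      then show ?thesis unfolding h_def norm_mult using GM [OF t] B by (intro mult_mono) auto
    qed
    have h1: "deriv h holomorphic_on ball 0 d" by (rule holomorphic_deriv [OF h open_ball])
    have h2: "deriv (deriv h) holomorphic_on ball 0 d" by (rule holomorphic_deriv [OF h1 open_ball])
    have in_ball: "of_real t \<in> ball (0 :: complex) d" if "t \<in> {a..b}" for t using that ab by auto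
    \<comment> \<open>The interval stays within distance d / 2 of the origin, so discs of radius d /
      4 around its points remain in the domain and Cauchy's inequality bounds the second
      derivative.\<close>
    have h2B: "cmod (deriv (deriv h) (of_real t)) \<le> 2 * B / (d / 4)\<^sup>2 * M" if t: "t \<in> {a..b}" for t
    proof -
      have sub: "cball (of_real t :: complex) (d / 4) \<subseteq> ball 0 d"
      proof -
        have "\<bar>t\<bar> < d / 2" using t ab by auto
        then have "\<bar>t\<bar> + d / 4 < d" using d by linarith
        then show ?thesis by (simp add: cball_subset_ball_iff)
      qed
      have "cmod ((deriv ^^ 2) h (of_real t)) \<le> fact 2 * (B * M) / (d / 4) ^ 2"
      proof (rule Cauchy_inequality)
        show "h holomorphic_on ball (of_real t) (d / 4)"
          by (rule holomorphic_on_subset [OF h order_trans [OF ball_subset_cball sub]])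
        show "continuous_on (cball (of_real t) (d / 4)) h"
          by (rule holomorphic_on_imp_continuous_on [OF holomorphic_on_subset [OF h sub]])
        show "cmod (h x) \<le> B * M" if "cmod (of_real t - x) = d / 4" for x
        proof (rule hB)
          have "x \<in> cball (of_real t) (d / 4)" using that by (simp add: dist_norm)
          then show "x \<in> ball 0 d" using sub by blast
        qed
      qed (use d in simp)
      then show ?thesis by (simp add: numeral_2_eq_2)
    qed
    have cont: "continuous_on {a..b} (\<lambda>t. F (of_real t))" if "F holomorphic_on ball 0 d" for F
    proof -
      have "continuous_on (of_real ` {a..b}) F"
        by (rule continuous_on_subset [OF holomorphic_on_imp_continuous_on [OF that]])
          (use in_ball in auto)
      then show ?thesis
        by (rule continuous_on_compose2 [of _ F _ of_real]) (auto intro: continuous_on_of_real_id)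
    qed
    have osch: "osc \<theta> n holomorphic_on S" for S
      unfolding osc_def [abs_def] by (intro holomorphic_intros)
    have co: "continuous_on {a..b} (\<lambda>t. osc \<theta> n (of_real t) * F (of_real t))" if "F holomorphic_on ball 0 d" for F
      by (rule continuous_on_mult [OF cont [OF osch] cont [OF that]])
    have int0: "cmod (integral {a..b} (\<lambda>t. osc \<theta> n (of_real t) * F (of_real t))) \<le> L * (b - a)"
      if "F holomorphic_on ball 0 d" "\<And>t. t \<in> {a..b} \<Longrightarrow> cmod (F (of_real t)) \<le> L" for F L
      by (rule integral_bound [OF ab(2) co [OF that(1)]]) (simp add: norm_mult norm_osc that(2))
    have bound0: "cmod (integral {a..b} (\<lambda>t. osc \<theta> n (of_real t) * h (of_real t))) \<le> (B * M) * (b - a)"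
      by (rule int0 [OF h hB [OF in_ball]])
    have bound2: "cmod (integral {a..b} (\<lambda>t. osc \<theta> n (of_real t) * deriv (deriv h) (of_real t)))
        \<le> (2 * B / (d / 4)\<^sup>2 * M) * (b - a)"
      by (rule int0 [OF h2 h2B])
    define X where "X = (B * M) * (b - a)"
    define Y where "Y = (2 * B / (d / 4)\<^sup>2 * M) * (b - a)"
    have XY: "0 \<le> X" "0 \<le> Y" using B M ab d by (auto simp: X_def Y_def)
    have K_eq: "K * M = X * 2 + Y * 2"
      by (simp add: K_def X_def Y_def algebra_simps)
    show ?thesis
    proof (cases "n = 0")
      case True
      have "X \<le> K * M" using XY unfolding K_eq by linarith
      then show ?thesis using bound0 [folded X_def] True by (simp add: h_def)
    next
      case False
      \<comment> \<open>A primitive that performs both integrations by parts at once: in its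
        derivative the terms with the first derivative of \<open>h\<close> cancel.\<close>
      define W where "W t = osc \<theta> n t * (h t / (\<i> * of_int n) + deriv h t / (of_int n)\<^sup>2)" for t
      define W' where "W' t = osc \<theta> n t * h t + (1 / (of_int n)\<^sup>2) * (osc \<theta> n t * deriv (deriv h) t)" for t
      have W: "(W has_field_derivative W' t) (at t)" if "t \<in> ball 0 d" for t
      proof -
        have 1: "(h has_field_derivative deriv h t) (at t)"
          "(deriv h has_field_derivative deriv (deriv h) t) (at t)"
          using holomorphic_derivI [OF h open_ball that] holomorphic_derivI [OF h1 open_ball that] by auto
        have "(W has_field_derivative (osc \<theta> n t * (deriv h t / (\<i> * of_int n) + deriv (deriv h) t / (of_int n)\<^sup>2)
            + (\<i> * of_int n * osc \<theta> n t) * (h t / (\<i> * of_int n) + deriv h t / (of_int n)\<^sup>2))) (at t)"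
          unfolding W_def [abs_def] by (intro DERIV_mult' osc_deriv DERIV_add DERIV_cdivide 1)
        also have "(osc \<theta> n t * (deriv h t / (\<i> * of_int n) + deriv (deriv h) t / (of_int n)\<^sup>2)
            + (\<i> * of_int n * osc \<theta> n t) * (h t / (\<i> * of_int n) + deriv h t / (of_int n)\<^sup>2)) = W' t"
        proof -
          have gen: "x * (y + s) + (N * x) * (r + q) = x * c + (x * s :: complex)"
            if "y + N * q = 0" "N * r = c" for x y s N r q c
          proof -
            have "x * (y + s) + (N * x) * (r + q) = x * (y + N * q) + x * (N * r) + x * s"
              by (simp add: algebra_simps)
            then show ?thesis using that by simp
          qed
          have "deriv h t / (\<i> * of_int n) + (\<i> * of_int n) * (deriv h t / (of_int n)\<^sup>2) = 0"
            using False by (simp add: field_simps power2_eq_square)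
          moreover have "(\<i> * of_int n) * (h t / (\<i> * of_int n)) = h t" using False by simp
          ultimately show ?thesis
            using gen [of "deriv h t / (\<i> * of_int n)" "\<i> * of_int n" "deriv h t / (of_int n)\<^sup>2"]
            by (simp add: W'_def)
        qed
        finally show ?thesis .
      qed
      have "((\<lambda>t. W' (of_real t)) has_integral (W (of_real b) - W (of_real a))) {a..b}"
        by (rule fundamental_theorem_of_calculus
            [OF ab(2) has_vector_derivative_real_field [OF W [OF in_ball]]])
      moreover have "W (of_real a) = 0" "W (of_real b) = 0"
      proof -
        have hf: "h = (\<lambda>t. bump a b t * G t)" by (simp add: h_def fun_eq_iff)
        have mem: "of_real a \<in> ball (0 :: complex) d" "of_real b \<in> ball (0 :: complex) d"
          using in_ball ab(2) by simp_all
        have "deriv h (of_real a) = 0" "deriv h (of_real b) = 0"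
          unfolding hf using bump_deriv_zero [OF G open_ball mem] by simp_all
        moreover have "h (of_real a) = 0" "h (of_real b) = 0" by (simp_all add: h_def bump_def)
        ultimately show "W (of_real a) = 0" "W (of_real b) = 0" by (simp_all add: W_def)
      qed
      ultimately have zero: "integral {a..b} (\<lambda>t. W' (of_real t)) = 0"
        by (simp add: integral_unique)
      have "integral {a..b} (\<lambda>t. W' (of_real t)) = integral {a..b} (\<lambda>t. osc \<theta> n (of_real t) * h (of_real t))
          + (1 / (of_int n)\<^sup>2) * integral {a..b} (\<lambda>t. osc \<theta> n (of_real t) * deriv (deriv h) (of_real t))"
        unfolding W'_def integral_mult_right [symmetric]
        by (rule integral_add [OF integrable_continuous_real [OF co [OF h]]
              integrable_continuous_real [OF continuous_on_mult_left [OF co [OF h2]]]])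
      then have "integral {a..b} (\<lambda>t. osc \<theta> n (of_real t) * h (of_real t))
          = - ((1 / (of_int n)\<^sup>2) * integral {a..b} (\<lambda>t. osc \<theta> n (of_real t) * deriv (deriv h) (of_real t)))"
        unfolding zero by (metis add_eq_0_iff2)
      then have "cmod (integral {a..b} (\<lambda>t. osc \<theta> n (of_real t) * h (of_real t)))
          = (1 / (of_int n)\<^sup>2) * cmod (integral {a..b} (\<lambda>t. osc \<theta> n (of_real t) * deriv (deriv h) (of_real t)))"
        by (simp only: norm_minus_cancel norm_mult) (simp add: norm_divide norm_power)
      also have "\<dots> \<le> (1 / (of_int n)\<^sup>2) * (K * M / 2)"
      proof (rule mult_left_mono)
        show "cmod (integral {a..b} (\<lambda>t. osc \<theta> n (of_real t) * deriv (deriv h) (of_real t))) \<le> K * M / 2"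
          using bound2 [folded Y_def] XY unfolding K_eq by argo
      qed simp
      also have "\<dots> \<le> K * M / (1 + (of_int n)\<^sup>2)"
      proof -
        have "1 \<le> n\<^sup>2" using False by (simp add: int_one_le_iff_zero_less)
        then have "1 \<le> (of_int n :: real)\<^sup>2" by (metis of_int_1_le_iff of_int_power)
        then have "1 / (2 * (of_int n)\<^sup>2) \<le> 1 / (1 + (of_int n :: real)\<^sup>2)" by (simp add: frac_le)
        then have "(K * M) * (1 / (2 * (of_int n)\<^sup>2)) \<le> (K * M) * (1 / (1 + (of_int n :: real)\<^sup>2))"
          using K M by (intro mult_left_mono) auto
        then show ?thesis by simp
      qed
      finally show ?thesis by (simp add: h_def)
    qed
  qed
  then show ?thesis using K by blast
qed

text \<open>The power series converges uniformly on the compact image of \<open>u\<close>, so sum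
  and integral may be exchanged. This scalar statement does the work of a vector-valued integral
  along the curve of eigenvectors.\<close>

lemma moment_sums:
  fixes g :: "complex \<Rightarrow> complex" and q :: "nat \<Rightarrow> complex" and a b :: real
  assumes g: "\<And>w. (\<lambda>j. q j * w ^ j) sums g w"
    and \<rho>: "continuous_on {a..b} \<rho>" and u: "continuous_on {a..b} u"
  shows "(\<lambda>j. q j * integral {a..b} (\<lambda>t. \<rho> t * u t ^ j)) sums integral {a..b} (\<lambda>t. \<rho> t * g (u t))"
proof -
  have "compact (u ` {a..b})" by (rule compact_continuous_image [OF u]) simp
  then obtain r where r: "\<And>t. t \<in> {a..b} \<Longrightarrow> cmod (u t) \<le> r"
    using compact_imp_bounded bounded_iff by (metis imageI)
  have "compact (\<rho> ` {a..b})" by (rule compact_continuous_image [OF \<rho>]) simp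
  then have b\<rho>: "bounded (\<rho> ` {a..b})" by (rule compact_imp_bounded)
  have "conv_radius q = \<infinity>"
    by (rule conv_radius_inftyI'') (use g sums_summable in blast)
  then have "uniform_limit (cball 0 r) (\<lambda>N w. \<Sum>j<N. q j * (w - 0) ^ j) (\<lambda>w. \<Sum>j. q j * (w - 0) ^ j) sequentially"
    by (intro powser_uniform_limit) simp
  then have ul: "uniform_limit (cball 0 r) (\<lambda>N w. \<Sum>j<N. q j * w ^ j) g sequentially"
    using g by (simp add: sums_iff)
  have ul': "uniform_limit {a..b} (\<lambda>N t. \<Sum>j<N. q j * u t ^ j) (\<lambda>t. g (u t)) sequentially"
  proof (rule uniform_limitI)
    fix e :: real assume "e > 0"
    from uniform_limitD [OF ul this]
    show "\<forall>\<^sub>F N in sequentially. \<forall>t\<in>{a..b}. dist (\<Sum>j<N. q j * u t ^ j) (g (u t)) < e"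
      by eventually_elim (use r in auto)
  qed
  have cN: "continuous_on {a..b} (\<lambda>t. \<Sum>j<N. q j * u t ^ j)" for N
    by (intro continuous_intros u)
  have cg: "continuous_on {a..b} (\<lambda>t. g (u t))"
    by (rule uniform_limit_theorem [OF _ ul']) (use cN in auto)
  then have bg: "bounded ((\<lambda>t. g (u t)) ` {a..b})"
    by (intro compact_imp_bounded compact_continuous_image) auto
  have "uniform_limit {a..b} (\<lambda>N t. \<rho> t * (\<Sum>j<N. q j * u t ^ j)) (\<lambda>t. \<rho> t * g (u t)) sequentially"
    by (rule uniform_lim_mult [OF uniform_limit_const ul' b\<rho> bg])
  then obtain I J where IJ: "\<And>N. ((\<lambda>t. \<rho> t * (\<Sum>j<N. q j * u t ^ j)) has_integral I N) {a..b}"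
    "((\<lambda>t. \<rho> t * g (u t)) has_integral J) {a..b}" "(I \<longlongrightarrow> J) sequentially"
    by (rule uniform_limit_integral) (auto intro!: continuous_on_mult \<rho> cN)
  have cj: "continuous_on {a..b} (\<lambda>t. \<rho> t * u t ^ j)" for j
    by (intro continuous_intros \<rho> u)
  have "I N = (\<Sum>j<N. q j * integral {a..b} (\<lambda>t. \<rho> t * u t ^ j))" for N
  proof -
    have "((\<lambda>t. \<Sum>j<N. q j * (\<rho> t * u t ^ j)) has_integral (\<Sum>j<N. q j * integral {a..b} (\<lambda>t. \<rho> t * u t ^ j))) {a..b}"
      by (intro has_integral_sum has_integral_mult_right integrable_integral integrable_continuous_real cj) auto
    moreover have "(\<lambda>t. \<Sum>j<N. q j * (\<rho> t * u t ^ j)) = (\<lambda>t. \<rho> t * (\<Sum>j<N. q j * u t ^ j))"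
      by (simp add: sum_distrib_left mult.left_commute)
    ultimately have "((\<lambda>t. \<rho> t * (\<Sum>j<N. q j * u t ^ j)) has_integral (\<Sum>j<N. q j * integral {a..b} (\<lambda>t. \<rho> t * u t ^ j))) {a..b}"
      by (simp only:)
    then show ?thesis by (rule has_integral_unique [OF IJ(1)])
  qed
  then have "I = (\<lambda>N. \<Sum>j<N. q j * integral {a..b} (\<lambda>t. \<rho> t * u t ^ j))" by blast
  then show ?thesis
    using IJ(3) unfolding sums_def integral_unique [OF IJ(2)] by simp
qed

section \<open>Closed subspaces\<close>

context seminormed_functions
begin

definition closure_in :: "('a \<Rightarrow> complex) set \<Rightarrow> ('a \<Rightarrow> complex) set" where
  "closure_in V = {f \<in> X. \<forall>s>0. \<forall>\<epsilon>>0. \<exists>g\<in>V. p s (\<lambda>x. f x - g x) < \<epsilon>}"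

definition subspace_in :: "('a \<Rightarrow> complex) set \<Rightarrow> bool" where
  "subspace_in V \<longleftrightarrow> V \<subseteq> X \<and> V \<noteq> {} \<and> (\<forall>f\<in>V. \<forall>g\<in>V. \<forall>a b. (\<lambda>x. a * f x + b * g x) \<in> V)"

lemma subspace_lin: "subspace_in V \<Longrightarrow> f \<in> V \<Longrightarrow> g \<in> V \<Longrightarrow> (\<lambda>x. a * f x + b * g x) \<in> V"
  unfolding subspace_in_def by blast

lemma subspace_scale: "subspace_in V \<Longrightarrow> f \<in> V \<Longrightarrow> (\<lambda>x. a * f x) \<in> V"
  using subspace_lin [of V f f a 0] by simp

lemma subspace_sum:
  assumes V: "subspace_in V" and f: "\<And>i. i \<in> I \<Longrightarrow> f i \<in> V"
  shows "(\<lambda>x. \<Sum>i\<in>I. c i * f i x) \<in> V"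
proof -
  obtain h where "h \<in> V" using V by (auto simp: subspace_in_def)
  then have z: "(\<lambda>x. 0) \<in> V" using subspace_scale [OF V, of h 0] by simp
  show ?thesis
    using f
  proof (induction I rule: infinite_finite_induct)
    case (insert i I)
    then show ?case
      using subspace_lin [OF V, of "f i" "\<lambda>x. \<Sum>i\<in>I. c i * f i x" "c i" 1] by simp
  qed (simp_all add: z)
qed

lemma closure_in_subset: "V \<subseteq> X \<Longrightarrow> V \<subseteq> closure_in V"
proof
  fix f assume V: "V \<subseteq> X" and f: "f \<in> V"
  have "p s (\<lambda>x. f x - f x) < \<epsilon>" if "0 < s" "0 < \<epsilon>" for s \<epsilon>
    using p_zero [OF that(1)] that(2) by simp
  then show "f \<in> closure_in V" using V f unfolding closure_in_def by blast
qed

lemma closure_in_lin: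
  assumes V: "subspace_in V" and f: "f \<in> closure_in V" and g: "g \<in> closure_in V"
  shows "(\<lambda>x. a * f x + b * g x) \<in> closure_in V"
  unfolding closure_in_def
proof (intro CollectI conjI allI impI)
  have fX: "f \<in> X" "g \<in> X" using f g by (auto simp: closure_in_def)
  then show "(\<lambda>x. a * f x + b * g x) \<in> X" by (rule lin_closed)
  fix s \<epsilon> :: real assume s: "0 < s" and \<epsilon>: "0 < \<epsilon>"
  define r where "r = \<epsilon> / (cmod a + cmod b + 1)"
  have r: "0 < r" using \<epsilon> by (simp add: r_def add_nonneg_pos)
  obtain f' where f': "f' \<in> V" "p s (\<lambda>x. f x - f' x) < r"
    using f s r unfolding closure_in_def by blast
  obtain g' where g': "g' \<in> V" "p s (\<lambda>x. g x - g' x) < r"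
    using g s r unfolding closure_in_def by blast
  have VX: "f' \<in> X" "g' \<in> X" using V f' g' by (auto simp: subspace_in_def)
  have "p s (\<lambda>x. (a * f x + b * g x) - (a * f' x + b * g' x))
      = p s (\<lambda>x. a * (f x - f' x) + b * (g x - g' x))" by (simp add: algebra_simps)
  also have "\<dots> \<le> cmod a * p s (\<lambda>x. f x - f' x) + cmod b * p s (\<lambda>x. g x - g' x)"
    by (rule p_lin [OF s diff_closed [OF fX(1) VX(1)] diff_closed [OF fX(2) VX(2)]])
  also have "\<dots> \<le> cmod a * r + cmod b * r"
    using f' g' by (intro add_mono mult_left_mono) auto
  also have "\<dots> < (cmod a + cmod b + 1) * r" using r by (simp add: algebra_simps)
  also have "\<dots> = \<epsilon>" by (simp add: r_def add_nonneg_eq_0_iff add_nonneg_pos less_imp_neq [symmetric])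
  finally show "\<exists>h\<in>V. p s (\<lambda>x. (a * f x + b * g x) - h x) < \<epsilon>"
    by (rule bexI [OF _ subspace_lin [OF V f'(1) g'(1), of a b]])
qed

lemma subspace_closure_in: "subspace_in V \<Longrightarrow> subspace_in (closure_in V)"
  using closure_in_lin closure_in_subset [of V] unfolding subspace_in_def [of "closure_in V"]
  by (auto simp: closure_in_def subspace_in_def)

lemma closure_in_idem:
  assumes V: "V \<subseteq> X"
  shows "closure_in (closure_in V) = closure_in V"
proof
  show "closure_in V \<subseteq> closure_in (closure_in V)"
    by (rule closure_in_subset) (auto simp: closure_in_def)
  show "closure_in (closure_in V) \<subseteq> closure_in V"
  proof
    fix f assume f: "f \<in> closure_in (closure_in V)"
    then have fX: "f \<in> X" by (simp add: closure_in_def)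
    have "\<exists>h\<in>V. p s (\<lambda>x. f x - h x) < \<epsilon>" if s: "0 < s" and \<epsilon>: "0 < \<epsilon>" for s \<epsilon>
    proof -
      have e2: "0 < \<epsilon> / 2" using \<epsilon> by simp
      obtain g where g: "g \<in> closure_in V" "p s (\<lambda>x. f x - g x) < \<epsilon> / 2"
        using f s e2 unfolding closure_in_def [of "closure_in V"] by blast
      then obtain h where h: "h \<in> V" "p s (\<lambda>x. g x - h x) < \<epsilon> / 2"
        using s e2 unfolding closure_in_def by blast
      have "g \<in> X" "h \<in> X" using g h V by (auto simp: closure_in_def)
      then have "p s (\<lambda>x. f x - h x) < \<epsilon>"
        using p_triangle [OF s fX, of g h] g h by simp
      then show ?thesis using h by blast
    qed
    then show "f \<in> closure_in V" using fX by (simp add: closure_in_def)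
  qed
qed

text \<open>Integer scales dominate all seminorms, so approximating at scale N + 1 up to 1 / (N + 1)
  produces a sequence that converges in every seminorm.\<close>

lemma closure_in_sequence:
  assumes f: "f \<in> closure_in V" and V: "V \<subseteq> X"
  obtains F where "\<And>N :: nat. F N \<in> V" "limitin \<T> F f sequentially"
proof -
  have fX: "f \<in> X" using f by (simp add: closure_in_def)
  have "\<forall>N :: nat. \<exists>g\<in>V. p (Suc N) (\<lambda>x. f x - g x) < 1 / Suc N"
    using f unfolding closure_in_def by simp
  then obtain F where F: "\<And>N. F N \<in> V" "\<And>N. p (Suc N) (\<lambda>x. f x - F N x) < 1 / Suc N"
    by metis
  have FX: "F N \<in> X" for N using F V by blast
  have "(\<lambda>N. p s (\<lambda>x. F N x - f x)) \<longlonglongrightarrow> 0" if s: "0 < s" for s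
  proof (rule Lim_null_comparison [OF _ LIMSEQ_Suc [OF lim_1_over_n]])
    obtain m :: nat where m: "s \<le> m" using real_arch_simple by blast
    show "eventually (\<lambda>N. norm (p s (\<lambda>x. F N x - f x)) \<le> 1 / real (Suc N)) sequentially"
      using eventually_ge_at_top [of m]
    proof eventually_elim
      case (elim N)
      have "p s (\<lambda>x. F N x - f x) = p s (\<lambda>x. f x - F N x)" by (rule p_swap [OF s FX fX])
      also have "\<dots> \<le> p (Suc N) (\<lambda>x. f x - F N x)"
        using elim m by (intro p_mono s diff_closed fX FX) auto
      finally show ?case
        using F(2) [of N] p_nonneg [OF s diff_closed [OF FX fX, of N]] by (simp del: of_nat_Suc)
    qed
  qed
  then have "limitin \<T> F f sequentially"
    using limitin_seminorm [OF fX, of F] FX by blast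
  then show ?thesis using that F(1) by blast
qed

lemma limitin_closure_in:
  assumes "limitin \<T> F f sequentially" "\<And>N. F N \<in> V" "V \<subseteq> X"
  shows "f \<in> closure_in V"
proof -
  have fX: "f \<in> X" using limitin_topspace [OF assms(1)] by simp
  have FX: "F N \<in> X" for N using assms by blast
  have lim: "(\<lambda>N. p s (\<lambda>x. F N x - f x)) \<longlonglongrightarrow> 0" if "0 < s" for s
    using assms(1) limitin_seminorm [OF fX, of F] FX that by blast
  have "\<exists>g\<in>V. p s (\<lambda>x. f x - g x) < \<epsilon>" if s: "0 < s" and \<epsilon>: "0 < \<epsilon>" for s \<epsilon>
  proof -
    have "eventually (\<lambda>N. p s (\<lambda>x. F N x - f x) < \<epsilon>) sequentially"
      using order_tendstoD(2) [OF lim [OF s] \<epsilon>] .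
    then obtain N where "p s (\<lambda>x. F N x - f x) < \<epsilon>" using eventually_happens by fastforce
    then show ?thesis using p_swap [OF s FX fX, of N] assms(2) by metis
  qed
  then show ?thesis using fX by (simp add: closure_in_def)
qed

end

section \<open>Density of exponentials\<close>

context poly_ideals
begin

lemma expfun_lin:
  assumes "exp_type K R c" "exp_type K' R' c'"
  shows "expfun \<gamma> \<delta> (\<lambda>j. a * c j + b * c' j) y = a * expfun \<gamma> \<delta> c y + b * expfun \<gamma> \<delta> c' y"
proof -
  have "(\<lambda>j. a * (c j * t ^ j / fact j) + b * (c' j * t ^ j / fact j)) sums (a * egf c t + b * egf c' t)" for t
    by (intro sums_add sums_mult egf_sums [OF assms(1)] egf_sums [OF assms(2)])
  then have "egf (\<lambda>j. a * c j + b * c' j) t = a * egf c t + b * egf c' t" for t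
    by (simp add: egf_def [of "\<lambda>j. a * c j + b * c' j"] sums_iff add_divide_distrib distrib_right mult.assoc)
  then show ?thesis by (simp add: expfun_def zero_off_def algebra_simps)
qed

lemma expfun_seminorm_le:
  assumes "\<gamma> \<in> dual" "\<delta> \<in> dual" "exp_type K R c" "0 < s"
  shows "p s (expfun \<gamma> \<delta> c) \<le> 2 * K * exp ((dnorm \<gamma> + 2 * R * dnorm \<delta>) * s)"
  by (rule tame_HbA(2) [OF expfun_tame]) (use assms in auto)

text \<open>The jets are iterated difference quotients of the curve of exponentials.\<close>

lemma jets_in_closure:
  assumes \<gamma>: "\<gamma> \<in> dual" and \<delta>: "\<delta> \<in> dual" and V: "subspace_in V"
    and w: "\<And>q :: nat. w q \<noteq> 0" "w \<longlonglongrightarrow> 0" and e: "\<And>q. expo (\<lambda>y. \<gamma> y + w q * \<delta> y) \<in> closure_in V"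
  shows "jet \<gamma> \<delta> j \<in> closure_in V"
proof (induction j rule: less_induct)
  case (less j)
  have VX: "V \<subseteq> H" using V by (simp add: subspace_in_def)
  note cV = subspace_closure_in [OF V]
  \<comment> \<open>The coefficients of the \<open>j\<close>-th difference quotient minus its limit:
    the exponential series from order j + 1 on, divided by w^j. For |w| at most 1 they have type 1
    with constant |w|, which tends to 0.\<close>
  define c where "c q i = (if i \<le> j then 0 else w q ^ (i - j))" for q i
  have ct: "exp_type (cmod (w q)) 1 (c q)" if "cmod (w q) \<le> 1" for q
  proof -
    have "cmod (w q) ^ (i - j) \<le> cmod (w q) ^ 1" if "\<not> i \<le> j" for i
      using that \<open>cmod (w q) \<le> 1\<close> by (intro power_decreasing) auto
    then show ?thesis by (simp add: exp_type_def c_def norm_power)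
  qed
  define F where "F q = (\<lambda>y. (1 / w q ^ j) * (1 * expo (\<lambda>y. \<gamma> y + w q * \<delta> y) y
      + (-1) * (\<Sum>i<j. w q ^ i * jet \<gamma> \<delta> i y)))" for q
  have F: "F q \<in> closure_in V" for q
    unfolding F_def by (intro subspace_scale [OF cV] subspace_lin [OF cV] e subspace_sum [OF cV] less.IH) simp
  have Fc: "F q y - jet \<gamma> \<delta> j y = expfun \<gamma> \<delta> (c q) y" if q: "cmod (w q) \<le> 1" for q y
  proof (cases "y \<in> vcarrier E")
    case True
    let ?t = "\<delta> y"
    have "(\<lambda>i. w q ^ j * (c q i * ?t ^ i / fact i)) sums (w q ^ j * egf (c q) ?t)"
      by (rule sums_mult [OF egf_sums [OF ct [OF q]]])
    moreover have "(\<lambda>i. w q ^ i * ?t ^ i / fact i - (if i \<in> {..j} then w q ^ i * ?t ^ i / fact i else 0))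
        sums (exp (w q * ?t) - (\<Sum>i\<in>{..j}. w q ^ i * ?t ^ i / fact i))"
    proof (intro sums_diff sums_If_finite_set)
      show "(\<lambda>i. w q ^ i * ?t ^ i / fact i) sums exp (w q * ?t)"
        using egf_sums [OF exp_type_power [of "w q"], of ?t] by (simp add: egf_power)
    qed simp
    moreover have "w q ^ j * (c q i * ?t ^ i / fact i)
        = w q ^ i * ?t ^ i / fact i - (if i \<in> {..j} then w q ^ i * ?t ^ i / fact i else 0)" for i
      by (simp add: c_def power_add [symmetric])
    ultimately have "w q ^ j * egf (c q) ?t = exp (w q * ?t) - (\<Sum>i\<in>{..j}. w q ^ i * ?t ^ i / fact i)"
      by (simp add: sums_unique2)
    then have "egf (c q) ?t = (1 / w q ^ j) * (exp (w q * ?t) - (\<Sum>i<j. w q ^ i * ?t ^ i / fact i)) - ?t ^ j / fact j"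
      using w(1) [of q] by (simp add: lessThan_Suc_atMost [symmetric] field_simps)
    moreover have "F q y - jet \<gamma> \<delta> j y = exp (\<gamma> y) * ((1 / w q ^ j) * (exp (w q * ?t) - (\<Sum>i<j. w q ^ i * ?t ^ i / fact i)) - ?t ^ j / fact j)"
    proof -
      have S: "(\<Sum>i<j. w q ^ i * jet \<gamma> \<delta> i y) = exp (\<gamma> y) * (\<Sum>i<j. w q ^ i * ?t ^ i / fact i)"
        using True by (simp add: jet_apply sum_distrib_left mult_ac)
      have "F q y = (1 / w q ^ j) * (exp (\<gamma> y) * exp (w q * ?t) - exp (\<gamma> y) * (\<Sum>i<j. w q ^ i * ?t ^ i / fact i))"
        using True unfolding F_def S by (simp add: expo_def zero_off_def exp_add)
      then show ?thesis using True by (simp only: jet_apply right_diff_distrib mult.left_commute)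
    qed
    ultimately show ?thesis using True by (simp add: expfun_def zero_off_def)
  next
    case False
    then show ?thesis by (simp add: F_def expfun_def expo_def zero_off_def)
  qed
  have jH: "jet \<gamma> \<delta> j \<in> H" by (rule jet_in_H [OF \<gamma> \<delta>])
  have FH: "F q \<in> H" for q using F by (simp add: closure_in_def)
  have "(\<lambda>q. p s (\<lambda>y. F q y - jet \<gamma> \<delta> j y)) \<longlonglongrightarrow> 0" if s: "0 < s" for s
  proof (rule Lim_null_comparison)
    have w0: "(\<lambda>q. cmod (w q)) \<longlonglongrightarrow> 0" using tendsto_norm [OF w(2)] by simp
    then have "eventually (\<lambda>q. cmod (w q) < 1) sequentially" by (rule order_tendstoD) simp
    then show "eventually (\<lambda>q. norm (p s (\<lambda>y. F q y - jet \<gamma> \<delta> j y))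
        \<le> cmod (w q) * (2 * exp ((dnorm \<gamma> + 2 * 1 * dnorm \<delta>) * s))) sequentially"
    proof eventually_elim
      case (elim q)
      then have q: "cmod (w q) \<le> 1" by simp
      have "(\<lambda>y. F q y - jet \<gamma> \<delta> j y) = expfun \<gamma> \<delta> (c q)" using Fc [OF q] by blast
      then show ?case
        using expfun_seminorm_le [OF \<gamma> \<delta> ct [OF q] s] p_nonneg [OF s expfun_in_H [OF \<gamma> \<delta> ct [OF q]]]
        by (simp add: mult_ac)
    qed
    show "(\<lambda>q. cmod (w q) * (2 * exp ((dnorm \<gamma> + 2 * 1 * dnorm \<delta>) * s))) \<longlonglongrightarrow> 0"
      by (rule tendsto_mult_left_zero [OF w0])
  qed
  then have "limitin \<T> F (jet \<gamma> \<delta> j) sequentially"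
    using limitin_seminorm [OF jH, of F] FH by blast
  then have "jet \<gamma> \<delta> j \<in> closure_in (closure_in V)"
    by (rule limitin_closure_in [OF _ F]) (auto simp: closure_in_def)
  then show ?case by (simp add: closure_in_idem [OF VX])
qed

text \<open>The expansion in jets converges for every parameter, so the jets at one point recover
  the exponentials on the whole complex line.\<close>

lemma expo_in_closure:
  assumes \<gamma>: "\<gamma> \<in> dual" and \<delta>: "\<delta> \<in> dual" and V: "subspace_in V"
    and jets: "\<And>j. jet \<gamma> \<delta> j \<in> closure_in V"
  shows "expo (\<lambda>y. \<gamma> y + w * \<delta> y) \<in> closure_in V"
proof -
  have VX: "V \<subseteq> H" using V by (simp add: subspace_in_def)
  have "limitin \<T> (\<lambda>N y. \<Sum>j<N. w ^ j * jet \<gamma> \<delta> j y) (expo (\<lambda>y. \<gamma> y + w * \<delta> y)) sequentially"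
    using expfun_series [OF \<gamma> \<delta> exp_type_power [of w]] by (simp only: expfun_power)
  then have "expo (\<lambda>y. \<gamma> y + w * \<delta> y) \<in> closure_in (closure_in V)"
  proof (rule limitin_closure_in)
    show "(\<lambda>y. \<Sum>j<N. w ^ j * jet \<gamma> \<delta> j y) \<in> closure_in V" for N
      by (rule subspace_sum [OF subspace_closure_in [OF V]]) (rule jets)
    show "closure_in V \<subseteq> H" by (auto simp: closure_in_def)
  qed
  then show ?thesis by (simp add: closure_in_idem [OF VX])
qed

text \<open>The difference is an \<open>expfun\<close> with coefficients 0, -1, -1, and so on. These
  have constant 1 / R at any radius R \<ge> 1, and for functionals of norm below 1 / R the
  exponential factor of the estimate stays bounded.\<close>

lemma expo_continuous:
  assumes \<gamma>: "\<gamma> \<in> dual" and s: "0 < s" and \<epsilon>: "0 < \<epsilon>"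
  obtains \<eta> where "0 < \<eta>" "\<And>\<delta>. \<delta> \<in> dual \<Longrightarrow> dnorm \<delta> < \<eta> \<Longrightarrow> p s (\<lambda>y. expo \<gamma> y - expo (\<lambda>y. \<gamma> y + \<delta> y) y) < \<epsilon>"
proof -
  define L where "L = 2 * exp ((dnorm \<gamma> + 2) * s)"
  have L: "0 < L" by (simp add: L_def)
  define R where "R = max 1 (2 * L / \<epsilon>)"
  have R: "1 \<le> R" "L / R < \<epsilon>"
  proof -
    show 1: "1 \<le> R" by (simp add: R_def)
    have "2 * L / \<epsilon> \<le> R" by (simp add: R_def)
    then have "2 * L \<le> R * \<epsilon>" using \<epsilon> by (simp add: divide_le_eq)
    then have "L < R * \<epsilon>" using L by linarith
    then show "L / R < \<epsilon>" using 1 by (simp add: divide_less_eq mult.commute)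
  qed
  have "p s (\<lambda>y. expo \<gamma> y - expo (\<lambda>y. \<gamma> y + \<delta> y) y) < \<epsilon>" if \<delta>: "\<delta> \<in> dual" and small: "dnorm \<delta> < 1 / R" for \<delta>
  proof -
    define c where "c = (\<lambda>i :: nat. if i = 0 then 0 else - 1 :: complex)"
    have c: "exp_type (1 / R) R c"
    proof -
      have "1 / R * R ^ i \<ge> 1" if "i \<noteq> 0" for i
      proof -
        have "R ^ 1 \<le> R ^ i" using R that by (intro power_increasing) auto
        then show ?thesis using R by (simp add: divide_le_eq le_divide_eq)
      qed
      then show ?thesis using R by (auto simp: exp_type_def c_def)
    qed
    have c_eq: "c = (\<lambda>i. 1 * (if i = 0 then 1 else 0) + (-1) * 1 ^ i)" by (auto simp: c_def)
    have "expfun \<gamma> \<delta> c y = 1 * jet \<gamma> \<delta> 0 y + (-1) * expfun \<gamma> \<delta> (\<lambda>i. 1 ^ i) y" for y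
      unfolding c_eq by (rule expfun_lin [OF exp_type_delta [OF zero_less_one] exp_type_power])
    moreover have "expfun \<gamma> \<delta> (\<lambda>i. 1 ^ i) = expo (\<lambda>y. \<gamma> y + \<delta> y)"
      using expfun_power [of \<gamma> \<delta> 1] by (simp only: mult_1)
    moreover have "jet \<gamma> \<delta> 0 y = expo \<gamma> y" for y
      by (cases "y \<in> vcarrier E") (simp_all add: jet_apply, simp_all add: expfun_def expo_def zero_off_def)
    ultimately have "(\<lambda>y. expo \<gamma> y - expo (\<lambda>y. \<gamma> y + \<delta> y) y) = expfun \<gamma> \<delta> c"
      by (auto simp: fun_eq_iff)
    then have "p s (\<lambda>y. expo \<gamma> y - expo (\<lambda>y. \<gamma> y + \<delta> y) y) \<le> 2 * (1 / R) * exp ((dnorm \<gamma> + 2 * R * dnorm \<delta>) * s)"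
      using expfun_seminorm_le [OF \<gamma> \<delta> c s] by simp
    also have "\<dots> \<le> 2 * (1 / R) * exp ((dnorm \<gamma> + 2) * s)"
    proof -
      have "R * dnorm \<delta> \<le> 1" using small R by (simp add: field_simps)
      then show ?thesis using R s by (intro mult_left_mono) (auto intro!: mult_right_mono)
    qed
    also have "\<dots> = L / R" by (simp add: L_def)
    finally show ?thesis using R by simp
  qed
  then show ?thesis using that [of "1 / R"] R by simp
qed

text \<open>The power of a functional is k! times its jet at the zero functional, so difference
  quotients of exponentials reach all finite type polynomials. These approximate the first Taylor
  terms of \<open>f\<close>, and the remaining terms have small total seminorm.\<close>

lemma exponentials_dense:
  assumes ft: "\<And>k. norm_topology (function_space (A k E) (n k E)) closure_of finite_type E k = A k E"
    and V: "subspace_in V" and e: "\<And>\<gamma>. \<gamma> \<in> dual \<Longrightarrow> expo \<gamma> \<in> closure_in V"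
  shows "closure_in V = H"
proof -
  have VX: "V \<subseteq> H" using V by (simp add: subspace_in_def)
  note cV = subspace_closure_in [OF V]
  have power: "zero_off E (\<lambda>y. \<gamma> y ^ k) \<in> closure_in V" if \<gamma>: "\<gamma> \<in> dual" for \<gamma> k
  proof -
    have "jet (\<lambda>y. 0) \<gamma> k \<in> closure_in V"
    proof (rule jets_in_closure [OF dual_zero \<gamma> V])
      show "(\<lambda>q. 1 / of_nat (Suc q)) \<longlonglongrightarrow> (0 :: complex)"
        by (rule LIMSEQ_Suc [OF lim_1_over_n])
      show "1 / of_nat (Suc q) \<noteq> (0 :: complex)" for q by (simp del: of_nat_Suc)
      show "expo (\<lambda>y. 0 + 1 / of_nat (Suc q) * \<gamma> y) \<in> closure_in V" for q
        using e dual_lin(1) [OF \<gamma> \<gamma>, of "1 / of_nat (Suc q)" 0] by simp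
    qed
    then have "(\<lambda>y. fact k * jet (\<lambda>y. 0) \<gamma> k y) \<in> closure_in V" by (rule subspace_scale [OF cV])
    moreover have "fact k * jet (\<lambda>y. 0) \<gamma> k y = zero_off E (\<lambda>y. \<gamma> y ^ k) y" for y
      by (cases "y \<in> vcarrier E") (simp add: jet_apply zero_off_def, simp add: expfun_def zero_off_def)
    ultimately show ?thesis by simp
  qed
  have fin: "P \<in> closure_in V" if ftP: "P \<in> finite_type E k" for P k
  proof -
    obtain m :: nat and c \<gamma> where P: "P = zero_off E (\<lambda>x. \<Sum>i<m. c i * \<gamma> i x ^ k)" "\<forall>i<m. \<gamma> i \<in> dual"
      using ftP unfolding finite_type_def by blast
    have "P = (\<lambda>x. \<Sum>i<m. c i * zero_off E (\<lambda>y. \<gamma> i y ^ k) x)"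
      by (auto simp: P(1) zero_off_def)
    then show ?thesis using P(2) by (auto intro!: subspace_sum [OF cV] power)
  qed
  have "f \<in> closure_in (closure_in V)" if f: "f \<in> H" for f
  proof -
    have "\<exists>g\<in>closure_in V. p s (\<lambda>x. f x - g x) < \<epsilon>" if s: "0 < s" and \<epsilon>: "0 < \<epsilon>" for s \<epsilon>
    proof -
      let ?P = "taylor_term E f"
      note sm = HbA_summable [OF f s]
      have "(\<lambda>N. \<Sum>k. s ^ (k + N) * n (k + N) E (?P (k + N))) \<longlonglongrightarrow> 0"
        by (rule suminf_exist_split2 [OF sm])
      then have "eventually (\<lambda>N. (\<Sum>k. s ^ (k + N) * n (k + N) E (?P (k + N))) < \<epsilon> / 2) sequentially"
        using \<epsilon> by (intro order_tendstoD) auto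
      then obtain N where N: "(\<Sum>k. s ^ (k + N) * n (k + N) E (?P (k + N))) < \<epsilon> / 2"
        using eventually_happens by fastforce
      \<comment> \<open>The bound is chosen so that the errors of \<open>N\<close> terms add up to
        at most \<open>\<epsilon> / 2\<close>.\<close>
      have "\<exists>Q. Q \<in> A k E \<and> Q \<in> finite_type E k \<and> s ^ k * n k E (\<lambda>x. ?P k x - Q x) \<le> \<epsilon> / (2 * Suc N)" for k
      proof -
        interpret P: complex_banach "function_space (A k E) (n k E)"
          by (rule A_banach [OF complex_banach_axioms])
        have PA: "?P k \<in> A k E" by (rule HbA_A [OF f])
        have r: "0 < \<epsilon> / (2 * Suc N) / s ^ k" using s \<epsilon> by simp
        have "?P k \<in> P.mtopology closure_of finite_type E k"
          using ft [of k] PA by (simp add: norm_topology_def)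
        then obtain Q where Q: "Q \<in> finite_type E k" "Q \<in> P.mball (?P k) (\<epsilon> / (2 * Suc N) / s ^ k)"
          unfolding P.metric_closure_of using r by blast
        then have QA: "Q \<in> A k E" unfolding P.in_mball by simp
        have "n k E (\<lambda>x. ?P k x - Q x) < \<epsilon> / (2 * Suc N) / s ^ k"
          using Q(2) unfolding P.in_mball vdist_function_space [OF PA QA] by blast
        then have "s ^ k * n k E (\<lambda>x. ?P k x - Q x) \<le> s ^ k * (\<epsilon> / (2 * Suc N) / s ^ k)"
          using s by (intro mult_left_mono) auto
        also have "\<dots> = \<epsilon> / (2 * Suc N)" using s by simp
        finally have "s ^ k * n k E (\<lambda>x. ?P k x - Q x) \<le> \<epsilon> / (2 * Suc N)" .
        then show ?thesis using Q(1) QA by blast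
      qed
      then obtain Q where Q: "\<And>k. Q k \<in> A k E" "\<And>k. Q k \<in> finite_type E k"
        "\<And>k. s ^ k * n k E (\<lambda>x. ?P k x - Q k x) \<le> \<epsilon> / (2 * Suc N)"
        by metis
      define g where "g = (\<lambda>x. \<Sum>k<N. 1 * Q k x)"
      have gV: "g \<in> closure_in V"
        unfolding g_def by (intro subspace_sum [OF cV] fin [OF Q(2)])
      then have gH: "g \<in> H" by (simp add: closure_in_def)
      define G where "G j = (if j < N then Q j else (\<lambda>x. 0))" for j
      have "expands_at g (vzero E) G"
        unfolding expands_at_def
      proof (intro conjI allI impI ballI)
        show "G j \<in> A j E" for j using Q(1) A_zero by (simp add: G_def)
        show "summable (\<lambda>j. s ^ j * n j E (G j))" for s
          by (rule summable_finite [of "{..<N}"]) (auto simp: G_def n_zero)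
        show "(\<lambda>j. G j y) sums g (vadd E (vzero E) y)" if "y \<in> vcarrier E" for y
          using sums_If_finite_set [of "{..<N}" "\<lambda>j. Q j y"] zero_add [OF that]
          by (simp add: G_def g_def if_distrib [of "\<lambda>f. f y"] cong: if_cong)
      qed
      then have tg: "taylor_term E g = G"
        by (rule taylor_term_eq [OF expands_taylor [OF _ complex_normed_space.zero_closed [OF complex_normed_space_axioms]]])
      have hol: "f \<in> holomorphic_functions E" "g \<in> holomorphic_functions E"
        using f gH by (auto simp: HbA_iff)
      have td: "taylor_term E (\<lambda>x. 1 * f x + (-1) * g x) = (\<lambda>k x. 1 * ?P k x + (-1) * G k x)"
        using holomorphic_functions_lin(2) [OF hol, of 1 "-1"] by (simp only: tg)
      let ?D = "\<lambda>k. s ^ k * n k E (\<lambda>x. ?P k x - G k x)"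
      have "p s (\<lambda>x. f x - g x) = p s (\<lambda>x. 1 * f x + (-1) * g x)" by simp
      also have "\<dots> = (\<Sum>k. ?D k)" unfolding HbA_seminorm_def td by simp
      also have "\<dots> = (\<Sum>k. ?D (k + N)) + (\<Sum>k<N. ?D k)"
      proof (rule suminf_split_initial_segment)
        have "(\<lambda>x. f x - g x) \<in> H" by (rule diff_closed [OF f gH])
        then have "(\<lambda>x. 1 * f x + (-1) * g x) \<in> H" by simp
        from HbA_summable [OF this s] show "summable ?D" unfolding td by simp
      qed
      also have "(\<Sum>k. ?D (k + N)) = (\<Sum>k. s ^ (k + N) * n (k + N) E (?P (k + N)))"
        by (simp add: G_def)
      also have "(\<Sum>k<N. ?D k) \<le> (\<Sum>k<N. \<epsilon> / (2 * Suc N))"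
        using Q(3) by (intro sum_mono) (simp add: G_def)
      also have "\<dots> \<le> \<epsilon> / 2" using \<epsilon> by (simp add: field_simps)
      finally have "p s (\<lambda>x. f x - g x) < \<epsilon>" using N by simp
      then show ?thesis using gV by blast
    qed
    then show ?thesis using f by (simp add: closure_in_def)
  qed
  then have "H \<subseteq> closure_in V" unfolding closure_in_idem [OF VX] by (rule subsetI)
  moreover have "closure_in V \<subseteq> H" by (auto simp: closure_in_def)
  ultimately show ?thesis by (rule subset_antisym [rotated])
qed

end

section \<open>Convolution operators\<close>

locale convolution = poly_ideals E A n
  for E :: "'u cnormed" and A :: "nat \<Rightarrow> 'u cnormed \<Rightarrow> ('u \<Rightarrow> complex) set"
    and n :: "nat \<Rightarrow> 'u cnormed \<Rightarrow> ('u \<Rightarrow> complex) \<Rightarrow> real" +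
  fixes T :: "('u \<Rightarrow> complex) \<Rightarrow> ('u \<Rightarrow> complex)"
  assumes T: "continuous_linear_operator \<T> T"
    and T_translation: "x \<in> vcarrier E \<Longrightarrow> f \<in> H \<Longrightarrow> T (translation E x f) = translation E x (T f)"
begin

lemmas vzero_closed = complex_normed_space.zero_closed [OF complex_normed_space_axioms]

definition eig :: "('u \<Rightarrow> complex) \<Rightarrow> complex" where
  "eig \<gamma> = T (expo \<gamma>) (vzero E)"

text \<open>Translating an exponential multiplies it by a scalar, so the value of its image at a point is
  determined by the value at the origin.\<close>

lemma T_expo:
  assumes \<gamma>: "\<gamma> \<in> dual"
  shows "T (expo \<gamma>) = (\<lambda>y. eig \<gamma> * expo \<gamma> y)"
proof
  fix y
  note eH = expo_in_H [OF \<gamma>]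
  show "T (expo \<gamma>) y = eig \<gamma> * expo \<gamma> y"
  proof (cases "y \<in> vcarrier E")
    case y: True
    have tr: "translation E y (expo \<gamma>) = (\<lambda>x. exp (\<gamma> y) * expo \<gamma> x + 0 * expo \<gamma> x)"
      using y by (auto simp: translation_def expo_def zero_off_def vadd_closed dual_add [OF \<gamma>] exp_add)
    have "T (expo \<gamma>) y = translation E y (T (expo \<gamma>)) (vzero E)"
      using y vzero_closed by (simp add: translation_def zero_off_def add_zero)
    also have "\<dots> = T (translation E y (expo \<gamma>)) (vzero E)"
      by (simp only: T_translation [OF y eH])
    also have "\<dots> = exp (\<gamma> y) * eig \<gamma>"
      unfolding tr operator_lin [OF T eH eH] eig_def by simp
    finally show ?thesis using y by (simp add: expo_def zero_off_def)
  next
    case False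
    then show ?thesis
      using HbA_off [OF operator_closed [OF T eH]] by (simp add: expo_def zero_off_def)
  qed
qed

lemma T_expfun_sums:
  assumes \<gamma>: "\<gamma> \<in> dual" and \<delta>: "\<delta> \<in> dual" and c: "exp_type K R c"
  shows "(\<lambda>j. c j * T (jet \<gamma> \<delta> j) y) sums T (expfun \<gamma> \<delta> c) y"
    "(\<lambda>j. c j * jet \<gamma> \<delta> j y) sums expfun \<gamma> \<delta> c y"
proof -
  note lim = expfun_series [OF \<gamma> \<delta> c]
  note cH = expfun_in_H [OF \<gamma> \<delta> c] and jH = jet_in_H [OF \<gamma> \<delta>]
  have sH: "(\<lambda>y. \<Sum>j<N. c j * jet \<gamma> \<delta> j y) \<in> H" for N
    by (rule sum_closed) (rule jH)
  show "(\<lambda>j. c j * jet \<gamma> \<delta> j y) sums expfun \<gamma> \<delta> c y"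
    unfolding sums_def by (rule limitin_pointwise [OF cH sH lim])
  have "(\<lambda>N. T (\<lambda>y. \<Sum>j<N. c j * jet \<gamma> \<delta> j y) y) \<longlonglongrightarrow> T (expfun \<gamma> \<delta> c) y"
    by (rule limitin_pointwise [OF operator_closed [OF T cH] operator_closed [OF T sH] operator_limit [OF T lim]])
  then show "(\<lambda>j. c j * T (jet \<gamma> \<delta> j) y) sums T (expfun \<gamma> \<delta> c) y"
    unfolding sums_def by (simp add: operator_sum [OF T jH])
qed

lemma dual_line: "\<gamma> \<in> dual \<Longrightarrow> \<delta> \<in> dual \<Longrightarrow> (\<lambda>y. \<gamma> y + w * \<delta> y) \<in> dual"
  using dual_lin(1) [of \<gamma> \<delta> 1 w] by simp

text \<open>Read as power series in \<open>w\<close>, these are the entire functions to which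
  \<open>moment_sums\<close> is applied; their ratio is the eigenvalue.\<close>

lemma eig_line_sums:
  assumes \<gamma>: "\<gamma> \<in> dual" and \<delta>: "\<delta> \<in> dual"
  shows "(\<lambda>j. T (jet \<gamma> \<delta> j) y * w ^ j) sums (eig (\<lambda>y. \<gamma> y + w * \<delta> y) * expo (\<lambda>y. \<gamma> y + w * \<delta> y) y)"
    "(\<lambda>j. jet \<gamma> \<delta> j y * w ^ j) sums expo (\<lambda>y. \<gamma> y + w * \<delta> y) y"
  using T_expfun_sums [OF \<gamma> \<delta> exp_type_power [of w], of y]
  unfolding expfun_power T_expo [OF dual_line [OF \<gamma> \<delta>]] by (simp_all add: mult.commute)

text \<open>The derivative of the eigenvalue at \<open>\<gamma>\<close> in direction
  \<open>\<delta>\<close>, as \<open>eig_line_holomorphic\<close> shows. Taken as the image of the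
  first jet it is linear in the direction, because that jet is.\<close>

definition deig :: "('u \<Rightarrow> complex) \<Rightarrow> ('u \<Rightarrow> complex) \<Rightarrow> complex" where
  "deig \<gamma> \<delta> = T (jet \<gamma> \<delta> 1) (vzero E)"

lemma eig_line_powser:
  assumes \<gamma>: "\<gamma> \<in> dual" and \<delta>: "\<delta> \<in> dual"
  shows "(\<lambda>j. T (jet \<gamma> \<delta> j) (vzero E) * w ^ j) sums eig (\<lambda>y. \<gamma> y + w * \<delta> y)"
proof -
  have d0: "\<eta> (vzero E) = 0" if "\<eta> \<in> dual" for \<eta>
    using dual_scale [OF that vzero_closed, of 0] scale_zero_left [OF vzero_closed] by simp
  have "expo (\<lambda>y. \<gamma> y + w * \<delta> y) (vzero E) = 1"
    using vzero_closed d0 [OF \<gamma>] d0 [OF \<delta>] by (simp add: expo_def zero_off_def)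
  then show ?thesis using eig_line_sums(1) [OF \<gamma> \<delta>, of "vzero E" w] by simp
qed

lemma eig_line_holomorphic:
  assumes \<gamma>: "\<gamma> \<in> dual" and \<delta>: "\<delta> \<in> dual"
  shows "(\<lambda>w. eig (\<lambda>y. \<gamma> y + w * \<delta> y)) holomorphic_on UNIV"
    "deriv (\<lambda>w. eig (\<lambda>y. \<gamma> y + w * \<delta> y)) 0 = deig \<gamma> \<delta>"
proof -
  let ?a = "\<lambda>j. T (jet \<gamma> \<delta> j) (vzero E)"
  have eq: "(\<lambda>w. eig (\<lambda>y. \<gamma> y + w * \<delta> y)) = (\<lambda>w. \<Sum>j. ?a j * w ^ j)"
    using eig_line_powser [OF \<gamma> \<delta>] by (simp add: sums_iff)
  have der: "((\<lambda>w. \<Sum>j. ?a j * w ^ j) has_field_derivative (\<Sum>j. diffs ?a j * w ^ j)) (at w)" for w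
    by (rule termdiffs_strong_converges_everywhere) (rule sums_summable [OF eig_line_powser [OF \<gamma> \<delta>]])
  then show "(\<lambda>w. eig (\<lambda>y. \<gamma> y + w * \<delta> y)) holomorphic_on UNIV"
    unfolding eq holomorphic_on_def field_differentiable_def
    using has_field_derivative_at_within by blast
  have "deriv (\<lambda>w. \<Sum>j. ?a j * w ^ j) 0 = (\<Sum>j. diffs ?a j * 0 ^ j)"
    by (rule DERIV_imp_deriv [OF der])
  also have "\<dots> = diffs ?a 0" by simp
  finally show "deriv (\<lambda>w. eig (\<lambda>y. \<gamma> y + w * \<delta> y)) 0 = deig \<gamma> \<delta>"
    unfolding eq by (simp add: diffs_def deig_def)
qed

lemma deig_add_scale:
  assumes \<gamma>: "\<gamma> \<in> dual" and \<delta>: "\<delta> \<in> dual" and \<eta>: "\<eta> \<in> dual"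
  shows "deig \<gamma> (\<lambda>y. \<delta> y + t * \<eta> y) = deig \<gamma> \<delta> + t * deig \<gamma> \<eta>"
proof -
  have "jet \<gamma> (\<lambda>y. \<delta> y + t * \<eta> y) 1 = (\<lambda>y. 1 * jet \<gamma> \<delta> 1 y + t * jet \<gamma> \<eta> 1 y)"
  proof
    fix y
    show "jet \<gamma> (\<lambda>y. \<delta> y + t * \<eta> y) 1 y = 1 * jet \<gamma> \<delta> 1 y + t * jet \<gamma> \<eta> 1 y"
      by (cases "y \<in> vcarrier E") (simp add: jet_apply algebra_simps, simp add: expfun_def zero_off_def)
  qed
  then show ?thesis
    unfolding deig_def by (simp only: operator_lin [OF T jet_in_H [OF \<gamma> \<delta>] jet_in_H [OF \<gamma> \<eta>]]) simp
qed

text \<open>The regular value is found at some parameter \<open>w\<close> on the line through the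
  zero functional. As \<open>deig\<close> is a derivative at parameter 0, the base point is moved to
  \<open>w\<close> times \<open>\<gamma>\<close>.\<close>

lemma unimodular_eigenvalue:
  assumes \<gamma>: "\<gamma> \<in> dual" and ne: "eig \<gamma> \<noteq> eig (\<lambda>y. 0)"
  obtains \<gamma>0 where "\<gamma>0 \<in> dual" "cmod (eig \<gamma>0) = 1" "deig \<gamma>0 \<gamma> \<noteq> 0"
proof -
  define f where "f w = eig (\<lambda>y. 0 + w * \<gamma> y)" for w
  have f: "f holomorphic_on UNIV"
    unfolding f_def [abs_def] by (rule eig_line_holomorphic(1) [OF dual_zero \<gamma>])
  have "f 1 \<noteq> f 0" using ne by (simp add: f_def)
  then obtain w where w: "cmod (f w) = 1" "deriv f w \<noteq> 0"
    using entire_unimodular_regular_value [OF f] by blast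
  define \<gamma>0 where "\<gamma>0 = (\<lambda>y. 0 + w * \<gamma> y)"
  have \<gamma>0: "\<gamma>0 \<in> dual" unfolding \<gamma>0_def by (rule dual_line [OF dual_zero \<gamma>])
  have "(\<lambda>z. eig (\<lambda>y. \<gamma>0 y + z * \<gamma> y)) = (\<lambda>z. f (z + w))"
    by (simp add: f_def \<gamma>0_def algebra_simps)
  moreover have "deriv (\<lambda>z. f (z + w)) 0 = deriv f w"
  proof -
    have "(f has_field_derivative deriv f w) (at (0 + w))"
      using holomorphic_derivI [OF f open_UNIV, of w] by simp
    then have "((\<lambda>z. f (z + w)) has_field_derivative deriv f w) (at 0)"
      by (simp only: DERIV_shift)
    then show ?thesis by (rule DERIV_imp_deriv)
  qed
  ultimately have "deig \<gamma>0 \<gamma> = deriv f w"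
    using eig_line_holomorphic(2) [OF \<gamma>0 \<gamma>] by simp
  moreover have "eig \<gamma>0 = f w" by (simp add: f_def \<gamma>0_def)
  ultimately show ?thesis using that [OF \<gamma>0] w by simp
qed

section \<open>Two-sided orbits\<close>

text \<open>The decay in \<open>m\<close> is that of \<open>bump_fourier_decay\<close>. An
  exponential type \<open>B\<close> common to the whole orbit allows a single weight per orbit when
  orbits are collected.\<close>

definition good_orbit :: "(int \<Rightarrow> 'u \<Rightarrow> complex) \<Rightarrow> bool" where
  "good_orbit x \<longleftrightarrow> (\<exists>K B. \<forall>m. tame (K / (1 + (of_int m)\<^sup>2)) B (x m)) \<and> (\<forall>m. T (x m) = x (m + 1))"

lemma bump_real: "bump a b (of_real t) = of_real (((t - a) * (t - b))\<^sup>2)"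
  by (simp add: bump_def)

lemma bump_integral_pos:
  fixes a b :: real
  assumes "a < b"
  shows "0 < integral {a..b} (\<lambda>t. ((t - a) * (t - b))\<^sup>2)"
proof -
  have c: "continuous_on {a..b} (\<lambda>t. ((t - a) * (t - b))\<^sup>2)" by (intro continuous_intros)
  have "0 \<le> integral {a..b} (\<lambda>t. ((t - a) * (t - b))\<^sup>2)"
    by (rule integral_nonneg [OF integrable_continuous_real [OF c]]) simp
  moreover have "integral {a..b} (\<lambda>t. ((t - a) * (t - b))\<^sup>2) \<noteq> 0"
  proof
    assume "integral {a..b} (\<lambda>t. ((t - a) * (t - b))\<^sup>2) = 0"
    then have "((\<lambda>t. ((t - a) * (t - b))\<^sup>2) has_integral 0) (cbox a b)"
      using integrable_integral [OF integrable_continuous_real [OF c]] by (simp add: cbox_interval)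
    then have "(((a + b) / 2 - a) * ((a + b) / 2 - b))\<^sup>2 = 0"
      by (intro has_integral_0_cbox_imp_0 [of a b]) (use c assms in \<open>auto simp: cbox_interval box_real\<close>)
    then have "(a + b) / 2 - a = 0 \<or> (a + b) / 2 - b = 0" by simp
    then show False using assms by (auto simp: field_simps)
  qed
  ultimately show ?thesis by simp
qed

text \<open>Averaging the eigenvectors along an arc of the unit circle against a smooth weight gives a vector
  whose two-sided orbit is summable.\<close>

lemma orbits_exist:
  assumes \<gamma>: "\<gamma> \<in> dual" and \<delta>: "\<delta> \<in> dual" and uni: "cmod (eig \<gamma>) = 1" and reg: "deig \<gamma> \<delta> \<noteq> 0"
  obtains x :: "nat \<Rightarrow> nat \<Rightarrow> int \<Rightarrow> 'u \<Rightarrow> complex" and w :: "nat \<Rightarrow> complex"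
    where "\<And>q l. good_orbit (x q l)" "\<And>q. w q \<noteq> 0" "w \<longlonglongrightarrow> 0"
      "\<And>q s \<epsilon>. 0 < s \<Longrightarrow> 0 < \<epsilon> \<Longrightarrow> \<exists>l. p s (\<lambda>y. expo (\<lambda>y. \<gamma> y + w q * \<delta> y) y - x q l 0 y) < \<epsilon>"
proof -
  define f where "f w = eig (\<lambda>y. \<gamma> y + w * \<delta> y)" for w
  have f: "f holomorphic_on UNIV"
    unfolding f_def [abs_def] by (rule eig_line_holomorphic(1) [OF \<gamma> \<delta>])
  have f0: "f 0 = eig \<gamma>" by (simp add: f_def)
  have df: "deriv f 0 \<noteq> 0" using eig_line_holomorphic(2) [OF \<gamma> \<delta>] reg by (simp add: f_def [abs_def])
  have fnz: "f 0 \<noteq> 0" using uni f0 by auto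
  obtain u d R where d: "0 < d" "d \<le> 1" and R: "0 < R" and u: "u holomorphic_on ball 0 d" "u 0 = 0"
    and fu: "\<And>t. t \<in> ball 0 d \<Longrightarrow> f (u t) = f 0 * exp (\<i> * t)" and uR: "\<And>t. t \<in> ball 0 d \<Longrightarrow> cmod (u t) \<le> R"
    and unz: "\<And>t. 0 < t \<Longrightarrow> t < d \<Longrightarrow> u (of_real t) \<noteq> 0"
    by (rule eigenvalue_curve [OF f df fnz]) blast
  obtain \<theta> where \<theta>: "f 0 = exp (\<i> * of_real \<theta>)"
    using uni f0 complex_norm_eq_1_exp by metis
  have fosc: "osc \<theta> m (of_real t) * (f 0 * exp (\<i> * of_real t)) = osc \<theta> (m + 1) (of_real t)" for m t
    unfolding \<theta> osc_def exp_add [symmetric] by (simp add: algebra_simps)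
  \<comment> \<open>Base points tend to 0 with \<open>q\<close>, and the intervals to the right of
    each base point shrink to it as \<open>l\<close> grows, all within distance d / 2 of the origin
    as the Fourier estimate requires.\<close>
  define tq where "tq q = d / (4 * Suc q)" for q :: nat
  define bl where "bl q l = tq q + d / (8 * Suc l)" for q l :: nat
  have tq: "0 < tq q" "tq q \<le> d / 4" for q
    using d by (auto simp: tq_def divide_simps)
  have bl: "tq q < bl q l" "bl q l < d / 2" for q l
  proof -
    have "0 < d / (8 * Suc l)" "d / (8 * Suc l) \<le> d / 8"
      using d by (auto simp: divide_simps)
    then show "tq q < bl q l" "bl q l < d / 2"
      unfolding bl_def using tq [of q] d by linarith+
  qed
  have in_ball: "of_real t \<in> ball (0 :: complex) d" if "t \<in> {tq q..bl q l}" for t q l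
    using that tq [of q] bl [of q l] d by auto
  \<comment> \<open>Normalises the bump to integral 1, so that for growing \<open>l\<close> the
    weights form an approximate identity at the base point.\<close>
  define \<kappa> where "\<kappa> q l = 1 / integral {tq q..bl q l} (\<lambda>t. ((t - tq q) * (t - bl q l))\<^sup>2)" for q l
  have \<kappa>: "0 < \<kappa> q l" for q l using bump_integral_pos [OF bl(1)] by (simp add: \<kappa>_def)
  \<comment> \<open>Moments of the curve \<open>u\<close> against the weight: the coefficients of
    the \<open>m\<close>-th Fourier coefficient of the eigenvector field
    exp(\<open>\<gamma> + u(t) \<delta>\<close>).\<close>
  define c where "c q l m j = integral {tq q..bl q l}
      (\<lambda>t. osc \<theta> m (of_real t) * (bump (tq q) (bl q l) (of_real t) * u (of_real t) ^ j))" for q l m j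
  define x where "x q l m = (\<lambda>y. of_real (\<kappa> q l) * expfun \<gamma> \<delta> (c q l m) y)" for q l m
  have uc: "continuous_on {tq q..bl q l} (\<lambda>t. u (of_real t))" for q l
  proof -
    have "continuous_on (of_real ` {tq q..bl q l}) u"
      by (rule continuous_on_subset [OF holomorphic_on_imp_continuous_on [OF u(1)]])
        (use in_ball in auto)
    then show ?thesis
      by (rule continuous_on_compose2 [of _ u _ of_real]) (auto intro: continuous_on_of_real_id)
  qed
  have oc: "continuous_on S (\<lambda>t. osc \<theta> m (of_real t) * bump a b (of_real t))" for S m a b
    unfolding osc_def bump_def by (intro continuous_intros)
  have c_type: "\<exists>K\<ge>0. \<forall>m. exp_type (K / (1 + (of_int m)\<^sup>2)) R (c q l m)" for q l
  proof -
    have ab: "- d / 2 < tq q" "tq q \<le> bl q l" using tq [of q] bl(1) [of q l] d by auto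
    obtain K where K: "K \<ge> 0" "\<And>G M m. G holomorphic_on ball 0 d \<Longrightarrow> (\<forall>t\<in>ball 0 d. cmod (G t) \<le> M) \<Longrightarrow>
        cmod (integral {tq q..bl q l} (\<lambda>t. osc \<theta> m (of_real t) * (bump (tq q) (bl q l) (of_real t) * G (of_real t))))
          \<le> K * M / (1 + (of_int m)\<^sup>2)"
      using bump_fourier_decay [OF d(1) ab bl(2), of \<theta>] by blast
    have "cmod (c q l m j) \<le> K / (1 + (of_int m)\<^sup>2) * R ^ j" for m j
    proof -
      have "cmod (c q l m j) \<le> K * R ^ j / (1 + (of_int m)\<^sup>2)"
        unfolding c_def
      proof (rule K(2))
        show "(\<lambda>t. u t ^ j) holomorphic_on ball 0 d" by (intro holomorphic_intros u)
        show "\<forall>t\<in>ball 0 d. cmod (u t ^ j) \<le> R ^ j" using uR by (simp add: norm_power power_mono)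
      qed
      then show ?thesis by simp
    qed
    moreover have "0 \<le> K / (1 + (of_int m)\<^sup>2)" for m :: int
      using K(1) by (intro divide_nonneg_nonneg add_nonneg_nonneg) auto
    ultimately show ?thesis using K(1) R by (auto simp: exp_type_def intro!: exI [of _ K])
  qed
  \<comment> \<open>Applying \<open>T\<close> inserts the eigenvalue
    exp(i(\<open>\<theta> + t\<close>)) under the integral, which raises the frequency by
    one.\<close>
  have T_step: "T (expfun \<gamma> \<delta> (c q l m)) = expfun \<gamma> \<delta> (c q l (m + 1))" for q l m
  proof
    fix y
    obtain K where K: "\<And>m. exp_type (K / (1 + (of_int m)\<^sup>2)) R (c q l m)"
      using c_type [of q l] by blast
    let ?I = "{tq q..bl q l}" and ?b = "\<lambda>t. bump (tq q) (bl q l) (of_real t)" and ?u = "\<lambda>t. u (of_real t)"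
    let ?e = "\<lambda>w. expo (\<lambda>y. \<gamma> y + w * \<delta> y) y"
    have ceq: "c q l m j = integral ?I (\<lambda>t. (osc \<theta> m (of_real t) * ?b t) * ?u t ^ j)" for m j
      unfolding c_def by (simp only: mult.assoc)
    have 1: "(\<lambda>j. T (jet \<gamma> \<delta> j) y * c q l m j) sums
        integral ?I (\<lambda>t. (osc \<theta> m (of_real t) * ?b t) * (f (?u t) * ?e (?u t)))"
      unfolding ceq f_def
      by (rule moment_sums [where g = "\<lambda>w. eig (\<lambda>y. \<gamma> y + w * \<delta> y) * ?e w", OF eig_line_sums(1) [OF \<gamma> \<delta>] oc uc])
    have 2: "(\<lambda>j. jet \<gamma> \<delta> j y * c q l (m + 1) j) sums
        integral ?I (\<lambda>t. (osc \<theta> (m + 1) (of_real t) * ?b t) * ?e (?u t))"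
      unfolding ceq
      by (rule moment_sums [where g = ?e, OF eig_line_sums(2) [OF \<gamma> \<delta>] oc uc])
    have eq: "integral ?I (\<lambda>t. (osc \<theta> m (of_real t) * ?b t) * (f (?u t) * ?e (?u t)))
        = integral ?I (\<lambda>t. (osc \<theta> (m + 1) (of_real t) * ?b t) * ?e (?u t))"
    proof (rule integral_cong)
      fix t assume "t \<in> ?I"
      then have "f (?u t) = f 0 * exp (\<i> * of_real t)" by (rule fu [OF in_ball])
      then show "(osc \<theta> m (of_real t) * ?b t) * (f (?u t) * ?e (?u t)) = (osc \<theta> (m + 1) (of_real t) * ?b t) * ?e (?u t)"
        by (simp add: fosc [symmetric])
    qed
    have 3: "(\<lambda>j. T (jet \<gamma> \<delta> j) y * c q l m j) sums T (expfun \<gamma> \<delta> (c q l m)) y"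
      using T_expfun_sums(1) [OF \<gamma> \<delta> K, of m y] by (simp add: mult.commute)
    have 4: "(\<lambda>j. jet \<gamma> \<delta> j y * c q l (m + 1) j) sums expfun \<gamma> \<delta> (c q l (m + 1)) y"
      using T_expfun_sums(2) [OF \<gamma> \<delta> K, of "m + 1" y] by (simp add: mult.commute)
    show "T (expfun \<gamma> \<delta> (c q l m)) y = expfun \<gamma> \<delta> (c q l (m + 1)) y"
      unfolding sums_unique2 [OF 3 1] sums_unique2 [OF 4 2] by (rule eq)
  qed
  show ?thesis
  proof (rule that)
    show "good_orbit (x q l)" for q l
      unfolding good_orbit_def
    proof (intro conjI allI)
      obtain K where K: "\<And>m. exp_type (K / (1 + (of_int m)\<^sup>2)) R (c q l m)"
        using c_type [of q l] by blast
      have "tame ((2 * K * \<kappa> q l) / (1 + (of_int m)\<^sup>2)) (dnorm \<gamma> + 2 * R * dnorm \<delta>) (x q l m)" for m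
        using tame_scale [OF expfun_tame [OF \<gamma> \<delta> K], of "of_real (\<kappa> q l)" m] \<kappa> [of q l]
        by (simp add: x_def mult_ac)
      then show "\<exists>K B. \<forall>m. tame (K / (1 + (of_int m)\<^sup>2)) B (x q l m)" by blast
      fix m
      have "expfun \<gamma> \<delta> (c q l m) \<in> H" using expfun_in_H [OF \<gamma> \<delta> K] .
      from operator_lin [OF T this this, of "of_real (\<kappa> q l)" 0]
      show "T (x q l m) = x q l (m + 1)" by (simp add: x_def T_step)
    qed
    show "u (of_real (tq q)) \<noteq> 0" for q
      using unz tq [of q] d by auto
    have "tq \<longlonglongrightarrow> 0"
      unfolding tq_def using tendsto_mult_right_zero [OF LIMSEQ_Suc [OF lim_1_over_n], of "d / 4"] by (simp add: mult_ac)
    then have "(\<lambda>q. complex_of_real (tq q)) \<longlonglongrightarrow> of_real 0" by (rule tendsto_of_real)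
    moreover have "isCont u 0"
      using u(1) d(1) by (intro continuous_on_interior [OF holomorphic_on_imp_continuous_on]) auto
    ultimately show "(\<lambda>q. u (of_real (tq q))) \<longlonglongrightarrow> 0"
      using isCont_tendsto_compose [of 0 u] u(2) by force
    show "\<exists>l. p s (\<lambda>y. expo (\<lambda>y. \<gamma> y + u (of_real (tq q)) * \<delta> y) y - x q l 0 y) < \<epsilon>"
      if s: "0 < s" and \<epsilon>: "0 < \<epsilon>" for q s \<epsilon>
    proof -
      let ?w = "u (of_real (tq q))"
      \<comment> \<open>The factor in the seminorm estimate for an \<open>expfun\<close> of radius
        2R, divided by \<open>R\<close>; with it the final bound is
        \<open>\<epsilon> / (2 * L) * L\<close>, that is, \<open>\<epsilon> / 2\<close>.\<close>
      define L where "L = 2 / R * exp ((dnorm \<gamma> + 2 * (2 * R) * dnorm \<delta>) * s)"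
      have L: "0 < L" using R by (simp add: L_def)
      have wR: "cmod ?w \<le> R" using uR [OF in_ball [of "tq q" q 0]] bl(1) [of q 0] by simp
      have "isCont u (of_real (tq q))"
        using u(1) in_ball [of "tq q" q 0] bl(1) [of q 0]
        by (intro continuous_on_interior [OF holomorphic_on_imp_continuous_on]) auto
      then obtain r where r: "r > 0" "\<And>z. cmod (z - of_real (tq q)) < r \<Longrightarrow> cmod (u z - ?w) < \<epsilon> / (2 * L)"
        unfolding continuous_at_eps_delta dist_norm
        by (elim allE [of _ "\<epsilon> / (2 * L)"] impE) (use \<epsilon> L in auto)
      obtain l :: nat where l: "d / r < l" using reals_Archimedean2 by blast
      have close: "cmod (u (of_real t) - ?w) \<le> \<epsilon> / (2 * L)" if t: "t \<in> {tq q..bl q l}" for t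
      proof -
        have "t - tq q \<le> d / (8 * Suc l)" using t by (simp add: bl_def)
        also have "\<dots> < r"
        proof -
          have "d < r * l" using l r(1) by (simp add: divide_less_eq mult.commute)
          also have "\<dots> \<le> r * (8 * Suc l)" using r(1) by (intro mult_left_mono) auto
          finally show ?thesis by (simp add: divide_less_eq del: of_nat_Suc)
        qed
        finally have "\<bar>t - tq q\<bar> < r" using t by simp
        then have "cmod (complex_of_real t - of_real (tq q)) < r"
          by (metis norm_of_real of_real_diff)
        then show ?thesis using r(2) less_imp_le by blast
      qed
      obtain K where K: "\<And>m. exp_type (K / (1 + (of_int m)\<^sup>2)) R (c q l m)"
        using c_type [of q l] by blast
      define e where "e j = 1 * ?w ^ j + (- of_real (\<kappa> q l)) * c q l 0 j" for j
      have exp_eq: "(\<lambda>y. expo (\<lambda>y. \<gamma> y + ?w * \<delta> y) y - x q l 0 y) = expfun \<gamma> \<delta> e"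
      proof
        fix y
        have "expfun \<gamma> \<delta> e y = 1 * expfun \<gamma> \<delta> (\<lambda>j. ?w ^ j) y + (- of_real (\<kappa> q l)) * expfun \<gamma> \<delta> (c q l 0) y"
          unfolding e_def [abs_def] by (rule expfun_lin [OF exp_type_power K])
        then show "expo (\<lambda>y. \<gamma> y + ?w * \<delta> y) y - x q l 0 y = expfun \<gamma> \<delta> e y"
          by (simp add: expfun_power x_def)
      qed
      \<comment> \<open>Powers differ by at most |w - u| j R^(j-1), and j \<le> 2^j turns the factor
        j into a doubled radius.\<close>
      have e_type: "exp_type (\<epsilon> / (2 * L) / R) (2 * R) e"
        unfolding exp_type_def
      proof (intro conjI allI)
        show "0 \<le> \<epsilon> / (2 * L) / R" "0 < 2 * R" using \<epsilon> L R by auto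
        fix j
        let ?I = "{tq q..bl q l}"
        let ?h = "\<lambda>t. ((t - tq q) * (t - bl q l))\<^sup>2"
        have hc: "continuous_on ?I ?h" by (intro continuous_intros)
        have "(?h has_integral (1 / \<kappa> q l)) ?I"
          using integrable_integral [OF integrable_continuous_real [OF hc]] by (simp add: \<kappa>_def)
        then have h1: "((\<lambda>t. \<kappa> q l * ?h t) has_integral 1) ?I"
          using has_integral_mult_right [of ?h "1 / \<kappa> q l" ?I "\<kappa> q l"] \<kappa> [of q l] by simp
        have hol: "continuous_on ?I (\<lambda>t. osc \<theta> 0 (of_real t) * (bump (tq q) (bl q l) (of_real t) * u (of_real t) ^ j))"
          using continuous_on_mult [OF oc continuous_on_power [OF uc]] by (simp only: mult.assoc)
        have "((\<lambda>t. ?w ^ j * of_real (\<kappa> q l * ?h t)) has_integral (?w ^ j * of_real 1)) ?I"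
          by (intro has_integral_mult_right has_integral_of_real h1)
        moreover have "((\<lambda>t. of_real (\<kappa> q l) * (osc \<theta> 0 (of_real t) * (bump (tq q) (bl q l) (of_real t) * u (of_real t) ^ j)))
            has_integral (of_real (\<kappa> q l) * c q l 0 j)) ?I"
          unfolding c_def by (intro has_integral_mult_right integrable_integral integrable_continuous_real hol)
        ultimately have "((\<lambda>t. ?w ^ j * of_real (\<kappa> q l * ?h t) - of_real (\<kappa> q l) * (osc \<theta> 0 (of_real t) * (bump (tq q) (bl q l) (of_real t) * u (of_real t) ^ j)))
            has_integral e j) ?I"
          by (auto simp: e_def dest: has_integral_diff)
        moreover have "?w ^ j * of_real (\<kappa> q l * ?h t) - of_real (\<kappa> q l) * (osc \<theta> 0 (of_real t) * (bump (tq q) (bl q l) (of_real t) * u (of_real t) ^ j))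
            = of_real (\<kappa> q l * ?h t) * (?w ^ j - u (of_real t) ^ j)" for t
          by (simp add: bump_real osc_def algebra_simps)
        ultimately have ej: "((\<lambda>t. of_real (\<kappa> q l * ?h t) * (?w ^ j - u (of_real t) ^ j)) has_integral e j) ?I"
          by simp
        have le: "norm (of_real (\<kappa> q l * ?h t) * (?w ^ j - u (of_real t) ^ j))
            \<le> \<kappa> q l * ?h t * (\<epsilon> / (2 * L) / R * (2 * R) ^ j)" if t: "t \<in> ?I" for t
        proof -
          have uRt: "cmod (u (of_real t)) \<le> R" using uR [OF in_ball [OF t]] .
          have "cmod (?w ^ j - u (of_real t) ^ j) \<le> \<epsilon> / (2 * L) / R * (2 * R) ^ j"
          proof (cases "j = 0")
            case True
            then show ?thesis using \<epsilon> L R by simp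
          next
            case False
            have "cmod (?w ^ j - u (of_real t) ^ j) = cmod (?w - u (of_real t)) * cmod (\<Sum>i<j. u (of_real t) ^ (j - Suc i) * ?w ^ i)"
              by (simp add: power_diff_sumr2 norm_mult)
            also have "\<dots> \<le> (\<epsilon> / (2 * L)) * (\<Sum>i<j. R ^ (j - 1))"
            proof (rule mult_mono)
              show "cmod (?w - u (of_real t)) \<le> \<epsilon> / (2 * L)"
                using close [OF t] by (simp add: norm_minus_commute)
              show "cmod (\<Sum>i<j. u (of_real t) ^ (j - Suc i) * ?w ^ i) \<le> (\<Sum>i<j. R ^ (j - 1))"
              proof (rule sum_norm_le)
                fix i assume i: "i \<in> {..<j}"
                have "cmod (u (of_real t) ^ (j - Suc i) * ?w ^ i) \<le> R ^ (j - Suc i) * R ^ i"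
                  unfolding norm_mult norm_power using uRt wR R by (intro mult_mono power_mono) auto
                also have "\<dots> = R ^ (j - 1)" using i by (simp add: power_add [symmetric])
                finally show "cmod (u (of_real t) ^ (j - Suc i) * ?w ^ i) \<le> R ^ (j - 1)" .
              qed
            qed (use \<epsilon> L in auto)
            also have "\<dots> = (\<epsilon> / (2 * L)) * (of_nat j * R ^ (j - 1))" by simp
            also have "\<dots> \<le> (\<epsilon> / (2 * L)) * (2 ^ j * R ^ (j - 1))"
              using \<epsilon> L R of_nat_less_two_power [of j, where 'a = real]
              by (intro mult_left_mono mult_right_mono) auto
            also have "\<dots> = \<epsilon> / (2 * L) / R * (2 * R) ^ j"
              using R False by (cases j) (simp_all add: power_mult_distrib)
            finally show ?thesis .
          qed
          then have "\<kappa> q l * ?h t * cmod (?w ^ j - u (of_real t) ^ j) \<le> \<kappa> q l * ?h t * (\<epsilon> / (2 * L) / R * (2 * R) ^ j)"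
            by (rule mult_left_mono) (use \<kappa> [of q l] in auto)
          moreover have "norm (complex_of_real (\<kappa> q l * ?h t)) = \<kappa> q l * ?h t"
            unfolding norm_of_real using \<kappa> [of q l] by (intro abs_of_nonneg) auto
          ultimately show ?thesis
            by (simp only: norm_mult)
        qed
        have "norm (integral ?I (\<lambda>t. of_real (\<kappa> q l * ?h t) * (?w ^ j - u (of_real t) ^ j)))
            \<le> integral ?I (\<lambda>t. \<kappa> q l * ?h t * (\<epsilon> / (2 * L) / R * (2 * R) ^ j))"
          by (rule integral_norm_bound_integral [OF has_integral_integrable [OF ej]
                has_integral_integrable [OF has_integral_mult_left [OF h1]] le])
        also have "\<dots> = 1 * (\<epsilon> / (2 * L) / R * (2 * R) ^ j)"
          by (rule integral_unique [OF has_integral_mult_left [OF h1]])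
        finally show "cmod (e j) \<le> \<epsilon> / (2 * L) / R * (2 * R) ^ j"
          using integral_unique [OF ej] by simp
      qed
      have "p s (expfun \<gamma> \<delta> e) \<le> 2 * (\<epsilon> / (2 * L) / R) * exp ((dnorm \<gamma> + 2 * (2 * R) * dnorm \<delta>) * s)"
        by (rule expfun_seminorm_le [OF \<gamma> \<delta> e_type s])
      also have "\<dots> = \<epsilon> / (2 * L) * L" by (simp add: L_def)
      also have "\<dots> < \<epsilon>" using L \<epsilon> by simp
      finally show ?thesis unfolding exp_eq [symmetric] by blast
    qed
  qed
qed

end

text \<open>The \<open>m\<close>-th integer z of the enumeration satisfies m \<le> 2|z|. With (m +
  1)^2 \<le> 2 m^2 + 2 this gives (m + 1)^2 \<le> 8 (1 + z^2), whence the constant 8.\<close>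

lemma summable_int_decode: "summable (\<lambda>m. 1 / (1 + (of_int (int_decode m))\<^sup>2) :: real)"
proof (rule summable_comparison_test')
  show "summable (\<lambda>m. 8 * inverse (real (Suc m) ^ 2))"
    using inverse_power_summable [of 2, where 'a = real]
    by (intro summable_mult) (subst summable_Suc_iff [of "\<lambda>m. inverse (real m ^ 2)"], simp)
  fix m :: nat
  have "int m \<le> 2 * \<bar>int_decode m\<bar>"
    by (auto simp: int_decode_def sum_decode_def)
  then have "real_of_int (int m) \<le> real_of_int (2 * \<bar>int_decode m\<bar>)" by (simp only: of_int_le_iff)
  then have "real m \<le> 2 * \<bar>of_int (int_decode m)\<bar>" by simp
  then have "(real m)\<^sup>2 \<le> (2 * \<bar>of_int (int_decode m)\<bar>)\<^sup>2" by (intro power_mono) auto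
  moreover have "0 \<le> (real m - 1)\<^sup>2" by simp
  ultimately have "(real (Suc m))\<^sup>2 \<le> 8 * (1 + (of_int (int_decode m))\<^sup>2)"
    by (simp add: power2_eq_square algebra_simps)
  then have "1 / (1 + (of_int (int_decode m))\<^sup>2) \<le> 8 / (real (Suc m))\<^sup>2"
    by (simp add: divide_simps add_pos_nonneg del: of_nat_Suc)
  then show "norm (1 / (1 + (of_int (int_decode m))\<^sup>2) :: real) \<le> 8 * inverse (real (Suc m) ^ 2)"
    by (simp add: divide_inverse del: of_nat_Suc)
qed

text \<open>A pair is coded by a number at least as large as each component, so the first
  \<open>N\<close> codes lie in a square, over which the sum is a product of partial sums.\<close>

lemma summable_prod_decode:
  fixes f g :: "nat \<Rightarrow> real"
  assumes "summable f" "summable g" "\<And>i. 0 \<le> f i" "\<And>j. 0 \<le> g j"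
  shows "summable (\<lambda>\<kappa>. f (fst (prod_decode \<kappa>)) * g (snd (prod_decode \<kappa>)))"
proof (rule summableI_nonneg_bounded)
  show "0 \<le> f (fst (prod_decode \<kappa>)) * g (snd (prod_decode \<kappa>))" for \<kappa> using assms by simp
  fix N
  have sub: "prod_decode ` {..<N} \<subseteq> {..<N} \<times> {..<N}"
  proof
    fix z assume "z \<in> prod_decode ` {..<N}"
    then have "prod_encode z < N" by auto
    then show "z \<in> {..<N} \<times> {..<N}"
      using le_prod_encode_1 [of "fst z" "snd z"] le_prod_encode_2 [of "snd z" "fst z"] by (auto simp: mem_Times_iff)
  qed
  have "(\<Sum>\<kappa><N. f (fst (prod_decode \<kappa>)) * g (snd (prod_decode \<kappa>)))
      = (\<Sum>z\<in>prod_decode ` {..<N}. f (fst z) * g (snd z))"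
    by (simp add: sum.reindex [OF inj_prod_decode])
  also have "\<dots> \<le> (\<Sum>z\<in>{..<N} \<times> {..<N}. f (fst z) * g (snd z))"
    using assms by (intro sum_mono2 sub) auto
  also have "\<dots> = (\<Sum>i<N. f i) * (\<Sum>j<N. g j)"
    by (simp add: sum_product sum.cartesian_product case_prod_beta)
  also have "\<dots> \<le> suminf f * suminf g"
    using assms by (intro mult_mono sum_le_suminf sum_nonneg suminf_nonneg) auto
  finally show "(\<Sum>\<kappa><N. f (fst (prod_decode \<kappa>)) * g (snd (prod_decode \<kappa>))) \<le> suminf f * suminf g" .
qed

context seminormed_functions
begin

lemma subspace_finite_sums:
  assumes x: "\<And>k. x k \<in> X"
  shows "subspace_in {f. \<exists>(N :: nat) a. f = (\<lambda>y. \<Sum>k<N. a k * x k y)}" (is "subspace_in ?V")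
  unfolding subspace_in_def
proof (intro conjI ballI allI subsetI)
  show "f \<in> X" if "f \<in> ?V" for f
    using that sum_closed [of _ x, OF x] by auto
  show "?V \<noteq> {}" by blast
  fix f g a b assume "f \<in> ?V" "g \<in> ?V"
  then obtain N M :: nat and c d where f: "f = (\<lambda>y. \<Sum>k<N. c k * x k y)" and g: "g = (\<lambda>y. \<Sum>k<M. d k * x k y)"
    by blast
  let ?e = "\<lambda>k. a * (if k < N then c k else 0) + b * (if k < M then d k else 0)"
  have pad: "(\<Sum>k<L. (if k < N then c k else 0) * x k y) = (\<Sum>k<N. c k * x k y)" if "N \<le> L" for N L c y
    by (rule sum.mono_neutral_cong_right) (use that in auto)
  have "(\<lambda>y. a * f y + b * g y) = (\<lambda>y. \<Sum>k<max N M. ?e k * x k y)"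
    unfolding f g
    by (subst (1 2) pad [of _ "max N M", symmetric])
      (simp_all only: max.cobounded1 max.cobounded2 sum_distrib_left sum.distrib [symmetric] distrib_right mult.assoc)
  then show "(\<lambda>y. a * f y + b * g y) \<in> ?V"
    by (intro CollectI exI [of _ "max N M"] exI [of _ ?e])
qed

end

section \<open>Assembling one gaussian series from countably many orbits\<close>

context convolution
begin

text \<open>Lists all points of all orbits in one sequence, with one weight per orbit. Rescaling a
  whole orbit leaves the action of \<open>T\<close> along it and the span unchanged. The density
  assumption is applied to the space of finite combinations of that sequence.\<close>

lemma mixing_of_dense_orbits:
  fixes F :: "nat \<Rightarrow> int \<Rightarrow> 'u \<Rightarrow> complex"
  assumes good: "\<And>k. good_orbit (F k)"
    and dense: "\<And>V. subspace_in V \<Longrightarrow> (\<And>k. F k 0 \<in> closure_in V) \<Longrightarrow> closure_in V = H"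
  shows "strongly_mixing_gaussian \<T> T"
proof -
  have "\<exists>K B. \<forall>m. tame (K / (1 + (of_int m)\<^sup>2)) B (F k m)" for k
    using good [of k] by (simp add: good_orbit_def)
  then obtain K B where KB: "\<And>k m. tame (K k / (1 + (of_int m)\<^sup>2)) (B k) (F k m)" by metis
  have T_F: "T (F k m) = F k (m + 1)" for k m using good [of k] by (simp add: good_orbit_def)
  have K: "0 \<le> K k" for k using tame_nonneg(1) [OF KB, of k 0] by simp
  have B: "0 \<le> B k" for k using tame_nonneg(2) [OF KB] .
  \<comment> \<open>2^-k gives summability over the orbits, the denominator absorbs the orbit's
    constant, and exp(-k B_k) outweighs exp(B_k s) as soon as k \<ge> s. Thus one weight serves
    every seminorm.\<close>
  define a where "a k = (1 / 2) ^ k / (K k + 1) * exp (- (real k * B k))" for k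
  have a: "0 < a k" for k using K [of k] by (simp add: a_def add_nonneg_pos)
  define i where "i \<kappa> = fst (prod_decode \<kappa>)" for \<kappa>
  define m where "m \<kappa> = int_decode (snd (prod_decode \<kappa>))" for \<kappa>
  define code where "code k l = prod_encode (k, int_encode l)" for k l
  have code [simp]: "i (code k l) = k" "m (code k l) = l" "code (i \<kappa>) (m \<kappa>) = \<kappa>" for k l \<kappa>
    by (simp_all add: i_def m_def code_def)
  define x where "x \<kappa> = (\<lambda>y. complex_of_real (a (i \<kappa>)) * F (i \<kappa>) (m \<kappa>) y)" for \<kappa>
  define C where "C \<kappa> = a (i \<kappa>) * K (i \<kappa>) / (1 + (of_int (m \<kappa>))\<^sup>2)" for \<kappa>
  define b where "b s \<kappa> = C \<kappa> * exp (B (i \<kappa>) * s)" for s \<kappa>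
  \<comment> \<open>The predecessor on the orbit, as \<open>T\<close> maps the vector at
    \<open>\<pi> \<kappa>\<close> to the vector at \<open>\<kappa>\<close>.\<close>
  define \<pi> where "\<pi> \<kappa> = code (i \<kappa>) (m \<kappa> - 1)" for \<kappa>
  have C: "0 \<le> C \<kappa>" for \<kappa>
    unfolding C_def using a [of "i \<kappa>"] K by (intro divide_nonneg_nonneg mult_nonneg_nonneg) auto
  have tx: "tame (C \<kappa>) (B (i \<kappa>)) (x \<kappa>)" for \<kappa>
    using tame_scale [OF KB, of "complex_of_real (a (i \<kappa>))" "i \<kappa>" "m \<kappa>"] a [of "i \<kappa>"]
    by (simp add: x_def C_def)
  have xH: "x \<kappa> \<in> H" for \<kappa> by (rule tame_HbA(1) [OF tx])
  have FH: "F k l \<in> H" for k l by (rule tame_HbA(1) [OF KB])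
  have sm_b: "summable (b s)" if s: "0 < s" for s
  proof -
    let ?f = "\<lambda>k. a k * K k * exp (B k * s)" and ?g = "\<lambda>l. 1 / (1 + (of_int (int_decode l))\<^sup>2) :: real"
    have "summable ?f"
    proof (rule summable_comparison_test')
      show "summable (\<lambda>k. (1 / 2 :: real) ^ k)" by (rule summable_geometric) simp
      fix k assume k: "nat \<lceil>s\<rceil> \<le> k"
      have "B k * s \<le> real k * B k"
        using k mult_right_mono [OF _ B, of s "real k" k] by (simp add: mult.commute nat_le_iff ceiling_le_iff)
      then have "exp (- (real k * B k)) * exp (B k * s) \<le> 1" by (simp add: exp_add [symmetric])
      moreover have "K k / (K k + 1) \<le> 1" using K [of k] by simp
      ultimately have "(1 / 2) ^ k * (K k / (K k + 1)) * (exp (- (real k * B k)) * exp (B k * s)) \<le> (1 / 2) ^ k * 1 * 1"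
        using K [of k] by (intro mult_mono) auto
      moreover have "0 \<le> ?f k" using a [of k] K [of k] by simp
      then have "norm (?f k) = ?f k" by (simp only: real_norm_def abs_of_nonneg)
      ultimately show "norm (?f k) \<le> (1 / 2) ^ k" by (simp add: a_def mult_ac)
    qed
    then have "summable (\<lambda>\<kappa>. ?f (fst (prod_decode \<kappa>)) * ?g (snd (prod_decode \<kappa>)))"
      by (rule summable_prod_decode [OF _ summable_int_decode]) (use a K in \<open>auto simp: less_imp_le\<close>)
    then show ?thesis by (simp add: b_def [abs_def] C_def i_def m_def mult_ac)
  qed
  have \<pi>_pow: "(\<pi> ^^ N) \<kappa> = code (i \<kappa>) (m \<kappa> - int N)" for N \<kappa>
    by (induction N) (simp_all add: \<pi>_def algebra_simps)
  have tz: "tame (cmod (z \<kappa>) * C \<kappa>) (B (i \<kappa>)) (\<lambda>y. z \<kappa> * x \<kappa> y)" for z \<kappa>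
    by (rule tame_scale [OF tx])
  interpret orbit_series H p T x b \<pi>
  proof
    show "continuous_linear_operator \<T> T" by (rule T)
    show "x \<kappa> \<in> H" for \<kappa> by (rule xH)
    show "T (x (\<pi> \<kappa>)) = x \<kappa>" for \<kappa>
    proof -
      have "x (\<pi> \<kappa>) = (\<lambda>y. complex_of_real (a (i \<kappa>)) * F (i \<kappa>) (m \<kappa> - 1) y + 0 * F (i \<kappa>) (m \<kappa> - 1) y)"
        by (simp add: x_def \<pi>_def)
      then show ?thesis
        by (simp only: operator_lin [OF T FH FH] T_F) (simp add: x_def)
    qed
    show "bij \<pi>"
      by (rule o_bij [of "\<lambda>\<kappa>. code (i \<kappa>) (m \<kappa> + 1)"]) (auto simp: \<pi>_def fun_eq_iff)
    show "eventually (\<lambda>N. (\<pi> ^^ N) j \<noteq> k) sequentially" for j k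
      using eventually_gt_at_top [of "nat \<bar>m j - m k\<bar>"]
    proof eventually_elim
      case (elim N)
      have "m ((\<pi> ^^ N) j) \<noteq> m k" unfolding \<pi>_pow using elim by simp
      then show ?case by blast
    qed
    show "p s (x \<kappa>) \<le> b s \<kappa>" if "0 < s" for s \<kappa>
      unfolding b_def by (rule tame_HbA(2) [OF tx that])
    show "b s \<kappa> \<le> b t \<kappa>" if "0 < s" "s \<le> t" for s t \<kappa>
      unfolding b_def using that C B by (intro mult_left_mono) (auto intro: mult_left_mono)
    show "summable (b s)" if "0 < s" for s by (rule sm_b [OF that])
    fix z :: "nat \<Rightarrow> complex"
    assume "\<And>s. 0 < s \<Longrightarrow> summable (\<lambda>\<kappa>. cmod (z \<kappa>) * b s \<kappa>)"
    then have sm: "\<And>s. 0 < s \<Longrightarrow> summable (\<lambda>\<kappa>. cmod (z \<kappa>) * C \<kappa> * exp (B (i \<kappa>) * s))"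
      by (simp add: b_def mult.assoc)
    show "(\<lambda>y. \<Sum>\<kappa>. z \<kappa> * x \<kappa> y) \<in> H"
      by (rule tame_series(1) [OF tz [of z] sm])
    show "(\<lambda>N. p s (\<lambda>y. (\<Sum>\<kappa><N. z \<kappa> * x \<kappa> y) - (\<Sum>\<kappa>. z \<kappa> * x \<kappa> y))) \<longlonglongrightarrow> 0" if "0 < s" for s
      by (rule tame_series_limit [OF tz [of z] sm that])
  next
    fix f and s \<epsilon> :: real assume f: "f \<in> H" and s: "0 < s" and \<epsilon>: "0 < \<epsilon>"
    define V where "V = {f. \<exists>(N :: nat) a. f = (\<lambda>y. \<Sum>\<kappa><N. a \<kappa> * x \<kappa> y)}"
    have V: "subspace_in V" unfolding V_def by (rule subspace_finite_sums [OF xH])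
    have xV: "x \<kappa> \<in> V" for \<kappa>
      unfolding V_def by (intro CollectI exI [of _ "Suc \<kappa>"] exI [of _ "\<lambda>l. if l = \<kappa> then 1 else 0"])
        (simp add: if_distrib [of "\<lambda>c. c * _"] cong: if_cong)
    have "F k 0 \<in> closure_in V" for k
    proof -
      have "F k 0 = (\<lambda>y. (1 / complex_of_real (a k)) * x (code k 0) y)"
        using a [of k] by (simp add: x_def)
      then have "F k 0 \<in> V" by (simp only: subspace_scale [OF V xV])
      then show ?thesis using V closure_in_subset [of V] by (auto simp: subspace_in_def)
    qed
    then have "f \<in> closure_in V" using dense [OF V] f by blast
    then obtain g where "g \<in> V" "p s (\<lambda>y. f y - g y) < \<epsilon>"
      using s \<epsilon> unfolding closure_in_def by blast
    then show "\<exists>(N :: nat) a. p s (\<lambda>y. f y - (\<Sum>\<kappa><N. a \<kappa> * x \<kappa> y)) < \<epsilon>"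
      unfolding V_def by blast
  qed
  show ?thesis by (rule strongly_mixing)
qed

text \<open>For constant eigenvalue c the solutions of T f = c f form a subspace containing all
  exponentials, hence a dense one; the equation passes to limits because evaluations are
  continuous.\<close>

lemma nonconstant_eigenvalue:
  assumes ft: "\<And>k. norm_topology (function_space (A k E) (n k E)) closure_of finite_type E k = A k E"
    and nt: "\<not> trivial_operator \<T> T"
  obtains \<gamma> where "\<gamma> \<in> dual" "eig \<gamma> \<noteq> eig (\<lambda>y. 0)"
proof -
  have "\<exists>\<gamma>\<in>dual. eig \<gamma> \<noteq> eig (\<lambda>y. 0)"
  proof (rule ccontr)
    assume "\<not> ?thesis"
    then have const: "eig \<gamma> = eig (\<lambda>y. 0)" if "\<gamma> \<in> dual" for \<gamma> using that by blast
    let ?c = "eig (\<lambda>y. 0)"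
    define V where "V = {f \<in> H. T f = (\<lambda>y. ?c * f y)}"
    have VH: "V \<subseteq> H" by (auto simp: V_def)
    have "(\<lambda>y. a * f y + b * g y) \<in> V" if "f \<in> V" "g \<in> V" for f g a b
    proof -
      have "f \<in> H" "g \<in> H" "T f = (\<lambda>y. ?c * f y)" "T g = (\<lambda>y. ?c * g y)" using that by (auto simp: V_def)
      then show ?thesis
        unfolding V_def using operator_lin [OF T, of f g a b] lin_closed [of f g a b]
        by (simp add: algebra_simps)
    qed
    moreover have "(\<lambda>y. 0) \<in> V"
      unfolding V_def by (simp add: zero_closed operator_zero [OF T])
    ultimately have V: "subspace_in V" unfolding subspace_in_def using VH by blast
    have "expo \<gamma> \<in> closure_in V" if \<gamma>: "\<gamma> \<in> dual" for \<gamma>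
    proof -
      have "expo \<gamma> \<in> V" unfolding V_def using expo_in_H [OF \<gamma>] T_expo [OF \<gamma>] const [OF \<gamma>] by simp
      then show ?thesis using closure_in_subset [OF VH] by blast
    qed
    then have cl: "closure_in V = H" by (rule exponentials_dense [OF ft V])
    have "T f = (\<lambda>y. ?c * f y)" if f: "f \<in> H" for f
    proof
      fix y
      obtain F where F: "\<And>N :: nat. F N \<in> V" and lim: "limitin \<T> F f sequentially"
        using closure_in_sequence [OF _ VH, of f] f cl by blast
      have FH: "F N \<in> H" for N using F VH by blast
      have "(\<lambda>N. F N y) \<longlonglongrightarrow> f y" by (rule limitin_pointwise [OF f FH lim])
      then have "(\<lambda>N. ?c * F N y) \<longlonglongrightarrow> ?c * f y" by (rule tendsto_mult_left)
      moreover have "(\<lambda>N. T (F N) y) \<longlonglongrightarrow> T f y"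
        by (rule limitin_pointwise [OF operator_closed [OF T f] operator_closed [OF T FH] operator_limit [OF T lim]])
      moreover have "T (F N) y = ?c * F N y" for N using F [of N] by (simp add: V_def)
      ultimately show "T f y = ?c * f y" by (simp add: LIMSEQ_unique)
    qed
    then show False using nt unfolding trivial_operator_def by auto
  qed
  then show ?thesis using that by blast
qed

text \<open>The directions to avoid are the kernel of the nonzero linear functional
  \<open>deig \<gamma>\<close>. Small multiples of the regular direction \<open>\<eta>\<close> push
  a countable dense set out of it.\<close>

lemma dense_regular_directions:
  assumes sep: "separable_space (norm_topology (dual_space E))"
    and \<gamma>: "\<gamma> \<in> dual" and \<eta>: "\<eta> \<in> dual" and reg: "deig \<gamma> \<eta> \<noteq> 0"
  obtains d :: "nat \<Rightarrow> 'u \<Rightarrow> complex" where "\<And>i. d i \<in> dual" "\<And>i. deig \<gamma> (d i) \<noteq> 0"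
    "\<And>\<delta> r. \<delta> \<in> dual \<Longrightarrow> 0 < r \<Longrightarrow> \<exists>i. dnorm (\<lambda>y. d i y - \<delta> y) < r"
proof -
  interpret D: complex_normed_space "dual_space E" by (rule dual_normed)
  have dist: "D.mball \<delta> r = {\<beta> \<in> dual. dnorm (\<lambda>y. \<beta> y - \<delta> y) < r}" if "\<delta> \<in> dual" for \<delta> r
  proof -
    have "vdist (dual_space E) \<beta> \<delta> = dnorm (\<lambda>y. \<beta> y - \<delta> y)" if "\<beta> \<in> dual" for \<beta>
      using that \<open>\<delta> \<in> dual\<close> unfolding dual_space_def by (simp add: vdist_function_space)
    then show ?thesis using that by (auto simp: D.commute [of \<delta>])
  qed
  obtain C where C: "countable C" "C \<subseteq> dual" "D.mtopology closure_of C = dual"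
    using sep by (auto simp: separable_space_def norm_topology_def)
  have near: "\<exists>\<beta>\<in>C. dnorm (\<lambda>y. \<beta> y - \<delta> y) < r" if \<delta>: "\<delta> \<in> dual" and r: "0 < r" for \<delta> r
  proof -
    have "\<delta> \<in> D.mtopology closure_of C" using \<delta> C by simp
    then obtain \<beta> where "\<beta> \<in> C" "\<beta> \<in> D.mball \<delta> r" unfolding D.metric_closure_of using r by blast
    then show ?thesis unfolding dist [OF \<delta>] by blast
  qed
  have "C \<noteq> {}" using near [OF dual_zero zero_less_one] by blast
  then obtain c :: "nat \<Rightarrow> 'u \<Rightarrow> complex" where c: "range c = C"
    using C(1) by (metis range_from_nat_into)
  have cD: "c i \<in> dual" for i using c C by blast
  define e where "e i m = (\<lambda>y. c i y + (1 / of_nat (Suc m)) * \<eta> y)" for i m :: nat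
  have eD: "e i m \<in> dual" for i m unfolding e_def by (rule dual_line [OF cD \<eta>])
  \<comment> \<open>Perturbations that still lie in the kernel are replaced by
    \<open>\<eta>\<close>, so the sequence keeps every usable perturbation and gains only a regular
    direction.\<close>
  define d where "d k = (case prod_decode k of (i, m) \<Rightarrow> if deig \<gamma> (e i m) = 0 then \<eta> else e i m)" for k
  have "\<exists>k. dnorm (\<lambda>y. d k y - \<delta> y) < r" if \<delta>: "\<delta> \<in> dual" and r: "0 < r" for \<delta> r
  proof -
    have r2: "0 < r / 2" using r by simp
    obtain i where i: "dnorm (\<lambda>y. c i y - \<delta> y) < r / 2" using near [OF \<delta> r2] c by blast
    have "(\<lambda>m. 1 / real (Suc m) * dnorm \<eta>) \<longlonglongrightarrow> 0"
      by (rule tendsto_mult_left_zero [OF LIMSEQ_Suc [OF lim_1_over_n]])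
    then have "eventually (\<lambda>m. 1 / real (Suc m) * dnorm \<eta> < r / 2) sequentially"
      by (rule order_tendstoD(2)) (rule r2)
    then obtain m0 where m0: "\<And>m. m0 \<le> m \<Longrightarrow> 1 / real (Suc m) * dnorm \<eta> < r / 2"
      unfolding eventually_sequentially by blast
    \<comment> \<open>Along the perturbation \<open>deig\<close> is affine with nonzero slope, so it
      cannot vanish at two consecutive indices.\<close>
    have "\<exists>m\<ge>m0. deig \<gamma> (e i m) \<noteq> 0"
    proof (rule ccontr)
      assume "\<not> ?thesis"
      then have "deig \<gamma> (e i m0) = 0" "deig \<gamma> (e i (Suc m0)) = 0" by auto
      then have "1 / of_nat (Suc m0) * deig \<gamma> \<eta> = 1 / of_nat (Suc (Suc m0)) * deig \<gamma> \<eta>"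
        unfolding e_def deig_add_scale [OF \<gamma> cD \<eta>] by (metis add_left_cancel)
      then have "of_nat (Suc m0) = (of_nat (Suc (Suc m0)) :: complex)"
        using reg by (simp add: divide_simps del: of_nat_Suc split: if_splits)
      then show False by simp
    qed
    then obtain m where m: "m0 \<le> m" "deig \<gamma> (e i m) \<noteq> 0" by blast
    have "(\<lambda>y. c i y - \<delta> y) \<in> dual" using dual_lin(1) [OF cD \<delta>, of 1 i "-1"] by simp
    from dual_lin(2) [OF this \<eta>, of 1 "1 / of_nat (Suc m)"]
    have "dnorm (\<lambda>y. e i m y - \<delta> y) \<le> dnorm (\<lambda>y. c i y - \<delta> y) + 1 / real (Suc m) * dnorm \<eta>"
      by (simp add: e_def algebra_simps norm_divide del: of_nat_Suc)
    also have "\<dots> < r / 2 + r / 2" using i m0 [OF m(1)] by (rule add_strict_mono)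
    also have "r / 2 + r / 2 = r" by simp
    finally have "dnorm (\<lambda>y. d (prod_encode (i, m)) y - \<delta> y) < r" using m by (simp add: d_def)
    then show ?thesis by blast
  qed
  moreover have "d k \<in> dual" "deig \<gamma> (d k) \<noteq> 0" for k
    using eD \<eta> reg by (auto simp: d_def split: prod.splits)
  ultimately show ?thesis using that by blast
qed

theorem strongly_mixing_convolution:
  assumes ft: "\<And>k. norm_topology (function_space (A k E) (n k E)) closure_of finite_type E k = A k E"
    and sep: "separable_space (norm_topology (dual_space E))"
    and nt: "\<not> trivial_operator \<T> T"
  shows "strongly_mixing_gaussian \<T> T"
proof -
  obtain \<eta> where \<eta>: "\<eta> \<in> dual" "eig \<eta> \<noteq> eig (\<lambda>y. 0)" by (rule nonconstant_eigenvalue [OF ft nt])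
  obtain \<gamma> where \<gamma>: "\<gamma> \<in> dual" and uni: "cmod (eig \<gamma>) = 1" and reg: "deig \<gamma> \<eta> \<noteq> 0"
    by (rule unimodular_eigenvalue [OF \<eta>])
  obtain d :: "nat \<Rightarrow> 'u \<Rightarrow> complex" where d: "\<And>i. d i \<in> dual" "\<And>i. deig \<gamma> (d i) \<noteq> 0"
    and d_dense: "\<And>\<delta> r. \<delta> \<in> dual \<Longrightarrow> 0 < r \<Longrightarrow> \<exists>i. dnorm (\<lambda>y. d i y - \<delta> y) < r"
    by (rule dense_regular_directions [OF sep \<gamma> \<eta>(1) reg]) blast
  define P where "P i x w \<longleftrightarrow> (\<forall>q l. good_orbit (x q l)) \<and> (\<forall>q. w q \<noteq> 0) \<and> w \<longlonglongrightarrow> 0 \<and>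
      (\<forall>q s \<epsilon>. 0 < s \<longrightarrow> 0 < \<epsilon> \<longrightarrow> (\<exists>l. p s (\<lambda>y. expo (\<lambda>y. \<gamma> y + w q * d i y) y - x q l 0 y) < \<epsilon>))"
    for i and x :: "nat \<Rightarrow> nat \<Rightarrow> int \<Rightarrow> 'u \<Rightarrow> complex" and w :: "nat \<Rightarrow> complex"
  have "\<exists>x w. P i x w" for i
  proof -
    obtain x :: "nat \<Rightarrow> nat \<Rightarrow> int \<Rightarrow> 'u \<Rightarrow> complex" and w :: "nat \<Rightarrow> complex"
      where "\<And>q l. good_orbit (x q l)" "\<And>q. w q \<noteq> 0" "w \<longlonglongrightarrow> 0"
        "\<And>q s \<epsilon>. 0 < s \<Longrightarrow> 0 < \<epsilon> \<Longrightarrow> \<exists>l. p s (\<lambda>y. expo (\<lambda>y. \<gamma> y + w q * d i y) y - x q l 0 y) < \<epsilon>"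
      by (rule orbits_exist [OF \<gamma> d(1) uni d(2)]) blast
    then have "P i x w" unfolding P_def by simp
    then show ?thesis by blast
  qed
  then obtain X W where XW: "\<And>i. P i (X i) (W i)" by metis
  define F where "F k = (case prod_decode k of (i, r) \<Rightarrow> case prod_decode r of (q, l) \<Rightarrow> X i q l)" for k
  have FX: "F (prod_encode (i, prod_encode (q, l))) = X i q l" for i q l by (simp add: F_def)
  show ?thesis
  proof (rule mixing_of_dense_orbits)
    show "good_orbit (F k)" for k
      using XW by (auto simp: F_def P_def split: prod.splits)
    fix V assume V: "subspace_in V" and FV: "\<And>k. F k 0 \<in> closure_in V"
    have VH: "V \<subseteq> H" using V by (simp add: subspace_in_def)
    have XV: "X i q l 0 \<in> closure_in V" for i q l using FV FX by metis
    have curve: "expo (\<lambda>y. \<gamma> y + W i q * d i y) \<in> closure_in V" for i q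
    proof -
      have "\<exists>g\<in>closure_in V. p s (\<lambda>y. expo (\<lambda>y. \<gamma> y + W i q * d i y) y - g y) < \<epsilon>" if "0 < s" "0 < \<epsilon>" for s \<epsilon>
        using XW [of i] XV that unfolding P_def by blast
      then have "expo (\<lambda>y. \<gamma> y + W i q * d i y) \<in> closure_in (closure_in V)"
        unfolding closure_in_def [of "closure_in V"] using expo_in_H [OF dual_line [OF \<gamma> d(1)]] by simp
      then show ?thesis by (simp only: closure_in_idem [OF VH])
    qed
    \<comment> \<open>The parameters \<open>W i q\<close> accumulate at 0, which gives all jets at
      \<open>\<gamma>\<close> in direction \<open>d i\<close>; their series is then summed at
      parameter 1.\<close>
    have line: "expo (\<lambda>y. \<gamma> y + 1 * d i y) \<in> closure_in V" for i
    proof (rule expo_in_closure [OF \<gamma> d(1) V], rule jets_in_closure [OF \<gamma> d(1) V _ _ curve])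
      show "W i q \<noteq> 0" "W i \<longlonglongrightarrow> 0" for q using XW [of i] by (simp_all add: P_def)
    qed
    have "expo \<beta> \<in> closure_in V" if \<beta>: "\<beta> \<in> dual" for \<beta>
    proof -
      have "\<exists>g\<in>closure_in V. p s (\<lambda>y. expo \<beta> y - g y) < \<epsilon>" if s: "0 < s" and \<epsilon>: "0 < \<epsilon>" for s \<epsilon>
      proof -
        obtain r where r: "0 < r"
          "\<And>\<delta>. \<delta> \<in> dual \<Longrightarrow> dnorm \<delta> < r \<Longrightarrow> p s (\<lambda>y. expo \<beta> y - expo (\<lambda>y. \<beta> y + \<delta> y) y) < \<epsilon>"
          by (rule expo_continuous [OF \<beta> s \<epsilon>]) blast
        \<comment> \<open>The base point stays fixed: \<open>\<beta>\<close> is reached from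
          \<open>\<gamma>\<close> by approximating the difference by one of the directions.\<close>
        have diff: "(\<lambda>y. \<beta> y - \<gamma> y) \<in> dual" using dual_lin(1) [OF \<beta> \<gamma>, of 1 "-1"] by simp
        then obtain i where i: "dnorm (\<lambda>y. d i y - (\<beta> y - \<gamma> y)) < r" using d_dense r(1) by blast
        have "(\<lambda>y. d i y - (\<beta> y - \<gamma> y)) \<in> dual" using dual_lin(1) [OF d(1) diff, of 1 i "-1"] by (simp add: algebra_simps)
        from r(2) [OF this i]
        have "p s (\<lambda>y. expo \<beta> y - expo (\<lambda>y. \<gamma> y + 1 * d i y) y) < \<epsilon>" by (simp add: add.commute)
        then show ?thesis using line by blast
      qed
      then have "expo \<beta> \<in> closure_in (closure_in V)"
        unfolding closure_in_def [of "closure_in V"] using expo_in_H [OF \<beta>] by simp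
      then show ?thesis by (simp only: closure_in_idem [OF VH])
    qed
    then show "closure_in V = H" by (rule exponentials_dense [OF ft V])
  qed
qed

end

text \<open>On the zero space a function vanishing off the carrier is determined by its value at one
  point, so the function space has dimension at most one and every linear operator is a scalar. A
  non-trivial operator therefore forces a nonzero vector in \<open>E\<close>.\<close>

lemma zero_space_trivial_operator:
  assumes E: "vcarrier E = {vzero E}" and T: "continuous_linear_operator (HbA_topology A n E) T"
  shows "trivial_operator (HbA_topology A n E) T"
proof -
  let ?S = "topspace (HbA_topology A n E)"
  have S: "?S \<subseteq> HbA A n E"
    by (auto simp: HbA_topology_def topology_generated_by_topspace)
  then have off: "f y = 0" if "f \<in> ?S" "y \<noteq> vzero E" for f y
    using that E by (auto simp: HbA_def holomorphic_functions_def)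
  have lin: "T (\<lambda>x. a * f x + b * g x) = (\<lambda>x. a * T f x + b * T g x)" if "f \<in> ?S" "g \<in> ?S" for f g a b
    using T that unfolding continuous_linear_operator_def by blast
  have TS: "T f \<in> ?S" if "f \<in> ?S" for f
    using T that continuous_map_image_subset_topspace unfolding continuous_linear_operator_def by blast
  show ?thesis
  proof (cases "\<exists>f\<in>?S. f (vzero E) \<noteq> 0")
    case True
    then obtain e where e: "e \<in> ?S" "e (vzero E) \<noteq> 0" by blast
    have "T e = (\<lambda>x. T e (vzero E) / e (vzero E) * e x)"
    proof
      fix x show "T e x = T e (vzero E) / e (vzero E) * e x"
        using e off [OF e(1)] off [OF TS [OF e(1)]] by (cases "x = vzero E") auto
    qed
    then obtain c where Te: "T e = (\<lambda>x. c * e x)" by blast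
    have "T f = (\<lambda>x. c * f x)" if f: "f \<in> ?S" for f
    proof -
      have "f = (\<lambda>x. (f (vzero E) / e (vzero E)) * e x + 0 * e x)"
      proof
        fix x show "f x = (f (vzero E) / e (vzero E)) * e x + 0 * e x"
          using e off [OF e(1)] off [OF f] by (cases "x = vzero E") auto
      qed
      then obtain a where a: "f = (\<lambda>x. a * e x + 0 * e x)" by blast
      show ?thesis unfolding a lin [OF e(1) e(1)] Te by (simp add: fun_eq_iff)
    qed
    then show ?thesis unfolding trivial_operator_def by blast
  next
    case False
    then have z: "g (vzero E) = 0" if "g \<in> ?S" for g using that by blast
    have "T f = (\<lambda>x. 1 * f x)" if f: "f \<in> ?S" for f
    proof
      fix x show "T f x = 1 * f x"
        using z [OF f] z [OF TS [OF f]] off [OF f] off [OF TS [OF f]] by (cases "x = vzero E") simp_all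
    qed
    then show ?thesis unfolding trivial_operator_def by blast
  qed
qed

theorem theorem2p5:
  fixes E :: "'u cnormed"
    and A :: "nat \<Rightarrow> 'u cnormed \<Rightarrow> ('u \<Rightarrow> complex) set"
    and n :: "nat \<Rightarrow> 'u cnormed \<Rightarrow> ('u \<Rightarrow> complex) \<Rightarrow> real"
    and T :: "('u \<Rightarrow> complex) \<Rightarrow> ('u \<Rightarrow> complex)"
  assumes "holomorphy_type A n"
    and "complex_banach E"
    and "separable_space (norm_topology (dual_space E))"
    and "\<And>k. norm_topology (function_space (A k E) (n k E)) closure_of finite_type E k = A k E"
    and "convolution_operator A n E T"
    and "\<not> trivial_operator (HbA_topology A n E) T"
  shows "strongly_mixing_gaussian (HbA_topology A n E) T"
proof -
  interpret E: complex_banach E by (rule assms(2))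
  have T: "continuous_linear_operator (HbA_topology A n E) T"
    using assms(5) by (simp add: convolution_operator_def)
  have "vcarrier E \<noteq> {vzero E}" using zero_space_trivial_operator [OF _ T] assms(6) by blast
  then have "\<exists>v\<in>vcarrier E. v \<noteq> vzero E" using E.zero_closed by blast
  moreover have "banach_ideal k (A k) (n k)" for k using assms(1) by (simp add: holomorphy_type_def)
  ultimately interpret poly_ideals E A n by unfold_locales blast+
  interpret convolution E A n T
  proof
    show "continuous_linear_operator \<T> T" using T by (simp only: HbA_topology_eq)
    show "T (translation E x f) = translation E x (T f)" if "x \<in> vcarrier E" "f \<in> H" for x f
      using assms(5) that by (simp add: convolution_operator_def)
  qed
  show ?thesis
    unfolding HbA_topology_eq
    by (rule strongly_mixing_convolution [OF assms(4) assms(3) assms(6) [unfolded HbA_topology_eq]])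
qed

end
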